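(* Let $n\ge 0$ be an integer and let $L$ be a simplicial complex with finite vertex set such that $s_2\chi(L^1)\leq n$. Then $A(n,L)\otimes \mathbb{Z}/2$ has an $\mathcal{A}_2$ action.
   Context: Let $\Delta^{n-1}$ be the full simplex on the vertex set $\{x_1,\dots,x_n\}$, let $L$ have vertex set $\{y_1,\dots,y_m\}$, and let $K=\Delta^{n-1}\ast L=\{\sigma\cup\tau\mid \sigma\in\Delta^{n-1},\tau\in L\}$ be the join (complexes contain the empty simplex). Then $A(n,L)$ is the graded Stanley-Reisner ring $\mathbb{Z}[x_1,\dots,x_n,y_1,\dots,y_m]/I_K$ with degrees $|x_i|=4$, $|y_j|=6$, where $I_K$ is the ideal generated by the square-free monomials $v_1\cdots v_k$ with $\{v_1,\dots,v_k\}\notin K$. The $1$-skeleton $L^1$ is regarded as a graph on $\{y_1,\dots,y_m\}$. An $n$-span colouring of a graph $G$ over a field $\mathbf{k}$ is a function assigning to each vertex $x$ a pair $(U_x,V_x)$ of a $1$-dimensional subspace $U_x$ and an $(n-1)$-dimensional subspace $V_x$ of $\mathbf{k}^n$ such that $U_x\not\subset V_x$ for every vertex $x$, and $U_x\subset V_y$, $U_y\subset V_x$ for every edge $(x,y)$. The span chromatic number $s_{\mathbf{k}}\chi(G)$ is the least $n$ for which one exists, and $s_2\chi=s_{\mathbb{Z}/2}\chi$. $\mathcal{A}_2$ is the mod-$2$ Steenrod algebra. An $\mathcal{A}_2$ action on a commutative graded unital $\mathbb{Z}/2$-algebra $A^*$ always means a graded $\mathcal{A}_2$-module structure that satisfies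 the Cartan formula $\mathrm{Sq}^k(xy)=\sum_{0\le i\le k}\mathrm{Sq}^i(x)\mathrm{Sq}^{k-i}(y)$ (with $\mathrm{Sq}^0=\mathrm{id}$) and is unstable: for $x\in A^d$, $\mathrm{Sq}^d(x)=x^2$ and $\mathrm{Sq}^k(x)=0$ for $k>d$. *)

theory Defs
  imports
    "HOL-Library.Z2"
    "HOL-Library.Extended_Nat"
    "HOL-Library.Function_Algebras"
    "HOL-Library.Poly_Mapping"
    "HOL-Algebra.Algebra"
    "HOL-Algebra.Algebraic_Closure_Type"
begin

section \<open>Simplicial complexes\<close>

text \<open>
  A simplicial complex on the vertex set \<open>W\<close>. It contains the empty simplex. The
  singletons of \<open>W\<close> are not required to be simplices.
\<close>

definition simplicial_complex_on :: "'v set \<Rightarrow> 'v set set \<Rightarrow> bool" where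
  "simplicial_complex_on W K \<longleftrightarrow>
     {} \<in> K \<and> (\<forall>\<sigma>\<in>K. finite \<sigma> \<and> \<sigma> \<subseteq> W) \<and> (\<forall>\<sigma>\<in>K. \<forall>\<tau>. \<tau> \<subseteq> \<sigma> \<longrightarrow> \<tau> \<in> K)"

definition skeleton_edges :: "'v set set \<Rightarrow> 'v set set" where
  "skeleton_edges L = {e \<in> L. card e = 2}"

definition complex_join :: "'v set set \<Rightarrow> 'v set set \<Rightarrow> 'v set set" where
  "complex_join K L = {\<sigma> \<union> \<tau> | \<sigma> \<tau>. \<sigma> \<in> K \<and> \<tau> \<in> L}"


section \<open>Span colourings\<close>

text \<open>
  The space \<open>k\<^sup>n\<close> is the set of sequences over \<open>k\<close> that vanish from index \<open>n\<close> on, inside the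
  vector space of all sequences.
\<close>

definition seq_scale :: "'k::field \<Rightarrow> (nat \<Rightarrow> 'k) \<Rightarrow> nat \<Rightarrow> 'k" where
  "seq_scale c v = (\<lambda>i. c * v i)"

global_interpretation seq_space: vector_space "seq_scale :: 'k::field \<Rightarrow> (nat \<Rightarrow> 'k) \<Rightarrow> nat \<Rightarrow> 'k"
  by unfold_locales (auto simp: seq_scale_def fun_eq_iff algebra_simps)

definition coord_space :: "nat \<Rightarrow> (nat \<Rightarrow> 'k::field) set" where
  "coord_space n = {v. \<forall>i\<ge>n. v i = 0}"

definition coord_subspace :: "nat \<Rightarrow> nat \<Rightarrow> (nat \<Rightarrow> 'k::field) set \<Rightarrow> bool" where
  "coord_subspace n d U \<longleftrightarrow> U \<subseteq> coord_space n \<and> seq_space.subspace U \<and> seq_space.dim U = d"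

text \<open>
  The graph has vertex set \<open>V\<close>, and its edges are the two-element sets in \<open>E\<close>. The dimension
  \<open>n - 1\<close> is truncated at \<open>n = 0\<close>, where no vertex can be coloured because there is no
  1-dimensional subspace.
\<close>

definition span_colouring ::
    "nat \<Rightarrow> 'v set \<Rightarrow> 'v set set \<Rightarrow> ('v \<Rightarrow> (nat \<Rightarrow> 'k::field) set \<times> (nat \<Rightarrow> 'k) set) \<Rightarrow> bool" where
  "span_colouring n V E c \<longleftrightarrow>
     (\<forall>x\<in>V. coord_subspace n 1 (fst (c x)) \<and> coord_subspace n (n - 1) (snd (c x)) \<and>
            \<not> fst (c x) \<subseteq> snd (c x)) \<and>
     (\<forall>x\<in>V. \<forall>y\<in>V. {x, y} \<in> E \<and> x \<noteq> y \<longrightarrow> fst (c x) \<subseteq> snd (c y) \<and> fst (c y) \<subseteq> snd (c x))"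

text \<open>The value is \<open>\<infinity>\<close> if there is no span colouring at all (impossible for a finite graph).\<close>

definition span_chromatic_number :: "'k::field itself \<Rightarrow> 'v set \<Rightarrow> 'v set set \<Rightarrow> enat" where
  "span_chromatic_number _ V E =
     Inf {enat n | n. \<exists>c :: 'v \<Rightarrow> (nat \<Rightarrow> 'k) set \<times> (nat \<Rightarrow> 'k) set. span_colouring n V E c}"


section \<open>The graded Stanley-Reisner ring\<close>

text \<open>
  Polynomials are finitely supported functions from monomials to coefficients, and a monomial is
  the finitely supported function of its exponents.
\<close>

definition int_poly_ring :: "'w set \<Rightarrow> (('w \<Rightarrow>\<^sub>0 nat) \<Rightarrow>\<^sub>0 int) ring" where
  "int_poly_ring W =
     (ring_of_type_algebra :: (('w \<Rightarrow>\<^sub>0 nat) \<Rightarrow>\<^sub>0 int) ring)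
       \<lparr>carrier := {p. \<forall>m\<in>Poly_Mapping.keys p. Poly_Mapping.keys m \<subseteq> W}\<rparr>"

definition indet :: "'w \<Rightarrow> ('w \<Rightarrow>\<^sub>0 nat) \<Rightarrow>\<^sub>0 int" where
  "indet v = Poly_Mapping.single (Poly_Mapping.single v 1) 1"

definition stanley_reisner_ideal :: "'w set \<Rightarrow> 'w set set \<Rightarrow> (('w \<Rightarrow>\<^sub>0 nat) \<Rightarrow>\<^sub>0 int) set" where
  "stanley_reisner_ideal W K =
     genideal (int_poly_ring W) {\<Prod>v\<in>\<sigma>. indet v | \<sigma>. finite \<sigma> \<and> \<sigma> \<subseteq> W \<and> \<sigma> \<notin> K}"

definition stanley_reisner_ring :: "'w set \<Rightarrow> 'w set set \<Rightarrow> (('w \<Rightarrow>\<^sub>0 nat) \<Rightarrow>\<^sub>0 int) set ring" where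
  "stanley_reisner_ring W K = int_poly_ring W Quot stanley_reisner_ideal W K"

definition monomial_degree :: "('w \<Rightarrow> nat) \<Rightarrow> ('w \<Rightarrow>\<^sub>0 nat) \<Rightarrow> nat" where
  "monomial_degree wt m = (\<Sum>v\<in>Poly_Mapping.keys m. Poly_Mapping.lookup m v * wt v)"

definition stanley_reisner_component ::
    "'w set \<Rightarrow> 'w set set \<Rightarrow> ('w \<Rightarrow> nat) \<Rightarrow> nat \<Rightarrow> (('w \<Rightarrow>\<^sub>0 nat) \<Rightarrow>\<^sub>0 int) set set" where
  "stanley_reisner_component W K wt d =
     {stanley_reisner_ideal W K +>\<^bsub>int_poly_ring W\<^esub> p | p.
        p \<in> carrier (int_poly_ring W) \<and> (\<forall>m\<in>Poly_Mapping.keys p. monomial_degree wt m = d)}"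

datatype 'v vertex = XVar nat | YVar 'v

definition A_vertices :: "nat \<Rightarrow> 'v set \<Rightarrow> 'v vertex set" where
  "A_vertices n V = XVar ` {1..n} \<union> YVar ` V"

definition A_complex :: "nat \<Rightarrow> 'v set set \<Rightarrow> 'v vertex set set" where
  "A_complex n L = complex_join (Pow (XVar ` {1..n})) ((`) YVar ` L)"

fun A_degree :: "'v vertex \<Rightarrow> nat" where
  "A_degree (XVar i) = 4"
| "A_degree (YVar v) = 6"

definition A_ring :: "nat \<Rightarrow> 'v set \<Rightarrow> 'v set set \<Rightarrow> (('v vertex \<Rightarrow>\<^sub>0 nat) \<Rightarrow>\<^sub>0 int) set ring" where
  "A_ring n V L = stanley_reisner_ring (A_vertices n V) (A_complex n L)"

definition A_component ::
    "nat \<Rightarrow> 'v set \<Rightarrow> 'v set set \<Rightarrow> nat \<Rightarrow> (('v vertex \<Rightarrow>\<^sub>0 nat) \<Rightarrow>\<^sub>0 int) set set" where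
  "A_component n V L = stanley_reisner_component (A_vertices n V) (A_complex n L) A_degree"


section \<open>Monoid rings\<close>

text \<open>
  The library multiplication on finitely supported functions is the convolution for the
  type class \<open>monoid_add\<close>; here the monoid is a record with a carrier.
\<close>

definition monoid_ring :: "('g, 'x) monoid_scheme \<Rightarrow> ('g \<Rightarrow>\<^sub>0 'a::ring_1) ring" where
  "monoid_ring G =
     \<lparr>carrier = {p. Poly_Mapping.keys p \<subseteq> carrier G},
      monoid.mult = (\<lambda>p q. \<Sum>s\<in>Poly_Mapping.keys p. \<Sum>t\<in>Poly_Mapping.keys q.
        Poly_Mapping.single (s \<otimes>\<^bsub>G\<^esub> t) (Poly_Mapping.lookup p s * Poly_Mapping.lookup q t)),
      one = Poly_Mapping.single \<one>\<^bsub>G\<^esub> 1,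
      ring.zero = 0,
      ring.add = (+)\<rparr>"


section \<open>Tensor products of commutative rings over the integers\<close>

text \<open>
  The tensor product is the quotient of the free abelian group on pairs, which is the monoid ring
  of the product of the multiplicative monoids, by the bilinearity relations. A product of a pair
  and a bilinearity relation is again a bilinearity relation, so the ideal and the subgroup
  generated by these relations coincide.
\<close>

definition tensor_relations ::
    "('a, 'x) ring_scheme \<Rightarrow> ('b, 'y) ring_scheme \<Rightarrow> ('a \<times> 'b \<Rightarrow>\<^sub>0 int) set" where
  "tensor_relations A B =
     {Poly_Mapping.single (a \<oplus>\<^bsub>A\<^esub> a', b) 1 - Poly_Mapping.single (a, b) 1
        - Poly_Mapping.single (a', b) 1 | a a' b.
        a \<in> carrier A \<and> a' \<in> carrier A \<and> b \<in> carrier B} \<union>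
     {Poly_Mapping.single (a, b \<oplus>\<^bsub>B\<^esub> b') 1 - Poly_Mapping.single (a, b) 1
        - Poly_Mapping.single (a, b') 1 | a b b'.
        a \<in> carrier A \<and> b \<in> carrier B \<and> b' \<in> carrier B}"

definition tensor_ideal ::
    "('a, 'x) ring_scheme \<Rightarrow> ('b, 'y) ring_scheme \<Rightarrow> ('a \<times> 'b \<Rightarrow>\<^sub>0 int) set" where
  "tensor_ideal A B = genideal (monoid_ring (A \<times>\<times> B)) (tensor_relations A B)"

definition tensor_ring ::
    "('a, 'x) ring_scheme \<Rightarrow> ('b, 'y) ring_scheme \<Rightarrow> ('a \<times> 'b \<Rightarrow>\<^sub>0 int) set ring" where
  "tensor_ring A B = monoid_ring (A \<times>\<times> B) Quot tensor_ideal A B"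

definition pure_tensor ::
    "('a, 'x) ring_scheme \<Rightarrow> ('b, 'y) ring_scheme \<Rightarrow> 'a \<Rightarrow> 'b \<Rightarrow> ('a \<times> 'b \<Rightarrow>\<^sub>0 int) set" where
  "pure_tensor A B a b =
     tensor_ideal A B +>\<^bsub>monoid_ring (A \<times>\<times> B)\<^esub> Poly_Mapping.single (a, b) 1"

abbreviation Z_mod_2 :: "bit ring" where
  "Z_mod_2 \<equiv> ring_of_type_algebra"

definition A_mod_2 ::
    "nat \<Rightarrow> 'v set \<Rightarrow> 'v set set \<Rightarrow> ((('v vertex \<Rightarrow>\<^sub>0 nat) \<Rightarrow>\<^sub>0 int) set \<times> bit \<Rightarrow>\<^sub>0 int) set ring" where
  "A_mod_2 n V L = tensor_ring (A_ring n V L) Z_mod_2"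

definition A_mod_2_component ::
    "nat \<Rightarrow> 'v set \<Rightarrow> 'v set set \<Rightarrow> nat \<Rightarrow> ((('v vertex \<Rightarrow>\<^sub>0 nat) \<Rightarrow>\<^sub>0 int) set \<times> bit \<Rightarrow>\<^sub>0 int) set set"
  where
  "A_mod_2_component n V L d =
     generate (add_monoid (A_mod_2 n V L))
       {pure_tensor (A_ring n V L) Z_mod_2 a b | a b. a \<in> A_component n V L d \<and> b \<in> carrier Z_mod_2}"


section \<open>The mod 2 Steenrod algebra\<close>

text \<open>
  A list \<open>[i\<^sub>1, \<dots>, i\<^sub>r]\<close> stands for the product of \<open>Sq\<close> of \<open>i\<^sub>1\<close>, \<open>\<dots>\<close>, \<open>Sq\<close> of \<open>i\<^sub>r\<close>, in this order, in the
  free associative algebra over \<open>\<int>/2\<close> on the symbols \<open>Sq\<^sup>i\<close> with \<open>i \<ge> 0\<close>.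
\<close>

definition sq_words :: "nat list monoid" where
  "sq_words = \<lparr>carrier = UNIV, monoid.mult = (@), one = []\<rparr>"

abbreviation free_sq_algebra :: "(nat list \<Rightarrow>\<^sub>0 bit) ring" where
  "free_sq_algebra \<equiv> monoid_ring sq_words"

text \<open>
  The Adem relation for \<open>0 < a < 2 b\<close>. The natural number subtractions are never truncated,
  since \<open>2 c \<le> a\<close> and \<open>c < b\<close>.
\<close>

definition adem_relation :: "nat \<Rightarrow> nat \<Rightarrow> nat list \<Rightarrow>\<^sub>0 bit" where
  "adem_relation a b =
     Poly_Mapping.single [a, b] 1 -
     (\<Sum>c = 0..a div 2. Poly_Mapping.single [a + b - c, c] (of_nat ((b - c - 1) choose (a - 2 * c))))"

definition steenrod_ideal :: "(nat list \<Rightarrow>\<^sub>0 bit) set" where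
  "steenrod_ideal =
     genideal free_sq_algebra
       (insert (Poly_Mapping.single [0] 1 - Poly_Mapping.single [] 1)
         {adem_relation a b | a b. 0 < a \<and> a < 2 * b})"

definition steenrod_algebra :: "(nat list \<Rightarrow>\<^sub>0 bit) set ring" where
  "steenrod_algebra = free_sq_algebra Quot steenrod_ideal"

definition steenrod_component :: "nat \<Rightarrow> (nat list \<Rightarrow>\<^sub>0 bit) set set" where
  "steenrod_component k =
     {steenrod_ideal +>\<^bsub>free_sq_algebra\<^esub> p | p. \<forall>w\<in>Poly_Mapping.keys p. sum_list w = k}"

definition Sq :: "nat \<Rightarrow> (nat list \<Rightarrow>\<^sub>0 bit) set" where
  "Sq k = steenrod_ideal +>\<^bsub>free_sq_algebra\<^esub> Poly_Mapping.single [k] 1"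


section \<open>Actions of the Steenrod algebra\<close>

text \<open>The library's locale \<open>module\<close> requires a commutative ring of scalars.\<close>

locale left_module = R?: ring R + M?: abelian_group M
  for R :: "('r, 'x) ring_scheme" (structure) and M :: "('m, 'y) ring_scheme" (structure) +
  fixes act :: "'r \<Rightarrow> 'm \<Rightarrow> 'm"
  assumes act_closed: "\<lbrakk>a \<in> carrier R; x \<in> carrier M\<rbrakk> \<Longrightarrow> act a x \<in> carrier M"
    and act_l_distr: "\<lbrakk>a \<in> carrier R; b \<in> carrier R; x \<in> carrier M\<rbrakk>
      \<Longrightarrow> act (a \<oplus>\<^bsub>R\<^esub> b) x = act a x \<oplus>\<^bsub>M\<^esub> act b x"
    and act_r_distr: "\<lbrakk>a \<in> carrier R; x \<in> carrier M; y \<in> carrier M\<rbrakk>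
      \<Longrightarrow> act a (x \<oplus>\<^bsub>M\<^esub> y) = act a x \<oplus>\<^bsub>M\<^esub> act a y"
    and act_assoc: "\<lbrakk>a \<in> carrier R; b \<in> carrier R; x \<in> carrier M\<rbrakk>
      \<Longrightarrow> act (a \<otimes>\<^bsub>R\<^esub> b) x = act a (act b x)"
    and act_one: "x \<in> carrier M \<Longrightarrow> act \<one>\<^bsub>R\<^esub> x = x"

text \<open>
  The degree \<open>d\<close> part of the algebra \<open>A\<close> is \<open>comp d\<close>. That \<open>Sq\<^sup>0\<close> acts as the identity is part
  of the module structure, because \<open>Sq\<^sup>0\<close> is the unit of the Steenrod algebra.
\<close>

locale steenrod_action = A?: cring A + left_module steenrod_algebra A act
  for A :: "('m, 'y) ring_scheme" (structure)
    and comp :: "nat \<Rightarrow> 'm set"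
    and act :: "(nat list \<Rightarrow>\<^sub>0 bit) set \<Rightarrow> 'm \<Rightarrow> 'm" +
  assumes act_graded: "\<lbrakk>a \<in> steenrod_component k; x \<in> comp d\<rbrakk> \<Longrightarrow> act a x \<in> comp (k + d)"
    and cartan: "\<lbrakk>x \<in> carrier A; y \<in> carrier A\<rbrakk>
      \<Longrightarrow> act (Sq k) (x \<otimes>\<^bsub>A\<^esub> y) =
          (\<Oplus>\<^bsub>A\<^esub>i\<in>{0..k}. act (Sq i) x \<otimes>\<^bsub>A\<^esub> act (Sq (k - i)) y)"
    and unstable_square: "x \<in> comp d \<Longrightarrow> act (Sq d) x = x \<otimes>\<^bsub>A\<^esub> x"
    and unstable_zero: "\<lbrakk>x \<in> comp d; d < k\<rbrakk> \<Longrightarrow> act (Sq k) x = \<zero>\<^bsub>A\<^esub>"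

end

theory Submission
  imports Defs
begin

text \<open>
  The ring in question is the polynomial ring modulo the ideal \<open>J\<close> generated by 2 and the non-faces.
  Over \<open>\<int>/2\<close> a span colouring amounts to vectors \<open>u\<^sub>v\<close> and linear forms \<open>\<phi>\<^sub>v\<close> with \<open>\<phi>\<^sub>v(u\<^sub>v) = 1\<close> and
  \<open>\<phi>\<^sub>v(u\<^sub>w) = 0\<close> on edges. Identify the span of the \<open>x\<^sub>i\<close> with \<open>(\<int>/2)\<^sup>n\<close> and define a multiplicative
  total square by \<open>x \<mapsto> x + t\<^sup>2 \<Sum>\<^sub>v \<phi>\<^sub>v(x) y\<^sub>v + t\<^sup>4 x\<^sup>2\<close> and \<open>y\<^sub>v \<mapsto> y\<^sub>v (1 + t\<^sup>4 u\<^sub>v + t\<^sup>6 y\<^sub>v)\<close>, a deformation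
  of the squares on the cohomology of \<open>BSU(3)\<close>. Multiples of \<open>y\<^sub>v\<close> go to multiples of \<open>y\<^sub>v\<close>, so \<open>J\<close> is
  preserved; the Cartan formula and the instability conditions hold by multiplicativity. Both sides
  of the Bullett--Macdonald identity are ring homomorphisms, so the identity needs to be checked
  only on generators, and extracting coefficients turns it into the Adem relations.
\<close>

section \<open>Congruence modulo an ideal of a commutative ring type\<close>

text \<open>For n = 1 and a single vertex the formulas are the Steenrod squares of H^*(BSU(3); Z/2)
  = Z/2[c_2, c_3], with x = c_2 and y = c_3: Sq^2 c_2 = c_3 and Sq^4 c_3 = c_2 c_3. In general the
  vertex v has its own c_2, the vector u_v, while Sq^2 of an element of the x-span is spread over
  all the y_v by the forms \<phi>_v. The copies meet in one place only: the double square of y_v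
  contains the sum of \<phi>_w(u_v) y_v y_w over all w, where BSU(3) has y_v^2. The colouring
  conditions make this sum y_v^2 modulo \<open>J\<close>; the rest of the check is formal algebra in
  characteristic 2.

  The target ring consists of cosets of formal combinations of pairs of a coset and a bit, a bad
  place to compute in. All calculations are therefore done with integer polynomials in all variables
  of the type, up to congruence modulo an ideal that contains 2, and are transported to the tensor
  product at the end. The price is that scalars from Z/2, lifted to 0 and 1, add only up to
  congruence.\<close>

locale ring_ideal =
  fixes J :: "'a::comm_ring_1 set"
  assumes zero_mem: "0 \<in> J"
    and add_mem: "\<lbrakk>x \<in> J; y \<in> J\<rbrakk> \<Longrightarrow> x + y \<in> J"
    and mult_mem: "x \<in> J \<Longrightarrow> c * x \<in> J"
begin

lemma mult_mem_right: "x \<in> J \<Longrightarrow> x * c \<in> J"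
  using mult_mem[of x c] by (simp add: mult.commute)

lemma dvd_mem: "\<lbrakk>x \<in> J; x dvd y\<rbrakk> \<Longrightarrow> y \<in> J"
  by (auto elim!: dvdE intro: mult_mem_right)

lemma uminus_mem: "x \<in> J \<Longrightarrow> - x \<in> J"
  using mult_mem[of x "-1"] by simp

lemma diff_mem: "\<lbrakk>x \<in> J; y \<in> J\<rbrakk> \<Longrightarrow> x - y \<in> J"
  using add_mem[of x "- y"] uminus_mem by simp

lemma sum_mem: "(\<And>i. i \<in> A \<Longrightarrow> f i \<in> J) \<Longrightarrow> sum f A \<in> J"
  by (induction A rule: infinite_finite_induct) (auto intro: zero_mem add_mem)

definition eqv :: "'a \<Rightarrow> 'a \<Rightarrow> bool" (infix \<open>\<asymp>\<close> 50) where
  "x \<asymp> y \<longleftrightarrow> x - y \<in> J"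

lemma eqv_refl [simp]: "x \<asymp> x"
  by (simp add: eqv_def zero_mem)

lemma eqv_sym: "x \<asymp> y \<Longrightarrow> y \<asymp> x"
  using uminus_mem[of "x - y"] by (simp add: eqv_def)

lemma eqv_trans [trans]: "\<lbrakk>x \<asymp> y; y \<asymp> z\<rbrakk> \<Longrightarrow> x \<asymp> z"
  using add_mem[of "x - y" "y - z"] by (simp add: eqv_def)

lemma eqv_zero_iff: "x \<asymp> 0 \<longleftrightarrow> x \<in> J"
  by (simp add: eqv_def)

lemma eqv_mem_iff: "x \<asymp> y \<Longrightarrow> x \<in> J \<longleftrightarrow> y \<in> J"
  by (metis eqv_sym eqv_trans eqv_zero_iff)

lemma eqv_add: "\<lbrakk>x \<asymp> y; x' \<asymp> y'\<rbrakk> \<Longrightarrow> x + x' \<asymp> y + y'"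
  using add_mem[of "x - y" "x' - y'"] by (simp add: eqv_def algebra_simps)

lemma eqv_diff: "\<lbrakk>x \<asymp> y; x' \<asymp> y'\<rbrakk> \<Longrightarrow> x - x' \<asymp> y - y'"
  using diff_mem[of "x - y" "x' - y'"] by (simp add: eqv_def algebra_simps)

lemma eqv_mult: "\<lbrakk>x \<asymp> y; x' \<asymp> y'\<rbrakk> \<Longrightarrow> x * x' \<asymp> y * y'"
  using add_mem[OF mult_mem[of "x - y" x'] mult_mem[of "x' - y'" y]]
  by (simp add: eqv_def algebra_simps)

lemma eqv_power: "x \<asymp> y \<Longrightarrow> x ^ n \<asymp> y ^ n"
  by (induction n) (auto intro: eqv_mult)

lemma eqv_sum: "(\<And>i. i \<in> A \<Longrightarrow> f i \<asymp> g i) \<Longrightarrow> sum f A \<asymp> sum g A"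
  by (induction A rule: infinite_finite_induct) (auto intro: eqv_add)

end

locale even_ring_ideal = ring_ideal +
  assumes two_mem: "2 \<in> J"
begin

lemma eqv_plus_double: "x + 2 * z \<asymp> x"
  using mult_mem_right[OF two_mem] by (simp add: eqv_def)

text \<open>A congruence modulo 2 becomes an exact ring identity once half of the difference is
  supplied as \<open>z\<close>. The explicit witnesses \<open>z\<close> in the later calculations
  serve this rule.\<close>

lemma eqv_if_diff_double: "x = y + 2 * z \<Longrightarrow> x \<asymp> y"
  using eqv_plus_double by simp

lemma eqv_uminus_self: "- x \<asymp> x"
  by (rule eqv_if_diff_double[of _ _ "- x"]) simp

lemma of_int_mem_if_even: "even k \<Longrightarrow> of_int k \<in> J"
  by (auto elim!: evenE simp: two_mem mult_mem_right)

lemma of_int_eqv: "even (k - l) \<Longrightarrow> of_int k \<asymp> of_int l"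
  using of_int_mem_if_even[of "k - l"] by (simp add: eqv_def)

text \<open>Frobenius: the mixed products of the square come in pairs.\<close>

lemma sum_power2_eqv: "(\<Sum>i\<in>A. f i)\<^sup>2 \<asymp> (\<Sum>i\<in>A. (f i)\<^sup>2)"
proof (induction A rule: infinite_finite_induct)
  case (insert x F)
  have "(\<Sum>i\<in>insert x F. f i)\<^sup>2 = ((f x)\<^sup>2 + (\<Sum>i\<in>F. f i)\<^sup>2) + 2 * (f x * (\<Sum>i\<in>F. f i))"
    using insert by (simp add: power2_sum)
  then have "(\<Sum>i\<in>insert x F. f i)\<^sup>2 \<asymp> (f x)\<^sup>2 + (\<Sum>i\<in>F. f i)\<^sup>2"
    by (rule eqv_if_diff_double)
  also have "\<dots> \<asymp> (f x)\<^sup>2 + (\<Sum>i\<in>F. (f i)\<^sup>2)"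
    using insert by (intro eqv_add) auto
  finally show ?case using insert by simp
qed auto

end

text \<open>The extension of \<open>J\<close> to polynomials. It is again an ideal of a ring type,
  so the construction can be iterated, which gives congruences with two auxiliary variables.\<close>

definition poly_ideal :: "'a::comm_ring_1 set \<Rightarrow> 'a poly set" where
  "poly_ideal J = {p. \<forall>i. poly.coeff p i \<in> J}"

lemma ring_ideal_poly_ideal:
  assumes "ring_ideal J"
  shows "ring_ideal (poly_ideal J)"
proof -
  interpret ring_ideal J by fact
  show ?thesis
    by unfold_locales
       (auto simp: poly_ideal_def zero_mem coeff_mult intro!: add_mem sum_mem mult_mem)
qed

lemma even_ring_ideal_poly_ideal:
  assumes "even_ring_ideal J"
  shows "even_ring_ideal (poly_ideal J)"
proof -
  interpret even_ring_ideal J by fact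
  interpret Q: ring_ideal "poly_ideal J" by (rule ring_ideal_poly_ideal) unfold_locales
  show ?thesis
    by unfold_locales
       (auto simp: poly_ideal_def numeral_poly coeff_pCons zero_mem two_mem split: nat.split)
qed


section \<open>Homomorphisms between commutative ring types\<close>

locale type_ring_hom =
  fixes h :: "'a::comm_ring_1 \<Rightarrow> 'b::comm_ring_1"
  assumes hom_one [simp]: "h 1 = 1"
    and hom_add: "h (x + y) = h x + h y"
    and hom_mult: "h (x * y) = h x * h y"
begin

lemma hom_zero [simp]: "h 0 = 0"
  using hom_add[of 0 0] by simp

lemma hom_uminus: "h (- x) = - h x"
  using hom_add[of x "- x"] by (simp add: eq_neg_iff_add_eq_0 add.commute)

lemma hom_diff: "h (x - y) = h x - h y"
  using hom_add[of x "- y"] by (simp add: hom_uminus)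

lemma hom_sum: "h (sum f A) = (\<Sum>i\<in>A. h (f i))"
  by (induction A rule: infinite_finite_induct) (auto simp: hom_add)

lemma hom_prod: "h (prod f A) = (\<Prod>i\<in>A. h (f i))"
  by (induction A rule: infinite_finite_induct) (auto simp: hom_mult)

lemma hom_power: "h (x ^ n) = h x ^ n"
  by (induction n) (auto simp: hom_mult)

lemma hom_of_nat: "h (of_nat k) = of_nat k"
  by (induction k) (auto simp: hom_add)

lemma hom_of_int: "h (of_int k) = of_int k"
  by (cases k) (auto simp: hom_of_nat hom_diff hom_uminus)

end

lemma type_ring_hom_comp:
  "\<lbrakk>type_ring_hom g; type_ring_hom h\<rbrakk> \<Longrightarrow> type_ring_hom (\<lambda>x. g (h x))"
  by (simp add: type_ring_hom_def)

lemma type_ring_hom_const_poly: "type_ring_hom (\<lambda>x. [:x:])"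
  by unfold_locales (auto simp: one_pCons)

text \<open>Composing total squares needs more than evaluation: the coefficients of one total square
  must be squared again, by \<open>h\<close>, while its variable is replaced by
  \<open>z\<close>.\<close>

definition eval_hom :: "('a::comm_ring_1 \<Rightarrow> 'b::comm_ring_1) \<Rightarrow> 'b \<Rightarrow> 'a poly \<Rightarrow> 'b" where
  "eval_hom h z p = poly (map_poly h p) z"

lemma eval_hom_0 [simp]: "eval_hom h z 0 = 0"
  by (simp add: eval_hom_def)

context type_ring_hom
begin

lemma eval_hom_pCons [simp]: "eval_hom h z (pCons a p) = h a + z * eval_hom h z p"
  by (simp add: eval_hom_def map_poly_pCons)

lemma eval_hom_add: "eval_hom h z (p + q) = eval_hom h z p + eval_hom h z q"
  by (induction p q rule: poly_induct2) (simp_all add: hom_add algebra_simps)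

lemma eval_hom_smult: "eval_hom h z (smult c p) = h c * eval_hom h z p"
  by (induction p) (auto simp: hom_mult algebra_simps)

lemma type_ring_hom_eval_hom: "type_ring_hom (eval_hom h z)"
proof
  show "eval_hom h z 1 = 1"
    by (simp add: one_pCons)
  show "eval_hom h z (p + q) = eval_hom h z p + eval_hom h z q" for p q
    by (rule eval_hom_add)
  show "eval_hom h z (p * q) = eval_hom h z p * eval_hom h z q" for p q
    by (induction p) (auto simp: eval_hom_add eval_hom_smult algebra_simps)
qed

lemma eval_hom_monom: "eval_hom h z (monom a n) = h a * z ^ n"
  by (induction n) (auto simp: monom_0 monom_Suc algebra_simps)

lemma eval_hom_altdef: "degree p \<le> n \<Longrightarrow> eval_hom h z p = (\<Sum>i\<le>n. h (poly.coeff p i) * z ^ i)"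
proof (induction n arbitrary: p)
  case 0
  then obtain a where "p = [:a:]" by (auto elim: degree_eq_zeroE)
  then show ?case by simp
next
  case (Suc n)
  show ?case
  proof (cases p)
    case (pCons a q)
    with Suc.prems have "degree q \<le> n" by (auto split: if_splits)
    then show ?thesis
      using pCons Suc.IH[of q] by (simp add: sum.atMost_Suc_shift sum_distrib_left algebra_simps del: sum.atMost_Suc)
  qed
qed

end


section \<open>Extraction of the Adem relations\<close>

text \<open>This is 1 / (1 - X), given by its coefficients because the coefficient ring is not
  assumed to have division.\<close>

abbreviation geometric_fps :: "'a::comm_ring_1 fps" where
  "geometric_fps \<equiv> Abs_fps (\<lambda>_. 1)"

lemma one_minus_X_mult_geometric: "(1 - fps_X) * (geometric_fps :: 'a::comm_ring_1 fps) = 1"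
  by (rule fps_ext) (auto simp: left_diff_distrib)

text \<open>Multiplication by 1 / (1 - X) takes partial sums of the coefficients, so the induction
  step is the hockey-stick identity.\<close>

lemma geometric_power_nth:
  "fps_nth (geometric_fps ^ Suc m :: 'a::comm_ring_1 fps) k = of_nat ((m + k) choose k)"
proof (induction m arbitrary: k)
  case (Suc m)

  have "fps_nth (geometric_fps ^ Suc (Suc m) :: 'a fps) k = fps_nth (geometric_fps ^ Suc m * geometric_fps :: 'a fps) k"
    by (simp add: mult.commute)
  also have "\<dots> = (\<Sum>i=0..k. of_nat ((m + i) choose i))"
    by (simp add: fps_mult_nth Suc.IH del: power_Suc)
  also have "\<dots> = of_nat (\<Sum>i\<le>k. (m + i) choose i)"
    by (simp add: atMost_atLeast0)
  also have "\<dots> = of_nat ((Suc m + k) choose k)"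
    by (simp only: sum_choose_lower) simp
  finally show ?case .
qed auto

text \<open>Pascal's rule gives two summands that agree by symmetry.\<close>

lemma even_central_binomial: "0 < m \<Longrightarrow> even ((m + m) choose m)"
proof -
  assume "0 < m"
  then obtain k where m: "m = Suc k" by (cases m) auto
  have "(m + m) choose m = ((k + m) choose k) + ((k + m) choose m)"
    by (simp add: m)
  also have "((k + m) choose m) = ((k + m) choose k)"
    using binomial_symmetric[of k "k + m"] by simp
  finally show ?thesis by simp
qed

text \<open>Pascal's rule again; the alternating signs of the binomial expansion disappear modulo
  2.\<close>

lemma (in even_ring_ideal) one_minus_X_power_nth_eqv:
  "fps_nth ((1 - fps_X) ^ m) k \<asymp> of_nat (m choose k)"
proof (induction m arbitrary: k)
  case 0
  then show ?case by (cases k) auto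
next
  case (Suc m)
  show ?case
  proof (cases k)
    case (Suc l)
    have "(1 - fps_X) ^ Suc m = (1 - fps_X) ^ m - fps_X * (1 - fps_X :: 'a fps) ^ m"
      by (simp add: left_diff_distrib)
    then have "fps_nth ((1 - fps_X) ^ Suc m) k =
        fps_nth ((1 - fps_X) ^ m) k - fps_nth ((1 - fps_X :: 'a fps) ^ m) l"
      by (simp only: Suc fps_sub_nth fps_X_mult_nth) simp
    also have "\<dots> \<asymp> of_nat (m choose k) - of_nat (m choose l)"
      by (intro eqv_diff Suc.IH)
    also have "\<dots> \<asymp> of_nat (m choose k) + of_nat (m choose l)"
      using eqv_add[OF eqv_refl[of "of_nat (m choose k)"] eqv_uminus_self[of "of_nat (m choose l)"]] by simp
    finally show ?thesis by (simp add: Suc add.commute)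
  qed (simp add: fps_power_zeroth)
qed

text \<open>
  The Adem relations are the coefficients of \<open>s\<^sup>a\<close> in the Bullett--Macdonald identity
  \<open>\<Sum> s\<^sup>n\<^sup>-\<^sup>j c\<^sub>j = \<Sum> (1 - t)\<^sup>n\<^sup>-\<^sup>j t\<^sup>2\<^sup>j c\<^sub>j\<close> with \<open>s = t (1 - t)\<close>. Modulo 2 the coefficient of \<open>s\<^sup>a\<close> is the
  residue of \<open>s\<^sup>-\<^sup>a\<^sup>-\<^sup>1 dt\<close>, that is, the coefficient of \<open>t\<^sup>a\<close> after division by \<open>(1 - t)\<^sup>a\<^sup>+\<^sup>1\<close>.
\<close>

lemma (in even_ring_ideal) adem_from_bullett_macdonald:
  fixes c :: "nat \<Rightarrow> 'a" and a b :: nat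
  defines "n \<equiv> a + b"
  assumes ab: "a < 2 * b"
    and bm: "(\<Sum>j\<le>n. ([:0, 1:] * [:1, -1:]) ^ (n - j) * [:c j:])
      - (\<Sum>j\<le>n. [:1, -1:] ^ (n - j) * [:0, 1:] ^ (2 * j) * [:c j:]) \<in> poly_ideal J"
  shows "c b \<asymp> (\<Sum>j=0..a div 2. of_nat ((b - j - 1) choose (a - 2 * j)) * c j)"
proof -
  define V where "V = (geometric_fps :: 'a fps)"
  define U where "U = (1 - fps_X :: 'a fps)"
  have UV: "U ^ k * V ^ k = 1" for k
    by (simp add: power_mult_distrib[symmetric] U_def V_def one_minus_X_mult_geometric)
  define R where "R f = fps_nth (fps_of_poly f * V ^ Suc a) a" for f :: "'a poly"
  have R_diff: "R (f - g) = R f - R g" for f g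
    by (simp add: R_def fps_of_poly_diff left_diff_distrib)
  have R_sum: "R (sum f A) = (\<Sum>i\<in>A. R (f i))" for f and A :: "nat set"
    by (simp add: R_def fps_of_poly_sum sum_distrib_right fps_sum_nth)
  have R_const: "R (f * [:z:]) = R f * z" for f z
  proof -
    have "R (f * [:z:]) = fps_nth (fps_const z * (fps_of_poly f * V ^ Suc a)) a"
      by (simp only: R_def fps_of_poly_mult fps_of_poly_const mult_ac)
    then show ?thesis by (simp only: R_def fps_mult_left_const_nth mult.commute)
  qed
  have R_mem: "R f \<in> J" if "f \<in> poly_ideal J" for f
    using that by (auto simp: R_def fps_mult_nth poly_ideal_def intro!: sum_mem mult_mem_right)
  have U_poly: "fps_of_poly [:1, -1:] = U"
    by (simp add: U_def fps_of_poly_pCons)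
  have X_poly: "fps_of_poly [:0, 1:] = (fps_X :: 'a fps)"
    by (simp add: fps_of_poly_pCons)
  \<comment> \<open>Since ds = (1 - 2 t) dt is dt modulo 2, \<open>R\<close> should pick out s^a.
    Directly: for i = a - m the value is the central binomial coefficient of 2 m, which is even
    unless m = 0.\<close>
  have left: "R (([:0, 1:] * [:1, -1:]) ^ i) \<asymp> (if i = a then 1 else 0)" for i
  proof -
    have eq: "R (([:0, 1:] * [:1, -1:]) ^ i) = fps_nth (fps_X ^ i * (U ^ i * V ^ Suc a)) a"
      by (simp only: R_def fps_of_poly_mult fps_of_poly_power power_mult_distrib U_poly X_poly mult.assoc)
    show ?thesis
    proof (cases "i \<le> a")
      case True
      then obtain m where m: "a = i + m" by (auto simp: le_iff_add)
      have "U ^ i * V ^ Suc a = (U ^ i * V ^ i) * V ^ Suc m"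
        by (simp add: m power_add algebra_simps)
      also have "\<dots> = V ^ Suc m" by (simp only: UV mult_1)
      finally have "R (([:0, 1:] * [:1, -1:]) ^ i) = fps_nth (V ^ Suc m) m"
        by (simp only: eq fps_X_power_mult_nth) (simp add: m)
      also have "\<dots> = of_nat ((m + m) choose m)"
        unfolding V_def by (rule geometric_power_nth)
      also have "\<dots> \<asymp> (if i = a then 1 else 0)"
      proof (cases "m = 0")
        case False
        then have "even (int ((m + m) choose m))"
          using even_central_binomial[of m] by simp
        from of_int_mem_if_even[OF this] show ?thesis
          using False m by (simp add: eqv_zero_iff)
      qed (simp add: m)
      finally show ?thesis .
    next
      case False
      then show ?thesis by (simp only: eq fps_X_power_mult_nth) simp
    qed
  qed
  have right: "R ([:1, -1:] ^ (n - j) * [:0, 1:] ^ (2 * j)) \<asymp>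
      (if j \<le> a div 2 then of_nat ((b - j - 1) choose (a - 2 * j)) else 0)" if "j \<le> n" for j
  proof -
    have eq: "R ([:1, -1:] ^ (n - j) * [:0, 1:] ^ (2 * j)) = fps_nth (fps_X ^ (2 * j) * (U ^ (n - j) * V ^ Suc a)) a"
      by (simp only: R_def fps_of_poly_mult fps_of_poly_power U_poly X_poly mult.assoc mult.left_commute)
    show ?thesis
    proof (cases "j \<le> a div 2")
      case True
      \<comment> \<open>From a < 2 b and j \<le> a / 2 follows j < b, so after division by (1 -
        t)^(a + 1) the exponent b - j - 1 is still nonnegative.\<close>
      then have "n - j = (b - j - 1) + Suc a" using ab by (auto simp: n_def)
      then have "U ^ (n - j) * V ^ Suc a = U ^ (b - j - 1) * (U ^ Suc a * V ^ Suc a)"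
        by (simp only: power_add mult.assoc)
      also have "\<dots> = U ^ (b - j - 1)" by (simp only: UV mult_1_right)
      finally have "R ([:1, -1:] ^ (n - j) * [:0, 1:] ^ (2 * j)) = fps_nth (U ^ (b - j - 1)) (a - 2 * j)"
        using True by (simp only: eq fps_X_power_mult_nth) auto
      then show ?thesis
        using True one_minus_X_power_nth_eqv by (simp add: U_def)
    next
      case False
      then show ?thesis by (simp only: eq fps_X_power_mult_nth) auto
    qed
  qed
  have "(\<Sum>j\<le>n. R (([:0, 1:] * [:1, -1:]) ^ (n - j)) * c j) \<asymp> (\<Sum>j\<le>n. (if n - j = a then 1 else 0) * c j)"
    by (intro eqv_sum eqv_mult left eqv_refl)
  also have "\<dots> = (\<Sum>j\<in>{b}. c j)"
    by (rule sum.mono_neutral_cong_right) (auto simp: n_def)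
  finally have l: "(\<Sum>j\<le>n. R (([:0, 1:] * [:1, -1:]) ^ (n - j)) * c j) \<asymp> c b" by simp
  have "(\<Sum>j\<le>n. R ([:1, -1:] ^ (n - j) * [:0, 1:] ^ (2 * j)) * c j) \<asymp>
      (\<Sum>j\<le>n. (if j \<le> a div 2 then of_nat ((b - j - 1) choose (a - 2 * j)) else 0) * c j)"
    by (intro eqv_sum eqv_mult right eqv_refl) auto
  also have "\<dots> = (\<Sum>j=0..a div 2. of_nat ((b - j - 1) choose (a - 2 * j)) * c j)"
    by (rule sum.mono_neutral_cong_right) (auto simp: n_def)
  finally have r: "(\<Sum>j\<le>n. R ([:1, -1:] ^ (n - j) * [:0, 1:] ^ (2 * j)) * c j) \<asymp> \<dots>" .
  have "(\<Sum>j\<le>n. R (([:0, 1:] * [:1, -1:]) ^ (n - j)) * c j) \<asymp> (\<Sum>j\<le>n. R ([:1, -1:] ^ (n - j) * [:0, 1:] ^ (2 * j)) * c j)"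
    using R_mem[OF bm] unfolding eqv_def R_diff R_sum R_const .
  with l r show ?thesis by (meson eqv_sym eqv_trans)
qed


section \<open>Integer polynomials\<close>

lemma poly_mapping_single_induct [case_names zero add]:
  assumes "P 0"
    and "\<And>f a b. \<lbrakk>a \<notin> Poly_Mapping.keys f; b \<noteq> 0; P f\<rbrakk> \<Longrightarrow> P (Poly_Mapping.single a b + f)"
  shows "P (f :: 'a \<Rightarrow>\<^sub>0 'b::comm_monoid_add)"
proof (induction f rule: Poly_Mapping.update_induct)
  case const
  show ?case by (rule assms(1))
next
  case (update f a b)
  have "Poly_Mapping.update a b f = Poly_Mapping.single a b + f"
    using update(1)
    by (intro poly_mapping_eqI) (auto simp: lookup_update lookup_add lookup_single in_keys_iff when_def)
  then show ?case using assms(2)[OF update] by simp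
qed

lemma keys_single_add:
  "\<lbrakk>a \<notin> Poly_Mapping.keys f; b \<noteq> 0\<rbrakk> \<Longrightarrow>
    Poly_Mapping.keys (Poly_Mapping.single a b + f) = insert a (Poly_Mapping.keys f)"
  by (auto simp: in_keys_iff lookup_add lookup_single when_def split: if_splits)

lemma keys_add_nat: "Poly_Mapping.keys (m + m' :: 'w \<Rightarrow>\<^sub>0 nat) = Poly_Mapping.keys m \<union> Poly_Mapping.keys m'"
  by (auto simp: in_keys_iff lookup_add)

lemma monomial_induct [case_names zero add]:
  fixes m :: "'w \<Rightarrow>\<^sub>0 nat"
  assumes "P 0" and step: "\<And>v m. P m \<Longrightarrow> P (Poly_Mapping.single v 1 + m)"
  shows "P m"
proof (induction m rule: poly_mapping_single_induct)
  case zero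
  show ?case by (rule assms(1))
next
  case (add m v k)
  have "P (Poly_Mapping.single v j + m)" for j
  proof (induction j)
    case (Suc j)
    have "Poly_Mapping.single v (Suc j) + m = Poly_Mapping.single v 1 + (Poly_Mapping.single v j + m)"
      by (simp add: single_add[symmetric] add.assoc[symmetric])
    then show ?case using step[OF Suc] by simp
  qed (use add in simp)
  then show ?case .
qed

lemma int_poly_induct [case_names of_int indet add mult]:
  fixes p :: "('w \<Rightarrow>\<^sub>0 nat) \<Rightarrow>\<^sub>0 int"
  assumes of_int: "\<And>c. P (of_int c)" and indet: "\<And>v. P (indet v)"
    and add: "\<And>p q. \<lbrakk>P p; P q\<rbrakk> \<Longrightarrow> P (p + q)" and mult: "\<And>p q. \<lbrakk>P p; P q\<rbrakk> \<Longrightarrow> P (p * q)"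
  shows "P p"
proof (induction p rule: poly_mapping_single_induct)
  case zero
  show ?case using of_int[of 0] by simp
next
  case (add p m c)
  have "P (Poly_Mapping.single m 1)"
  proof (induction m rule: monomial_induct)
    case zero
    show ?case using of_int[of 1] by simp
  next
    case (add v m)
    then show ?case using mult[OF indet[of v], of "Poly_Mapping.single m 1"]
      by (simp add: indet_def mult_single)
  qed
  from mult[OF of_int[of c] this] have "P (Poly_Mapping.single m c)"
    by (simp add: mult_single flip: single_of_int)
  then show ?case using add assms(3) by blast
qed

section \<open>Evaluation of monomials and substitution\<close>

definition eval_monomial :: "('w \<Rightarrow> 'b::comm_ring_1) \<Rightarrow> ('w \<Rightarrow>\<^sub>0 nat) \<Rightarrow> 'b" where
  "eval_monomial s m = (\<Prod>v\<in>Poly_Mapping.keys m. s v ^ Poly_Mapping.lookup m v)"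

lemma eval_monomial_superset:
  assumes "finite A" "Poly_Mapping.keys m \<subseteq> A"
  shows "eval_monomial s m = (\<Prod>v\<in>A. s v ^ Poly_Mapping.lookup m v)"
  unfolding eval_monomial_def using assms
  by (intro prod.mono_neutral_left) (auto simp: in_keys_iff)

lemma eval_monomial_0 [simp]: "eval_monomial s 0 = 1"
  by (simp add: eval_monomial_def)

lemma eval_monomial_add: "eval_monomial s (m + m') = eval_monomial s m * eval_monomial s m'"
proof -
  let ?A = "Poly_Mapping.keys m \<union> Poly_Mapping.keys m'"
  have "eval_monomial s (m + m') = (\<Prod>v\<in>?A. s v ^ Poly_Mapping.lookup (m + m') v)"
    by (rule eval_monomial_superset) (auto simp: keys_add_nat)
  also have "\<dots> = eval_monomial s m * eval_monomial s m'"
    by (simp add: eval_monomial_superset[of ?A] lookup_add power_add prod.distrib)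
  finally show ?thesis .
qed

lemma eval_monomial_single [simp]: "eval_monomial s (Poly_Mapping.single v k) = s v ^ k"
  by (simp add: eval_monomial_superset[of "{v}"])

definition subst_hom :: "('w \<Rightarrow> 'b::comm_ring_1) \<Rightarrow> (('w \<Rightarrow>\<^sub>0 nat) \<Rightarrow>\<^sub>0 int) \<Rightarrow> 'b" where
  "subst_hom s p = (\<Sum>m\<in>Poly_Mapping.keys p. of_int (Poly_Mapping.lookup p m) * eval_monomial s m)"

lemma subst_hom_add: "subst_hom s (p + q) = subst_hom s p + subst_hom s q"
  unfolding subst_hom_def by (rule setsum_keys_plus_distrib) (auto simp: algebra_simps)

lemma subst_hom_single: "subst_hom s (Poly_Mapping.single m c) = of_int c * eval_monomial s m"
  by (simp add: subst_hom_def)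

lemma subst_hom_indet [simp]: "subst_hom s (indet v) = s v"
  by (simp add: indet_def subst_hom_single)

lemma type_ring_hom_subst_hom: "type_ring_hom (subst_hom s)"
proof
  show "subst_hom s 1 = 1"
    using subst_hom_single[of s 0 1] by simp
  have single: "subst_hom s (Poly_Mapping.single m c * q) = subst_hom s (Poly_Mapping.single m c) * subst_hom s q"
    for m c q
    by (induction q rule: poly_mapping_single_induct)
       (auto simp: subst_hom_def[of s 0] subst_hom_add subst_hom_single distrib_left mult_single
          eval_monomial_add mult_ac)
  show "subst_hom s (p * q) = subst_hom s p * subst_hom s q" for p q
    by (induction p rule: poly_mapping_single_induct)
       (auto simp: subst_hom_def[of s 0] subst_hom_add distrib_right single)
qed (rule subst_hom_add)

lemma (in ring_ideal) eqv_if_eqv_indet: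
  assumes "type_ring_hom g" "type_ring_hom h" "\<And>v. g (indet v) \<asymp> h (indet v)"
  shows "g p \<asymp> h p"
proof -
  interpret g: type_ring_hom g by fact
  interpret h: type_ring_hom h by fact
  show ?thesis
    by (induction p rule: int_poly_induct)
       (auto simp: g.hom_of_int h.hom_of_int g.hom_add h.hom_add g.hom_mult h.hom_mult assms(3)
          intro: eqv_add eqv_mult)
qed

section \<open>Weighted degrees and homogeneous polynomials\<close>

lemma monomial_degree_superset:
  assumes "finite A" "Poly_Mapping.keys m \<subseteq> A"
  shows "monomial_degree wt m = (\<Sum>v\<in>A. Poly_Mapping.lookup m v * wt v)"
  unfolding monomial_degree_def using assms
  by (intro sum.mono_neutral_left) (auto simp: in_keys_iff)

lemma monomial_degree_0 [simp]: "monomial_degree wt 0 = 0"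
  by (simp add: monomial_degree_def)

lemma monomial_degree_add: "monomial_degree wt (m + m') = monomial_degree wt m + monomial_degree wt m'"
proof -
  let ?A = "Poly_Mapping.keys m \<union> Poly_Mapping.keys m'"
  have "monomial_degree wt (m + m') = (\<Sum>v\<in>?A. Poly_Mapping.lookup (m + m') v * wt v)"
    by (rule monomial_degree_superset) (auto simp: keys_add_nat)
  also have "\<dots> = monomial_degree wt m + monomial_degree wt m'"
    by (simp add: monomial_degree_superset[of ?A] lookup_add sum.distrib algebra_simps)
  finally show ?thesis .
qed

lemma monomial_degree_single [simp]: "monomial_degree wt (Poly_Mapping.single v k) = k * wt v"
  by (simp add: monomial_degree_superset[of "{v}"])

definition homogeneous :: "('w \<Rightarrow> nat) \<Rightarrow> nat \<Rightarrow> (('w \<Rightarrow>\<^sub>0 nat) \<Rightarrow>\<^sub>0 int) \<Rightarrow> bool" where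
  "homogeneous wt d p \<longleftrightarrow> (\<forall>m\<in>Poly_Mapping.keys p. monomial_degree wt m = d)"

lemma homogeneous_0 [simp]: "homogeneous wt d 0"
  by (simp add: homogeneous_def)

lemma homogeneous_single: "monomial_degree wt m = d \<Longrightarrow> homogeneous wt d (Poly_Mapping.single m c)"
  by (simp add: homogeneous_def)

lemma homogeneous_1 [simp]: "homogeneous wt 0 1"
  by (simp add: homogeneous_def)

lemma homogeneous_indet: "homogeneous wt (wt v) (indet v)"
  by (simp add: indet_def homogeneous_single)

lemma homogeneous_add: "\<lbrakk>homogeneous wt d p; homogeneous wt d q\<rbrakk> \<Longrightarrow> homogeneous wt d (p + q)"
  using Poly_Mapping.keys_add[of p q] by (auto simp: homogeneous_def)

lemma homogeneous_uminus: "homogeneous wt d p \<Longrightarrow> homogeneous wt d (- p)"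
  by (simp add: homogeneous_def)

lemma homogeneous_sum: "(\<And>i. i \<in> A \<Longrightarrow> homogeneous wt d (f i)) \<Longrightarrow> homogeneous wt d (sum f A)"
  by (induction A rule: infinite_finite_induct) (auto intro: homogeneous_add)

lemma homogeneous_mult:
  "\<lbrakk>homogeneous wt d p; homogeneous wt e q\<rbrakk> \<Longrightarrow> homogeneous wt (d + e) (p * q)"
  using Poly_Mapping.keys_mult[of p q] by (auto simp: homogeneous_def monomial_degree_add)

lemma homogeneous_of_int_mult: "homogeneous wt d p \<Longrightarrow> homogeneous wt d (of_int c * p)"
  using homogeneous_mult[of wt 0 "Poly_Mapping.single 0 c" d p] homogeneous_single[of wt 0 0 c]
  by (simp flip: single_of_int)

lemma prod_indet: "finite A \<Longrightarrow> (\<Prod>v\<in>A. indet v) = Poly_Mapping.single (\<Sum>v\<in>A. Poly_Mapping.single v 1) 1"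
  by (induction A rule: finite_induct) (auto simp: indet_def mult_single)

lemma lookup_indicator_monomial:
  "finite A \<Longrightarrow> Poly_Mapping.lookup (\<Sum>v\<in>A. Poly_Mapping.single v (1::nat)) w = (if w \<in> A then 1 else 0)"
  by (simp add: lookup_sum lookup_single when_def)

lemma keys_indicator_monomial:
  "finite A \<Longrightarrow> Poly_Mapping.keys (\<Sum>v\<in>A. Poly_Mapping.single v (1::nat)) = A"
  by (auto simp only: in_keys_iff lookup_indicator_monomial split: if_splits)

lemma poly_mapping_expansion:
  "p = (\<Sum>m\<in>Poly_Mapping.keys p. Poly_Mapping.single m (Poly_Mapping.lookup p m))"
  by (intro poly_mapping_eqI) (auto simp: lookup_sum lookup_single when_def in_keys_iff)


section \<open>The mod 2 Stanley-Reisner ideal\<close>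

text \<open>A test on coefficients instead of a set of generators, so that membership is decided one
  monomial at a time. For a complex \<open>K\<close>, monomials with a variable outside its vertex
  set are not supported on a face and so belong to the ideal.\<close>

definition mod2_face_ideal :: "'w set set \<Rightarrow> (('w \<Rightarrow>\<^sub>0 nat) \<Rightarrow>\<^sub>0 int) set" where
  "mod2_face_ideal K = {p. \<forall>m. Poly_Mapping.keys m \<in> K \<longrightarrow> even (Poly_Mapping.lookup p m)}"

lemma single_mem_mod2_face_ideal:
  "Poly_Mapping.single m c \<in> mod2_face_ideal K \<longleftrightarrow> Poly_Mapping.keys m \<notin> K \<or> even c"
  by (auto simp: mod2_face_ideal_def lookup_single when_def)

lemma add_mem_mod2_face_ideal:
  "\<lbrakk>p \<in> mod2_face_ideal K; q \<in> mod2_face_ideal K\<rbrakk> \<Longrightarrow> p + q \<in> mod2_face_ideal K"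
  by (auto simp: mod2_face_ideal_def lookup_add)

text \<open>If a product of monomials is supported on a face, then by downward closure so is each
  factor, and the even coefficient of the factor from \<open>p\<close> makes the product of the
  coefficients even.\<close>

lemma even_ring_ideal_mod2_face_ideal:
  assumes down: "\<And>\<sigma> \<tau>. \<lbrakk>\<sigma> \<in> K; \<tau> \<subseteq> \<sigma>\<rbrakk> \<Longrightarrow> \<tau> \<in> K"
  shows "even_ring_ideal (mod2_face_ideal K)"
proof
  show zero: "0 \<in> mod2_face_ideal K"
    by (simp add: mod2_face_ideal_def)
  have sum: "sum f A \<in> mod2_face_ideal K" if "\<And>i. i \<in> A \<Longrightarrow> f i \<in> mod2_face_ideal K"
    for f :: "('a \<Rightarrow>\<^sub>0 nat) \<Rightarrow> _" and A
    using that by (induction A rule: infinite_finite_induct) (auto simp: zero add_mem_mod2_face_ideal)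
  show "c * p \<in> mod2_face_ideal K" if p: "p \<in> mod2_face_ideal K" for c p
  proof -
    have "c * p = (\<Sum>k\<in>Poly_Mapping.keys c. \<Sum>m\<in>Poly_Mapping.keys p.
        Poly_Mapping.single (k + m) (Poly_Mapping.lookup c k * Poly_Mapping.lookup p m))"
      by (subst poly_mapping_expansion[of c], subst poly_mapping_expansion[of p])
         (simp add: sum_product mult_single)
    also have "\<dots> \<in> mod2_face_ideal K"
      using p down
      by (intro sum) (auto simp: single_mem_mod2_face_ideal keys_add_nat, auto simp: mod2_face_ideal_def)
    finally show ?thesis .
  qed
  show "2 \<in> mod2_face_ideal K"
    using single_mem_mod2_face_ideal[of 0 2 K] by simp
qed (rule add_mem_mod2_face_ideal)

lemma A_complex_iff:
  "\<sigma> \<in> A_complex n L \<longleftrightarrow> {i. XVar i \<in> \<sigma>} \<subseteq> {1..n} \<and> {v. YVar v \<in> \<sigma>} \<in> L"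
proof
  assume "\<sigma> \<in> A_complex n L"
  then obtain A B where "A \<subseteq> XVar ` {1..n}" "B \<in> L" "\<sigma> = A \<union> YVar ` B"
    by (auto simp: A_complex_def complex_join_def)
  moreover from this have "{v. YVar v \<in> \<sigma>} = B" by auto
  ultimately show "{i. XVar i \<in> \<sigma>} \<subseteq> {1..n} \<and> {v. YVar v \<in> \<sigma>} \<in> L" by auto
next
  assume *: "{i. XVar i \<in> \<sigma>} \<subseteq> {1..n} \<and> {v. YVar v \<in> \<sigma>} \<in> L"
  have "z \<in> XVar ` {i. XVar i \<in> \<sigma>} \<union> YVar ` {v. YVar v \<in> \<sigma>}" if "z \<in> \<sigma>" for z
    using that by (cases z) auto
  then have "\<sigma> = XVar ` {i. XVar i \<in> \<sigma>} \<union> YVar ` {v. YVar v \<in> \<sigma>}"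
    by auto
  then show "\<sigma> \<in> A_complex n L"
    unfolding A_complex_def complex_join_def using * by blast
qed

lemma A_complex_subset:
  assumes "simplicial_complex_on V L" "\<sigma> \<in> A_complex n L" "\<tau> \<subseteq> \<sigma>"
  shows "\<tau> \<in> A_complex n L"
proof -
  have "{v. YVar v \<in> \<tau>} \<subseteq> {v. YVar v \<in> \<sigma>}" using assms(3) by auto
  then have "{v. YVar v \<in> \<tau>} \<in> L"
    using assms(1,2) unfolding simplicial_complex_on_def A_complex_iff by blast
  moreover have "{i. XVar i \<in> \<tau>} \<subseteq> {1..n}" using assms(2,3) by (auto simp: A_complex_iff)
  ultimately show ?thesis by (simp add: A_complex_iff)
qed

lemma A_complex_subset_vertices:
  assumes "simplicial_complex_on V L" "\<sigma> \<in> A_complex n L"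
  shows "\<sigma> \<subseteq> A_vertices n V"
proof
  fix z assume z: "z \<in> \<sigma>"
  show "z \<in> A_vertices n V"
  proof (cases z)
    case (XVar i)
    then show ?thesis using assms(2) z by (auto simp: A_complex_iff A_vertices_def)
  next
    case (YVar v)
    have "{v. YVar v \<in> \<sigma>} \<subseteq> V"
      using assms by (simp add: A_complex_iff simplicial_complex_on_def)
    then show ?thesis using YVar z by (auto simp: A_vertices_def)
  qed
qed


section \<open>The total Steenrod square\<close>

text \<open>A colouring in coordinates, lifted to integers because only parities matter:
  \<open>F v\<close> holds the values on the unit vectors of a linear form with kernel V_v, and
  \<open>G v\<close> the coordinates of a vector spanning U_v. \<open>F_support\<close> is there for
  the x_i with \<open>i\<close> outside 1..n: these lie in \<open>J\<close>, and so must their total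
  squares.\<close>

locale span_data =
  fixes n :: nat and V :: "'v set" and L :: "'v set set" and F G :: "'v \<Rightarrow> nat \<Rightarrow> int"
  assumes complex: "simplicial_complex_on V L" and finite_V: "finite V"
    and F_support: "i \<notin> {1..n} \<Longrightarrow> F v i = 0"
    and pairing_diagonal: "v \<in> V \<Longrightarrow> odd (\<Sum>i=1..n. F v i * G v i)"
    and pairing_edge: "\<lbrakk>v \<in> V; w \<in> V; v \<noteq> w; {v, w} \<in> L\<rbrakk> \<Longrightarrow> even (\<Sum>i=1..n. F w i * G v i)"
begin

abbreviation "J \<equiv> mod2_face_ideal (A_complex n L)"
abbreviation "x i \<equiv> indet (XVar i) :: ('v vertex \<Rightarrow>\<^sub>0 nat) \<Rightarrow>\<^sub>0 int"
abbreviation "y v \<equiv> indet (YVar v) :: ('v vertex \<Rightarrow>\<^sub>0 nat) \<Rightarrow>\<^sub>0 int"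

sublocale even_ring_ideal J
  by (rule even_ring_ideal_mod2_face_ideal) (rule A_complex_subset[OF complex])

notation eqv (infix \<open>\<asymp>\<close> 50)

text \<open>The counterparts of c_3 and c_2: Sq^2 of x_i is \<open>\<phi> i\<close>, and Sq^4 of y_v
  is y_v times \<open>u v\<close>.\<close>

definition "\<phi> i = (\<Sum>v\<in>V. of_int (F v i) * y v)"
definition "u v = (\<Sum>i=1..n. of_int (G v i) * x i)"

fun gen :: "'v vertex \<Rightarrow> (('v vertex \<Rightarrow>\<^sub>0 nat) \<Rightarrow>\<^sub>0 int) poly" where
  "gen (XVar i) = [:x i:] + monom (\<phi> i) 2 + monom ((x i)\<^sup>2) 4"
| "gen (YVar v) = [:y v:] * (1 + monom (u v) 4 + monom (y v) 6)"

text \<open>The factored form in \<open>gen\<close> exhibits divisibility by y_v; degrees and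
  coefficients are read off from this expanded one.\<close>

lemma gen_YVar: "gen (YVar v) = [:y v:] + monom (y v * u v) 4 + monom ((y v)\<^sup>2) 6"
  by (simp add: smult_add_right smult_monom power2_eq_square one_pCons)

definition "total_sq = subst_hom gen"
definition "sq k p = poly.coeff (total_sq p) k"

sublocale total_sq: type_ring_hom total_sq
  unfolding total_sq_def by (rule type_ring_hom_subst_hom)

lemma sq_add: "sq k (p + q) = sq k p + sq k q"
  by (simp add: sq_def total_sq.hom_add)

lemma sq_zero [simp]: "sq k 0 = 0"
  by (simp add: sq_def)

lemma sq_sum: "sq k (sum f A) = (\<Sum>i\<in>A. sq k (f i))"
  by (simp add: sq_def total_sq.hom_sum coeff_sum)

lemma sq_mult: "sq k (p * q) = (\<Sum>i\<le>k. sq i p * sq (k - i) q)"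
  by (simp add: sq_def total_sq.hom_mult coeff_mult)

lemma sq_0: "sq 0 p = p"
proof (induction p rule: int_poly_induct)
  case (of_int c)
  then show ?case by (simp add: sq_def total_sq.hom_of_int of_int_poly)
next
  case (indet v)
  then show ?case by (cases v) (simp_all add: sq_def total_sq_def coeff_mult_0)
qed (auto simp: sq_add sq_mult)

section \<open>Invariance of the ideal under the total square\<close>

lemma prod_indet_mem: "\<lbrakk>finite \<sigma>; \<sigma> \<notin> A_complex n L\<rbrakk> \<Longrightarrow> (\<Prod>v\<in>\<sigma>. indet v) \<in> J"
  by (simp only: prod_indet single_mem_mod2_face_ideal keys_indicator_monomial) simp

sublocale PJ: even_ring_ideal "poly_ideal J"
  by (rule even_ring_ideal_poly_ideal) unfold_locales

lemma const_poly_mem: "p \<in> J \<Longrightarrow> [:p:] \<in> poly_ideal J"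
  by (auto simp: poly_ideal_def coeff_pCons zero_mem split: nat.split)

text \<open>A non-face contains an x_i with \<open>i\<close> out of range, or its y-part is not in
  \<open>L\<close>. In the first case \<open>\<phi> i\<close> = 0 and x_i, an element of
  \<open>J\<close>, divides its own total square. In the second case each y_v divides its total
  square, so the image is divisible by the non-face monomial on the y-part.\<close>

lemma eval_monomial_gen_mem:
  assumes "Poly_Mapping.keys m \<notin> A_complex n L"
  shows "eval_monomial gen m \<in> poly_ideal J"
proof -
  consider i where "XVar i \<in> Poly_Mapping.keys m" "i \<notin> {1..n}"
    | "{v. YVar v \<in> Poly_Mapping.keys m} \<notin> L"
    using assms unfolding A_complex_iff by blast
  then show ?thesis
  proof cases
    case (1 i)
    have "x i \<in> J"
      using prod_indet_mem[of "{XVar i}"] 1 by (auto simp: A_complex_iff)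
    moreover have "gen (XVar i) = [:x i:] * (1 + monom (x i) 4)"
      using F_support[OF 1(2)]
      by (simp add: \<phi>_def distrib_left smult_monom power2_eq_square monom_0[symmetric] mult_monom)
    ultimately have "gen (XVar i) \<in> poly_ideal J"
      by (simp only: PJ.mult_mem_right const_poly_mem)
    moreover have "gen (XVar i) dvd gen (XVar i) ^ Poly_Mapping.lookup m (XVar i)"
      by (rule dvd_power[OF disjI1]) (use 1 in \<open>simp add: in_keys_iff\<close>)
    moreover have "gen (XVar i) ^ Poly_Mapping.lookup m (XVar i) dvd eval_monomial gen m"
      unfolding eval_monomial_def by (rule dvd_prodI) (use 1 in auto)
    ultimately show ?thesis by (meson PJ.dvd_mem)
  next
    case 2
    define B where "B = {v. YVar v \<in> Poly_Mapping.keys m}"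
    have fin: "finite (YVar ` B)"
      by (rule finite_subset[of _ "Poly_Mapping.keys m"]) (auto simp: B_def)
    moreover have "{v. YVar v \<in> YVar ` B} = B" by auto
    ultimately have "(\<Prod>v\<in>YVar ` B. indet v) \<in> J"
      using 2 by (intro prod_indet_mem) (simp_all only: A_complex_iff B_def, simp)
    then have "[:\<Prod>v\<in>YVar ` B. indet v:] \<in> poly_ideal J"
      by (rule const_poly_mem)
    moreover have "[:\<Prod>v\<in>YVar ` B. indet v:] = (\<Prod>v\<in>YVar ` B. [:indet v:])"
      by (rule type_ring_hom.hom_prod[OF type_ring_hom_const_poly])
    moreover have "(\<Prod>v\<in>YVar ` B. [:indet v:]) dvd (\<Prod>v\<in>YVar ` B. gen v ^ Poly_Mapping.lookup m v)"
    proof (rule prod_dvd_prod)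
      fix w assume "w \<in> YVar ` B"
      then obtain v where v: "w = YVar v" "YVar v \<in> Poly_Mapping.keys m" by (auto simp: B_def)
      have "[:indet w:] dvd gen w" by (simp only: v gen.simps dvd_triv_left)
      also have "gen w dvd gen w ^ Poly_Mapping.lookup m w"
        by (rule dvd_power[OF disjI1]) (use v in \<open>simp add: in_keys_iff\<close>)
      finally show "[:indet w:] dvd gen w ^ Poly_Mapping.lookup m w" .
    qed
    moreover have "(\<Prod>v\<in>YVar ` B. gen v ^ Poly_Mapping.lookup m v) dvd eval_monomial gen m"
      unfolding eval_monomial_def by (rule prod_dvd_prod_subset) (auto simp: B_def)
    ultimately show ?thesis by (metis PJ.dvd_mem)
  qed
qed

lemma total_sq_mem:
  assumes "p \<in> J"
  shows "total_sq p \<in> poly_ideal J"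
  unfolding total_sq_def subst_hom_def
proof (rule PJ.sum_mem)
  fix m assume "m \<in> Poly_Mapping.keys p"
  consider "even (Poly_Mapping.lookup p m)" | "Poly_Mapping.keys m \<notin> A_complex n L"
    using assms by (auto simp: mod2_face_ideal_def)
  then show "of_int (Poly_Mapping.lookup p m) * eval_monomial gen m \<in> poly_ideal J"
    by cases (simp_all add: PJ.of_int_mem_if_even PJ.mult_mem_right PJ.mult_mem eval_monomial_gen_mem)
qed

lemma sq_mem: "p \<in> J \<Longrightarrow> sq k p \<in> J"
  using total_sq_mem by (simp add: sq_def poly_ideal_def)

text \<open>The variable of the total square counts the rise in degree. On generators this amounts
  to 4 + 2 = 6 for \<open>\<phi> i\<close>, 4 + 4 = 8 for x_i^2, 6 + 4 = 10 for y_v u_v and 6 + 6 =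
  12 for y_v^2; convolution carries it to products.\<close>

lemma homogeneous_coeff_eval_monomial_gen:
  "homogeneous A_degree (monomial_degree A_degree m + k) (poly.coeff (eval_monomial gen m) k)"
proof (induction m arbitrary: k rule: monomial_induct)
  case (add v m)
  have y: "homogeneous A_degree 6 (y v)" for v using homogeneous_indet[of A_degree "YVar v"] by simp
  have x: "homogeneous A_degree 4 (x i)" for i using homogeneous_indet[of A_degree "XVar i"] by simp
  have gen: "homogeneous A_degree (A_degree v + k) (poly.coeff (gen v) k)" for k
  proof (cases v)
    case (XVar i)
    have "homogeneous A_degree 6 (\<phi> i)"
      unfolding \<phi>_def by (intro homogeneous_sum homogeneous_of_int_mult y)
    moreover have "homogeneous A_degree 8 ((x i)\<^sup>2)"
      using homogeneous_mult[OF x x] by (simp add: power2_eq_square)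
    moreover have "poly.coeff (gen v) k =
        (if k = 0 then x i else if k = 2 then \<phi> i else if k = 4 then (x i)\<^sup>2 else 0)"
      by (auto simp: XVar coeff_pCons split: nat.split)
    ultimately show ?thesis using x by (auto simp: XVar)
  next
    case (YVar w)
    have "homogeneous A_degree 4 (u w)"
      unfolding u_def by (intro homogeneous_sum homogeneous_of_int_mult x)
    from homogeneous_mult[OF y this] have "homogeneous A_degree 10 (y w * u w)" by simp
    moreover have "homogeneous A_degree 12 ((y w)\<^sup>2)"
      using homogeneous_mult[OF y y] by (simp add: power2_eq_square)
    moreover have "poly.coeff (gen v) k =
        (if k = 0 then y w else if k = 4 then y w * u w else if k = 6 then (y w)\<^sup>2 else 0)"
      by (auto simp: YVar gen_YVar coeff_pCons simp del: gen.simps split: nat.split)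
    ultimately show ?thesis using y by (auto simp: YVar)
  qed
  have "homogeneous A_degree (A_degree v + monomial_degree A_degree m + k)
      (poly.coeff (gen v) i * poly.coeff (eval_monomial gen m) (k - i))" if "i \<le> k" for i
    using homogeneous_mult[OF gen[of i] add[of "k - i"]] that by (simp add: add_ac)
  then show ?case
    by (auto simp: eval_monomial_add monomial_degree_add coeff_mult intro!: homogeneous_sum)
qed (auto simp: coeff_1)

lemma sq_single: "sq k (Poly_Mapping.single m c) = of_int c * poly.coeff (eval_monomial gen m) k"
  by (simp add: sq_def total_sq_def subst_hom_single of_int_poly)

lemma sq_expansion:
  "sq k p = (\<Sum>m\<in>Poly_Mapping.keys p. of_int (Poly_Mapping.lookup p m) * poly.coeff (eval_monomial gen m) k)"
  by (subst poly_mapping_expansion[of p]) (simp only: sq_sum sq_single)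

lemma homogeneous_sq:
  assumes "homogeneous A_degree d p"
  shows "homogeneous A_degree (k + d) (sq k p)"
  unfolding sq_expansion using assms homogeneous_coeff_eval_monomial_gen[of _ k]
  by (intro homogeneous_sum homogeneous_of_int_mult) (simp add: homogeneous_def add.commute)

text \<open>Both instability conditions for monomials. A generator of degree d has a total square of
  degree at most d whose coefficient at d is the square of the generator. This passes to products,
  as only the two top coefficients meet in the top coefficient of the product.\<close>

lemma degree_eval_monomial_gen:
  "degree (eval_monomial gen m) \<le> monomial_degree A_degree m \<and>
   poly.coeff (eval_monomial gen m) (monomial_degree A_degree m) = (Poly_Mapping.single m 1)\<^sup>2"
proof (induction m rule: monomial_induct)
  case (add v m)
  let ?d = "A_degree v" and ?e = "monomial_degree A_degree m"
  have gen: "degree (gen v) \<le> ?d \<and> poly.coeff (gen v) ?d = (indet v)\<^sup>2"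
  proof (cases v)
    case (XVar i)
    have "degree ([:x i:] + monom (\<phi> i) 2 + monom ((x i)\<^sup>2) 4) \<le> 4"
      by (intro degree_add_le order_trans[OF degree_monom_le]) simp_all
    then show ?thesis by (simp add: XVar coeff_pCons numeral_eq_Suc)
  next
    case (YVar w)
    have "degree (gen v) \<le> 6"
      unfolding YVar gen_YVar by (intro degree_add_le order_trans[OF degree_monom_le]) simp_all
    then show ?thesis by (simp add: YVar gen_YVar coeff_pCons numeral_eq_Suc del: gen.simps)
  qed
  have "degree (gen v * eval_monomial gen m) \<le> ?d + ?e"
    using degree_mult_le[of "gen v" "eval_monomial gen m"] gen add by linarith
  moreover have "poly.coeff (gen v * eval_monomial gen m) (?d + ?e) =
      (\<Sum>i\<in>{?d}. poly.coeff (gen v) i * poly.coeff (eval_monomial gen m) (?d + ?e - i))"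
    unfolding coeff_mult
  proof (rule sum.mono_neutral_right)
    show "\<forall>i\<in>{..?d + ?e} - {?d}. poly.coeff (gen v) i * poly.coeff (eval_monomial gen m) (?d + ?e - i) = 0"
    proof
      fix i assume i: "i \<in> {..?d + ?e} - {?d}"
      show "poly.coeff (gen v) i * poly.coeff (eval_monomial gen m) (?d + ?e - i) = 0"
      proof (cases "i < ?d")
        case True
        then have "degree (eval_monomial gen m) < ?d + ?e - i" using add by auto
        then show ?thesis by (simp add: coeff_eq_0)
      next
        case False
        then have "degree (gen v) < i" using gen i by auto
        then show ?thesis by (simp add: coeff_eq_0)
      qed
    qed
  qed auto
  moreover have "Poly_Mapping.single (Poly_Mapping.single v 1 + m) 1 = indet v * Poly_Mapping.single m (1::int)"
    by (simp add: indet_def mult_single)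
  moreover have "eval_monomial gen (Poly_Mapping.single v 1 + m) = gen v * eval_monomial gen m"
    by (simp add: eval_monomial_add)
  moreover have "monomial_degree A_degree (Poly_Mapping.single v 1 + m) = ?d + ?e"
    by (simp add: monomial_degree_add)
  ultimately show ?case
    using gen add by (simp add: power_mult_distrib del: One_nat_def)
qed auto

lemma sq_above_degree: "\<lbrakk>homogeneous A_degree d p; d < k\<rbrakk> \<Longrightarrow> sq k p = 0"
  unfolding sq_expansion
proof (intro sum.neutral ballI)
  fix m assume "homogeneous A_degree d p" "d < k" "m \<in> Poly_Mapping.keys p"
  then have "degree (eval_monomial gen m) < k"
    using degree_eval_monomial_gen[of m] by (auto simp: homogeneous_def)
  then show "of_int (Poly_Mapping.lookup p m) * poly.coeff (eval_monomial gen m) k = 0"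
    by (simp add: coeff_eq_0)
qed

text \<open>For monomials with coefficient 1 this is exact. For sums, each integer coefficient
  agrees with its square modulo 2, and Frobenius collects the squares.\<close>

lemma sq_degree:
  assumes "homogeneous A_degree d p"
  shows "sq d p \<asymp> p * p"
proof -
  have "sq d p = (\<Sum>m\<in>Poly_Mapping.keys p. of_int (Poly_Mapping.lookup p m) * (Poly_Mapping.single m 1)\<^sup>2)"
    unfolding sq_expansion using assms degree_eval_monomial_gen
    by (intro sum.cong) (auto simp: homogeneous_def)
  also have "\<dots> \<asymp> (\<Sum>m\<in>Poly_Mapping.keys p. of_int ((Poly_Mapping.lookup p m)\<^sup>2) * (Poly_Mapping.single m 1)\<^sup>2)"
    by (intro eqv_sum eqv_mult of_int_eqv eqv_refl) auto
  also have "\<dots> = (\<Sum>m\<in>Poly_Mapping.keys p. (Poly_Mapping.single m (Poly_Mapping.lookup p m))\<^sup>2)"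
    by (intro sum.cong) (auto simp: power2_eq_square mult_single simp flip: single_of_int)
  also have "\<dots> \<asymp> (\<Sum>m\<in>Poly_Mapping.keys p. Poly_Mapping.single m (Poly_Mapping.lookup p m))\<^sup>2"
    by (rule eqv_sym) (rule sum_power2_eqv)
  also have "\<dots> = p * p"
    by (simp only: poly_mapping_expansion[symmetric] power2_eq_square)
  finally show ?thesis .
qed

end


section \<open>The Bullett--Macdonald identity\<close>

context span_data
begin

sublocale PPJ: even_ring_ideal "poly_ideal (poly_ideal J)"
  by (rule even_ring_ideal_poly_ideal) unfold_locales

text \<open>Two auxiliary variables are adjoined: in the Adem argument the inner one is t and the
  outer one is r.\<close>

definition incl :: "(('v vertex \<Rightarrow>\<^sub>0 nat) \<Rightarrow>\<^sub>0 int) \<Rightarrow> (('v vertex \<Rightarrow>\<^sub>0 nat) \<Rightarrow>\<^sub>0 int) poly poly" where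
  "incl p = [:[:p:]:]"

sublocale incl: type_ring_hom incl
  unfolding incl_def
  by (rule type_ring_hom_comp) (rule type_ring_hom_const_poly)+

lemma incl_eqv: "p \<asymp> q \<Longrightarrow> PPJ.eqv (incl p) (incl q)"
  unfolding eqv_def PPJ.eqv_def incl.hom_diff[symmetric]
  by (auto simp: incl_def poly_ideal_def coeff_pCons zero_mem split: nat.split)

definition "sq_at \<alpha> p = eval_hom incl \<alpha> (total_sq p)"
text \<open>The generating function of the composites Sq^i Sq^j, with weight \<alpha>^i \<beta>^j:
  the operation applied first carries \<beta>.\<close>

definition "double_sq \<alpha> \<beta> p = eval_hom (sq_at \<alpha>) \<beta> (total_sq p)"

lemma type_ring_hom_sq_at: "type_ring_hom (sq_at \<alpha>)"
  unfolding sq_at_def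
  by (rule type_ring_hom_comp[OF incl.type_ring_hom_eval_hom total_sq.type_ring_hom_axioms])

sublocale sq_at: type_ring_hom "sq_at \<alpha>" for \<alpha>
  by (rule type_ring_hom_sq_at)

lemma type_ring_hom_double_sq: "type_ring_hom (double_sq \<alpha> \<beta>)"
  unfolding double_sq_def
  by (rule type_ring_hom_comp[OF sq_at.type_ring_hom_eval_hom total_sq.type_ring_hom_axioms])

lemma total_sq_x: "total_sq (x i) = [:x i:] + monom (\<phi> i) 2 + monom ((x i)\<^sup>2) 4"
  by (simp add: total_sq_def)

lemma total_sq_y: "total_sq (y v) = [:y v:] + monom (y v * u v) 4 + monom ((y v)\<^sup>2) 6"
  unfolding gen_YVar[symmetric] by (simp add: total_sq_def del: gen.simps)

lemma sq_at_x: "sq_at \<alpha> (x i) = incl (x i) + \<alpha> ^ 2 * incl (\<phi> i) + \<alpha> ^ 4 * incl (x i) ^ 2"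
  by (simp add: sq_at_def total_sq_x incl.eval_hom_add incl.eval_hom_monom incl.hom_power)

lemma sq_at_y:
  "sq_at \<alpha> (y v) = incl (y v) + \<alpha> ^ 4 * (incl (y v) * incl (u v)) + \<alpha> ^ 6 * incl (y v) ^ 2"
  by (simp add: sq_at_def total_sq_y incl.eval_hom_add incl.eval_hom_monom incl.hom_power incl.hom_mult)

text \<open>This is Sq^4 Sq^2 of x_i. Each y_v brings its own u_v, so the product c_2 c_3 of the
  model becomes a sum over vertices.\<close>

definition "\<psi> i = (\<Sum>v\<in>V. of_int (F v i) * (y v * u v))"

lemma sq_at_\<phi>:
  "sq_at \<alpha> (\<phi> i) = incl (\<phi> i) + \<alpha> ^ 4 * incl (\<psi> i) + \<alpha> ^ 6 * incl (\<Sum>v\<in>V. of_int (F v i) * (y v)\<^sup>2)"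
  unfolding \<phi>_def \<psi>_def sq_at.hom_sum sq_at.hom_mult sq_at.hom_of_int sq_at_y
  by (simp add: incl.hom_sum incl.hom_mult incl.hom_of_int incl.hom_power sum_distrib_left
      sum.distrib distrib_left mult_ac)

lemma sq_at_u:
  "sq_at \<alpha> (u v) = incl (u v) + \<alpha> ^ 2 * incl (\<Sum>i=1..n. of_int (G v i) * \<phi> i)
     + \<alpha> ^ 4 * incl (\<Sum>i=1..n. of_int (G v i) * (x i)\<^sup>2)"
  unfolding u_def sq_at.hom_sum sq_at.hom_mult sq_at.hom_of_int sq_at_x
  by (simp add: incl.hom_sum incl.hom_mult incl.hom_of_int incl.hom_power sum_distrib_left
      sum.distrib distrib_left mult_ac)

text \<open>The coefficients may be squared modulo 2, after which Frobenius applies; the same holds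
  for \<open>u_power2\<close>.\<close>

lemma \<phi>_power2: "(\<Sum>v\<in>V. of_int (F v i) * (y v)\<^sup>2) \<asymp> (\<phi> i)\<^sup>2"
proof -
  have "(\<Sum>v\<in>V. of_int (F v i) * (y v)\<^sup>2) \<asymp> (\<Sum>v\<in>V. of_int ((F v i)\<^sup>2) * (y v)\<^sup>2)"
    by (intro eqv_sum eqv_mult of_int_eqv eqv_refl) auto
  also have "\<dots> = (\<Sum>v\<in>V. (of_int (F v i) * y v)\<^sup>2)"
    by (simp add: power_mult_distrib)
  also have "\<dots> \<asymp> (\<phi> i)\<^sup>2"
    unfolding \<phi>_def by (rule eqv_sym) (rule sum_power2_eqv)
  finally show ?thesis .
qed

lemma u_power2: "(\<Sum>i=1..n. of_int (G v i) * (x i)\<^sup>2) \<asymp> (u v)\<^sup>2"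
proof -
  have "(\<Sum>i=1..n. of_int (G v i) * (x i)\<^sup>2) \<asymp> (\<Sum>i=1..n. of_int ((G v i)\<^sup>2) * (x i)\<^sup>2)"
    by (intro eqv_sum eqv_mult of_int_eqv eqv_refl) auto
  also have "\<dots> = (\<Sum>i=1..n. (of_int (G v i) * x i)\<^sup>2)"
    by (simp add: power_mult_distrib)
  also have "\<dots> \<asymp> (u v)\<^sup>2"
    unfolding u_def by (rule eqv_sym) (rule sum_power2_eqv)
  finally show ?thesis .
qed

text \<open>The span colouring enters here: \<open>y\<^sub>v y\<^sub>w\<close> survives for edges only, where the pairing vanishes.\<close>

lemma y_pairing: "y v * (\<Sum>i=1..n. of_int (G v i) * \<phi> i) \<asymp> (y v)\<^sup>2"
proof (cases "v \<in> V")
  case False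
  \<comment> \<open>An uncoloured vertex is no simplex, so y_v is in \<open>J\<close> and both sides
    vanish.\<close>
  have "{v} \<notin> L" using False complex by (auto simp: simplicial_complex_on_def)
  moreover have "{w. YVar w \<in> {YVar v}} = {v}" by auto
  ultimately have "y v \<in> J"
    using prod_indet_mem[of "{YVar v}"] by (simp only: A_complex_iff) simp
  then have "y v * (\<Sum>i=1..n. of_int (G v i) * \<phi> i) - (y v)\<^sup>2 \<in> J"
    by (simp add: power2_eq_square mult_mem_right diff_mem)
  then show ?thesis by (simp add: eqv_def)
next
  case True
  \<comment> \<open>The coefficient of y_v y_w is the form of \<open>w\<close> evaluated at the
    vector of \<open>v\<close>.\<close>
  let ?c = "\<lambda>w. \<Sum>i=1..n. F w i * G v i"
  have "y v * (\<Sum>i=1..n. of_int (G v i) * \<phi> i) = (\<Sum>w\<in>V. of_int (?c w) * (y v * y w))"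
    unfolding \<phi>_def by (simp add: sum_distrib_left sum_distrib_right sum.swap[of _ V] mult_ac)
  also have "\<dots> \<asymp> (\<Sum>w\<in>V. if w = v then (y v)\<^sup>2 else 0)"
  proof (rule eqv_sum)
    fix w assume w: "w \<in> V"
    consider "w = v" | "w \<noteq> v" "{v, w} \<in> L" | "w \<noteq> v" "{v, w} \<notin> L" by blast
    then show "of_int (?c w) * (y v * y w) \<asymp> (if w = v then (y v)\<^sup>2 else 0)"
    proof cases
      case 1
      then show ?thesis
        using eqv_mult[OF of_int_eqv[of "?c v" 1] eqv_refl[of "(y v)\<^sup>2"]] pairing_diagonal[OF True]
        by (simp add: power2_eq_square)
    next
      case 2
      then have "even (?c w)" using pairing_edge[OF True w] by auto
      then show ?thesis
        using 2 by (simp add: eqv_zero_iff mult_mem_right of_int_mem_if_even del: of_int_sum)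
    next
      case 3
      have "{z. YVar z \<in> {YVar v, YVar w}} = {v, w}" by auto
      with 3 have "y v * y w \<in> J"
        using prod_indet_mem[of "{YVar v, YVar w}"] by (simp only: A_complex_iff) simp
      then show ?thesis
        using 3 by (simp add: eqv_zero_iff mult_mem)
    qed
  qed
  also have "\<dots> = (y v)\<^sup>2" using True finite_V by simp
  finally show ?thesis .
qed

lemma double_sq_x:
  "double_sq \<alpha> \<beta> (x i) = sq_at \<alpha> (x i) + \<beta> ^ 2 * sq_at \<alpha> (\<phi> i) + \<beta> ^ 4 * sq_at \<alpha> (x i) ^ 2"
  by (simp add: double_sq_def total_sq_x sq_at.eval_hom_add sq_at.eval_hom_monom sq_at.hom_power mult.commute)

lemma double_sq_y:
  "double_sq \<alpha> \<beta> (y v) = sq_at \<alpha> (y v) + \<beta> ^ 4 * (sq_at \<alpha> (y v) * sq_at \<alpha> (u v)) + \<beta> ^ 6 * sq_at \<alpha> (y v) ^ 2"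
  by (simp add: double_sq_def total_sq_y sq_at.eval_hom_add sq_at.eval_hom_monom sq_at.hom_power
      sq_at.hom_mult mult.commute)

text \<open>
  The Bullett--Macdonald substitution preserves \<open>\<alpha>\<^sup>2 + \<beta>\<^sup>2\<close> and \<open>\<alpha>\<^sup>4 \<beta>\<^sup>2\<close> modulo 2. It therefore suffices
  that the double total square of a generator depends on \<open>\<alpha>\<close> and \<open>\<beta>\<close> only through these two terms.
\<close>

definition "normal_x e f i =
  incl (x i) + e * incl (\<phi> i) + e ^ 2 * incl (x i) ^ 2 + f * incl (\<psi> i) + e * f * incl (\<phi> i) ^ 2
    + f ^ 2 * incl (x i) ^ 4"

definition "normal_y e f v =
  incl (y v) * (1 + e ^ 2 * incl (u v) + (e ^ 3 + f) * incl (y v) + f ^ 2 * (incl (u v) ^ 3 + incl (y v) ^ 2)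
    + f ^ 2 * e * (incl (y v) * incl (u v) ^ 2) + f ^ 3 * incl (y v) ^ 3)"

lemma double_sq_x_eqv:
  "PPJ.eqv (double_sq \<alpha> \<beta> (x i)) (normal_x (\<alpha>\<^sup>2 + \<beta>\<^sup>2) (\<alpha> ^ 4 * \<beta>\<^sup>2) i)"
proof -
  define A where "A = \<alpha>\<^sup>2"
  define B where "B = \<beta>\<^sup>2"
  define W where "W = incl (x i)"
  define P where "P = incl (\<phi> i)"
  define Q where "Q = incl (\<psi> i)"
  define P2 where "P2 = incl (\<Sum>v\<in>V. of_int (F v i) * (y v)\<^sup>2)"
  have "\<alpha> ^ 4 = A ^ 2" "\<alpha> ^ 6 = A ^ 3" "\<beta> ^ 4 = B ^ 2"
    by (simp_all add: A_def B_def power_mult[symmetric])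
  note pow = this A_def[symmetric] B_def[symmetric]
  have "PPJ.eqv P2 (P\<^sup>2)"
    unfolding P2_def P_def incl.hom_power[symmetric] by (rule incl_eqv[OF \<phi>_power2])
  then have "PPJ.eqv (W + A * P + A ^ 2 * W ^ 2 + B * (P + A ^ 2 * Q + A ^ 3 * P2)
        + B ^ 2 * (W + A * P + A ^ 2 * W ^ 2) ^ 2)
      (W + A * P + A ^ 2 * W ^ 2 + B * (P + A ^ 2 * Q + A ^ 3 * P\<^sup>2)
        + B ^ 2 * (W + A * P + A ^ 2 * W ^ 2) ^ 2)"
    by (intro PPJ.eqv_add PPJ.eqv_mult PPJ.eqv_refl)
  \<comment> \<open>The witness \<open>z\<close> accounts for the double products of the squared
    trinomial, minus the one that (A + B)^2 contributes.\<close>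
  also have "PPJ.eqv \<dots> (W + (A + B) * P + (A + B) ^ 2 * W ^ 2 + A ^ 2 * B * Q
      + (A + B) * (A ^ 2 * B) * P ^ 2 + (A ^ 2 * B) ^ 2 * W ^ 4)"
    by (rule PPJ.eqv_if_diff_double[where z = "B ^ 2 * (A * W * P + A ^ 3 * P * W ^ 2 + A ^ 2 * W ^ 3) - A * B * W ^ 2"])
       (simp add: eval_nat_numeral algebra_simps)
  finally show ?thesis
    by (simp only: double_sq_x sq_at_x sq_at_\<phi> normal_x_def pow
        W_def[symmetric] P_def[symmetric] Q_def[symmetric] P2_def[symmetric])
qed

lemma double_sq_y_eqv:
  "PPJ.eqv (double_sq \<alpha> \<beta> (y v)) (normal_y (\<alpha>\<^sup>2 + \<beta>\<^sup>2) (\<alpha> ^ 4 * \<beta>\<^sup>2) v)"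
proof -
  define A where "A = \<alpha>\<^sup>2"
  define B where "B = \<beta>\<^sup>2"
  define Y where "Y = incl (y v)"
  define U where "U = incl (u v)"
  define T where "T = incl (\<Sum>i=1..n. of_int (G v i) * \<phi> i)"
  define U2 where "U2 = incl (\<Sum>i=1..n. of_int (G v i) * (x i)\<^sup>2)"
  have "\<alpha> ^ 4 = A ^ 2" "\<alpha> ^ 6 = A ^ 3" "\<beta> ^ 4 = B ^ 2" "\<beta> ^ 6 = B ^ 3"
    by (simp_all add: A_def B_def power_mult[symmetric])
  note pow = this A_def[symmetric] B_def[symmetric]
  have U2: "PPJ.eqv U2 (U\<^sup>2)"
    unfolding U2_def U_def incl.hom_power[symmetric] by (rule incl_eqv[OF u_power2])
  have T: "PPJ.eqv (Y * T) (Y\<^sup>2)"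
    unfolding Y_def T_def incl.hom_power[symmetric] incl.hom_mult[symmetric] by (rule incl_eqv[OF y_pairing])
  \<comment> \<open>\<open>R\<close> is the cofactor of y_v in its total square. The factor
    \<open>Y\<close> has to stay next to \<open>T\<close>, since only the product
    \<open>Y * T\<close> is known modulo \<open>J\<close>.\<close>
  define R where "R = 1 + A ^ 2 * U + A ^ 3 * Y"
  define e f where "e = A + B" and "f = A ^ 2 * B"
  have R1: "PPJ.eqv (R * (Y * U + A * Y ^ 2 + A ^ 2 * (Y * U ^ 2)))
      (Y * (U + A * Y + A ^ 4 * U ^ 3 + A ^ 4 * Y ^ 2 + A ^ 5 * Y * U ^ 2))"
    unfolding R_def
    by (rule PPJ.eqv_if_diff_double[where z = "Y * (A ^ 2 * U ^ 2 + A ^ 3 * U * Y)"])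
       (simp add: eval_nat_numeral algebra_simps)
  have R2: "PPJ.eqv (R ^ 2) (1 + A ^ 4 * U ^ 2 + A ^ 6 * Y ^ 2)"
    unfolding R_def
    by (rule PPJ.eqv_if_diff_double[where z = "A ^ 2 * U + A ^ 3 * Y + A ^ 5 * U * Y"])
       (simp add: eval_nat_numeral algebra_simps)
  have e2: "PPJ.eqv (A ^ 2 + B ^ 2) (e ^ 2)"
    unfolding e_def
    by (rule PPJ.eqv_if_diff_double[where z = "- (A * B)"]) (simp add: eval_nat_numeral algebra_simps)
  \<comment> \<open>Modulo 2 the cube of A + B has the extra term A^2 B, which adding
    \<open>f\<close> cancels.\<close>
  have e3: "PPJ.eqv (A ^ 3 + A * B ^ 2 + B ^ 3) (e ^ 3 + f)"
    unfolding e_def f_def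
    by (rule PPJ.eqv_if_diff_double[where z = "- (2 * A ^ 2 * B + A * B ^ 2)"])
       (simp add: eval_nat_numeral algebra_simps)
  have f_powers: "A ^ 4 * B ^ 2 = f ^ 2" "A ^ 5 * B ^ 2 + A ^ 4 * B ^ 3 = f ^ 2 * e" "A ^ 6 * B ^ 3 = f ^ 3"
    unfolding e_def f_def by (simp_all add: eval_nat_numeral algebra_simps)
  have "(Y + A ^ 2 * (Y * U) + A ^ 3 * Y ^ 2)
        + B ^ 2 * ((Y + A ^ 2 * (Y * U) + A ^ 3 * Y ^ 2) * (U + A * T + A ^ 2 * U2))
        + B ^ 3 * (Y + A ^ 2 * (Y * U) + A ^ 3 * Y ^ 2) ^ 2 =
      Y * R + B ^ 2 * (R * (Y * U + A * (Y * T) + A ^ 2 * (Y * U2))) + B ^ 3 * (Y ^ 2 * R ^ 2)"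
  proof -
    have "Y + A ^ 2 * (Y * U) + A ^ 3 * Y ^ 2 = Y * R"
      by (simp add: R_def eval_nat_numeral algebra_simps)
    then show ?thesis by (simp add: power_mult_distrib algebra_simps)
  qed
  also have "PPJ.eqv \<dots>
      (Y * R + B ^ 2 * (R * (Y * U + A * Y ^ 2 + A ^ 2 * (Y * U ^ 2))) + B ^ 3 * (Y ^ 2 * R ^ 2))"
    by (intro PPJ.eqv_add PPJ.eqv_mult PPJ.eqv_refl T U2)
  also have "PPJ.eqv \<dots>
      (Y * R + B ^ 2 * (Y * (U + A * Y + A ^ 4 * U ^ 3 + A ^ 4 * Y ^ 2 + A ^ 5 * Y * U ^ 2))
        + B ^ 3 * (Y ^ 2 * (1 + A ^ 4 * U ^ 2 + A ^ 6 * Y ^ 2)))"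
    by (intro PPJ.eqv_add PPJ.eqv_mult PPJ.eqv_refl R1 R2)
  also have "\<dots> = Y * (1 + (A ^ 2 + B ^ 2) * U + (A ^ 3 + A * B ^ 2 + B ^ 3) * Y
      + A ^ 4 * B ^ 2 * (U ^ 3 + Y ^ 2) + (A ^ 5 * B ^ 2 + A ^ 4 * B ^ 3) * (Y * U ^ 2)
      + A ^ 6 * B ^ 3 * Y ^ 3)"
    by (simp add: R_def eval_nat_numeral algebra_simps)
  also have "PPJ.eqv \<dots> (Y * (1 + e ^ 2 * U + (e ^ 3 + f) * Y
      + f ^ 2 * (U ^ 3 + Y ^ 2) + f ^ 2 * e * (Y * U ^ 2) + f ^ 3 * Y ^ 3))"
    unfolding f_powers by (intro PPJ.eqv_add PPJ.eqv_mult PPJ.eqv_refl e2 e3)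
  finally show ?thesis
    unfolding e_def f_def
    by (simp only: double_sq_y sq_at_y sq_at_u normal_y_def pow
        Y_def[symmetric] U_def[symmetric] T_def[symmetric] U2_def[symmetric])
qed

lemma normal_x_eqv: "PPJ.eqv e e' \<Longrightarrow> PPJ.eqv (normal_x e f i) (normal_x e' f i)"
  unfolding normal_x_def by (intro PPJ.eqv_add PPJ.eqv_mult PPJ.eqv_power PPJ.eqv_refl)

lemma normal_y_eqv: "PPJ.eqv e e' \<Longrightarrow> PPJ.eqv (normal_y e f v) (normal_y e' f v)"
  unfolding normal_y_def by (intro PPJ.eqv_add PPJ.eqv_mult PPJ.eqv_power PPJ.eqv_refl)

text \<open>With P(z) the total square at z, the classical form is P(s^2 + s t) P(t^2) = P(t^2 + s
  t) P(s^2). Here one variable is set to 1, and \<open>r\<close> rescales both arguments so that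
  degrees can be separated again. The sign in 1 - t is free modulo 2 and matches the series 1 / (1 -
  t) used to extract coefficients. Modulo 2 and at r = 1, both sides have \<alpha> + \<beta> = 1 + t
  + t^2 and \<alpha>^2 \<beta> = t^2 (1 - t)^2: the dehomogenized Dickson invariants of rank two,
  the second one squared.\<close>

lemma bullett_macdonald:
  "PPJ.eqv (double_sq (r * (t * (1 - t))) r p) (double_sq (r * (1 - t)) (r * t\<^sup>2) p)"
proof (rule PPJ.eqv_if_eqv_indet[OF type_ring_hom_double_sq type_ring_hom_double_sq])
  fix w :: "'v vertex"
  have f: "(r * (t * (1 - t))) ^ 4 * r\<^sup>2 = (r * (1 - t)) ^ 4 * (r * t\<^sup>2)\<^sup>2"
    by (simp add: eval_nat_numeral algebra_simps)
  have e: "PPJ.eqv ((r * (t * (1 - t)))\<^sup>2 + r\<^sup>2) ((r * (1 - t))\<^sup>2 + (r * t\<^sup>2)\<^sup>2)"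
    by (rule PPJ.eqv_if_diff_double[where z = "r\<^sup>2 * (t - t ^ 3)"]) (simp add: eval_nat_numeral algebra_simps)
  show "PPJ.eqv (double_sq (r * (t * (1 - t))) r (indet w)) (double_sq (r * (1 - t)) (r * t\<^sup>2) (indet w))"
  proof (cases w)
    case (XVar i)
    have "PPJ.eqv (double_sq (r * (t * (1 - t))) r (x i))
        (normal_x ((r * (1 - t))\<^sup>2 + (r * t\<^sup>2)\<^sup>2) ((r * (1 - t)) ^ 4 * (r * t\<^sup>2)\<^sup>2) i)"
      using PPJ.eqv_trans[OF double_sq_x_eqv normal_x_eqv[OF e]] by (simp only: f)
    then show ?thesis
      unfolding XVar using double_sq_x_eqv PPJ.eqv_trans PPJ.eqv_sym by blast
  next
    case (YVar v)
    have "PPJ.eqv (double_sq (r * (t * (1 - t))) r (y v))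
        (normal_y ((r * (1 - t))\<^sup>2 + (r * t\<^sup>2)\<^sup>2) ((r * (1 - t)) ^ 4 * (r * t\<^sup>2)\<^sup>2) v)"
      using PPJ.eqv_trans[OF double_sq_y_eqv normal_y_eqv[OF e]] by (simp only: f)
    then show ?thesis
      unfolding YVar using double_sq_y_eqv PPJ.eqv_trans PPJ.eqv_sym by blast
  qed
qed

section \<open>Coefficient extraction and the Adem relations\<close>

lemma incl_monom: "incl p = monom [:p:] 0"
  by (simp add: incl_def monom_0)

lemma coeff_double_sq:
  "poly.coeff (double_sq (monom a 1) (monom b 1) p) k = (\<Sum>j\<le>k. a ^ (k - j) * b ^ j * [:sq (k - j) (sq j p):])"
proof -
  \<comment> \<open>A common bound makes the double sum rectangular. Beyond the degree of
    \<open>total_sq p\<close> the polynomials \<open>sq j p\<close> vanish, so finitely many inner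
    degrees suffice; \<open>k\<close> is included so that every j \<le> k occurs.\<close>
  define N where "N = Max (insert k (insert (degree (total_sq p)) ((\<lambda>j. degree (total_sq (sq j p))) ` {..degree (total_sq p)})))"
  have N: "k \<le> N" "degree (total_sq p) \<le> N"
    by (auto simp: N_def)
  have N': "degree (total_sq (sq j p)) \<le> N" for j
  proof (cases "j \<le> degree (total_sq p)")
    case True
    then show ?thesis unfolding N_def by (intro Max_ge) auto
  qed (simp add: sq_def coeff_eq_0 total_sq.hom_zero)
  have "double_sq (monom a 1) (monom b 1) p = (\<Sum>j\<le>N. (\<Sum>i\<le>N. incl (sq i (sq j p)) * monom a 1 ^ i) * monom b 1 ^ j)"
    unfolding double_sq_def sq_at.eval_hom_altdef[OF N(2)] sq_at_def
    by (simp add: incl.eval_hom_altdef[OF N'] flip: sq_def)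
  also have "\<dots> = (\<Sum>j\<le>N. \<Sum>i\<le>N. monom (a ^ i * b ^ j * [:sq i (sq j p):]) (i + j))"
    unfolding sum_distrib_right
    by (intro sum.cong refl) (simp only: incl_monom monom_power mult_monom mult_1 mult_1_right add_0 add_0_right mult_ac add_ac)
  finally have "poly.coeff (double_sq (monom a 1) (monom b 1) p) k =
      (\<Sum>j\<le>N. \<Sum>i\<le>N. if i + j = k then a ^ i * b ^ j * [:sq i (sq j p):] else 0)"
    by (simp only: coeff_sum coeff_monom)
  also have "\<dots> = (\<Sum>j\<le>N. if j \<le> k then a ^ (k - j) * b ^ j * [:sq (k - j) (sq j p):] else 0)"
  proof (rule sum.cong[OF refl])
    fix j
    have "(\<Sum>i\<le>N. if i + j = k then a ^ i * b ^ j * [:sq i (sq j p):] else 0) =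
        (\<Sum>i\<le>N. if i = k - j then if j \<le> k then a ^ (k - j) * b ^ j * [:sq (k - j) (sq j p):] else 0 else 0)"
      by (intro sum.cong) auto
    also have "\<dots> = (if j \<le> k then a ^ (k - j) * b ^ j * [:sq (k - j) (sq j p):] else 0)"
      using N(1) by (simp, linarith)
    finally show "(\<Sum>i\<le>N. if i + j = k then a ^ i * b ^ j * [:sq i (sq j p):] else 0) = \<dots>" .
  qed
  also have "\<dots> = (\<Sum>j\<le>k. a ^ (k - j) * b ^ j * [:sq (k - j) (sq j p):])"
    using N by (intro sum.mono_neutral_cong_right) auto
  finally show ?thesis .
qed

text \<open>The coefficient of r^(a + b) supplies the hypothesis of
  \<open>adem_from_bullett_macdonald\<close> with Sq^(a + b - j) Sq^j p as \<open>c j\<close>, so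
  that \<open>c b\<close> is Sq^a Sq^b p.\<close>

lemma adem:
  assumes "a < 2 * b"
  shows "sq a (sq b p) \<asymp> (\<Sum>j=0..a div 2. of_nat ((b - j - 1) choose (a - 2 * j)) * sq (a + b - j) (sq j p))"
proof -
  let ?t = "[:0, 1:] :: (('v vertex \<Rightarrow>\<^sub>0 nat) \<Rightarrow>\<^sub>0 int) poly" and ?u = "[:1, -1:] :: (('v vertex \<Rightarrow>\<^sub>0 nat) \<Rightarrow>\<^sub>0 int) poly"
  have "1 - [:?t:] = [:?u:]"
    by (simp add: one_pCons)
  then have "PPJ.eqv (double_sq (monom (?t * ?u) 1) (monom 1 1) p) (double_sq (monom ?u 1) (monom (?t\<^sup>2) 1) p)"
    using bullett_macdonald[of "monom 1 1" "[:?t:]" p]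
    by (simp add: smult_monom mult.commute[of "monom 1 (Suc 0)"] power2_eq_square)
  then have "poly.coeff (double_sq (monom (?t * ?u) 1) (monom 1 1) p) (a + b)
      - poly.coeff (double_sq (monom ?u 1) (monom (?t\<^sup>2) 1) p) (a + b) \<in> poly_ideal J"
    unfolding PPJ.eqv_def by (simp add: poly_ideal_def)
  then have "(\<Sum>j\<le>a + b. (?t * ?u) ^ (a + b - j) * [:sq (a + b - j) (sq j p):])
      - (\<Sum>j\<le>a + b. ?u ^ (a + b - j) * ?t ^ (2 * j) * [:sq (a + b - j) (sq j p):]) \<in> poly_ideal J"
    by (simp only: coeff_double_sq power_one mult_1_right power_mult)
  from adem_from_bullett_macdonald[OF assms this] show ?thesis by simp
qed

end


section \<open>Span colourings over the field with two elements\<close>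

definition unit_seq :: "nat \<Rightarrow> nat \<Rightarrow> 'k::field" where
  "unit_seq i = (\<lambda>j. if j = i then 1 else 0)"

lemma sum_seq_apply: "(sum f A :: nat \<Rightarrow> 'k::field) j = (\<Sum>i\<in>A. f i j)"
  by (induction A rule: infinite_finite_induct) (auto simp: plus_fun_def zero_fun_def)

lemma unit_seq_expansion:
  fixes z :: "nat \<Rightarrow> bit"
  assumes "z \<in> coord_space n"
  shows "z = (\<Sum>i\<in>{i. i < n \<and> z i = 1}. unit_seq i)"
proof
  fix j
  have "(\<Sum>i\<in>{i. i < n \<and> z i = 1}. unit_seq i) j = (if j < n \<and> z j = 1 then 1 else 0 :: bit)"
    by (auto simp: sum_seq_apply unit_seq_def)
  then show "z j = (\<Sum>i\<in>{i. i < n \<and> z i = 1}. unit_seq i) j"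
    using assms by (auto simp: coord_space_def not_less)
qed

lemma coord_space_span: "(coord_space n :: (nat \<Rightarrow> bit) set) \<subseteq> seq_space.span (unit_seq ` {..<n})"
proof
  fix z :: "nat \<Rightarrow> bit" assume "z \<in> coord_space n"
  then show "z \<in> seq_space.span (unit_seq ` {..<n})"
    by (subst unit_seq_expansion) (auto intro: seq_space.span_sum seq_space.span_base)
qed

lemma coord_subspace_basis:
  fixes W :: "(nat \<Rightarrow> bit) set"
  assumes "coord_subspace n d W"
  obtains B where "finite B" "B \<subseteq> W" "seq_space.independent B" "seq_space.span B = W" "card B = d"
proof -
  have W: "W \<subseteq> coord_space n" "seq_space.subspace W" "seq_space.dim W = d"
    using assms by (auto simp: coord_subspace_def)
  obtain B where B: "B \<subseteq> W" "seq_space.independent B" "W \<subseteq> seq_space.span B" "card B = seq_space.dim W"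
    by (rule seq_space.basis_exists)
  have "B \<subseteq> seq_space.span (unit_seq ` {..<n})"
    using B(1) W(1) coord_space_span by blast
  with B(2) have "finite B"
    using seq_space.independent_span_bound[of "unit_seq ` {..<n}" B] by auto
  moreover have "seq_space.span B = W"
    using B W by (metis seq_space.span_minimal subset_antisym)
  ultimately show thesis using that B W by simp
qed

text \<open>Over Z/2 a hyperplane has just one other coset. Adding \<open>z\<close> to a basis of
  \<open>W\<close> gives \<open>n\<close> independent vectors, and a \<open>z'\<close> outside their
  span would give one too many. So \<open>z'\<close> is in \<open>W\<close> up to a multiple of
  \<open>z\<close>, and the scalar must be 1.\<close>

lemma hyperplane_complement_add:
  fixes W :: "(nat \<Rightarrow> bit) set"
  assumes W: "coord_subspace n (n - 1) W" and "0 < n"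
    and z: "z \<in> coord_space n" "z \<notin> W" and z': "z' \<in> coord_space n" "z' \<notin> W"
  shows "z + z' \<in> W"
proof -
  obtain B where B: "finite B" "B \<subseteq> W" "seq_space.independent B" "seq_space.span B = W" "card B = n - 1"
    by (rule coord_subspace_basis[OF W])
  have zB: "z \<notin> B" using B z by auto
  have ind: "seq_space.independent (insert z B)"
    using B z by (intro seq_space.independent_insertI) auto
  have "z' \<in> seq_space.span (insert z B)"
  proof (rule ccontr)
    assume *: "z' \<notin> seq_space.span (insert z B)"
    then have "seq_space.independent (insert z' (insert z B))"
      using ind by (rule seq_space.independent_insertI)
    moreover have "insert z' (insert z B) \<subseteq> seq_space.span (unit_seq ` {..<n})"
      using B(2) W z z' coord_space_span[of n] by (auto simp: coord_subspace_def)
    ultimately have "card (insert z' (insert z B)) \<le> card (unit_seq ` {..<n} :: (nat \<Rightarrow> bit) set)"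
      using seq_space.independent_span_bound[of "unit_seq ` {..<n}" "insert z' (insert z B)"] by auto
    also have "\<dots> \<le> n" using card_image_le[of "{..<n}" unit_seq] by simp
    finally have "card (insert z' (insert z B)) \<le> n" .
    moreover have "z' \<notin> insert z B" using * seq_space.span_base by blast
    ultimately show False using B zB \<open>0 < n\<close> by simp
  qed
  then obtain k where k: "z' - seq_scale k z \<in> W"
    using B by (auto simp: seq_space.span_insert)
  show ?thesis
  proof (cases "k = 0")
    case True
    then have "z' - seq_scale k z = z'" by (auto simp: seq_scale_def)
    with k z' show ?thesis by simp
  next
    case False
    then have "z' - seq_scale k z = z + z'"
      by (auto simp: seq_scale_def fun_eq_iff plus_fun_def fun_diff_def add.commute)
    with k show ?thesis by simp
  qed
qed

text \<open>Not being in \<open>W\<close> is the linear form with kernel \<open>W\<close>. The form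
  is never constructed: its values are added up over unit vectors, two non-members
  cancelling.\<close>

lemma sum_mem_hyperplane_iff:
  fixes W :: "(nat \<Rightarrow> bit) set"
  assumes W: "coord_subspace n (n - 1) W" and "finite I" "I \<subseteq> {..<n}"
  shows "sum unit_seq I \<in> W \<longleftrightarrow> even (card {i \<in> I. unit_seq i \<notin> W})"
  using assms(2,3)
proof (induction I rule: finite_induct)
  case empty
  have "0 \<in> W" using W by (simp only: coord_subspace_def seq_space.subspace_0)
  then show ?case by (simp add: zero_fun_def)
next
  case (insert i I)
  have sub: "seq_space.subspace W" and n: "0 < n"
    using W insert.prems by (auto simp: coord_subspace_def)
  have unit: "(unit_seq i :: nat \<Rightarrow> bit) \<in> coord_space n"
    using insert.prems by (auto simp: unit_seq_def coord_space_def)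
  have sum: "(sum unit_seq I :: nat \<Rightarrow> bit) \<in> coord_space n"
    unfolding coord_space_def mem_Collect_eq sum_seq_apply
    using insert.prems by (intro allI impI sum.neutral ballI) (auto simp: unit_seq_def)
  have "sum unit_seq (insert i I) \<in> W \<longleftrightarrow> (unit_seq i \<in> W \<longleftrightarrow> sum unit_seq I \<in> W)"
  proof -
    have "sum unit_seq (insert i I) = unit_seq i + (sum unit_seq I :: nat \<Rightarrow> bit)"
      using insert by simp
    moreover have "a + b \<in> W \<longleftrightarrow> b \<in> W" "b + a \<in> W \<longleftrightarrow> b \<in> W" if "a \<in> W" for a b
      using sub that seq_space.subspace_add seq_space.subspace_diff
      by (metis add_diff_cancel_left', metis add_diff_cancel_right')
    ultimately show ?thesis
      using hyperplane_complement_add[OF W n unit _ sum] by metis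
  qed
  moreover have "even (card {j \<in> insert i I. unit_seq j \<notin> W}) \<longleftrightarrow>
      (unit_seq i \<in> W \<longleftrightarrow> even (card {j \<in> I. unit_seq j \<notin> W}))"
  proof -
    have "{j \<in> insert i I. unit_seq j \<notin> W} =
        (if unit_seq i \<in> W then {j \<in> I. unit_seq j \<notin> W} else insert i {j \<in> I. unit_seq j \<notin> W})"
      by auto
    then show ?thesis using insert.hyps by (cases "unit_seq i \<in> W") simp_all
  qed
  ultimately show ?case using insert.IH insert.prems by blast
qed

lemma coord_subspace_1_obtains:
  fixes U W :: "(nat \<Rightarrow> bit) set"
  assumes U: "coord_subspace n 1 U" and W: "coord_subspace n d W" and "\<not> U \<subseteq> W"
  obtains u where "u \<in> U" "u \<notin> W" "u \<in> coord_space n" "0 < n"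
proof -
  obtain u where u: "u \<in> U" "u \<notin> W" using assms(3) by blast
  have "u \<in> coord_space n" using u U by (auto simp: coord_subspace_def)
  moreover have "u \<noteq> 0" using u W seq_space.subspace_0 by (auto simp: coord_subspace_def)
  ultimately have "0 < n" by (auto simp: coord_space_def fun_eq_iff intro!: Nat.gr0I)
  with u \<open>u \<in> coord_space n\<close> that show thesis by blast
qed

lemma ex_span_colouring_if_chromatic_number_le:
  fixes V :: "'v set"
  assumes "span_chromatic_number TYPE('k::field) V E \<le> enat n"
  obtains m and c :: "'v \<Rightarrow> (nat \<Rightarrow> 'k::field) set \<times> (nat \<Rightarrow> 'k) set" where "m \<le> n" "span_colouring m V E c"
proof -
  let ?S = "{enat m | m. \<exists>c :: 'v \<Rightarrow> (nat \<Rightarrow> 'k::field) set \<times> (nat \<Rightarrow> 'k) set. span_colouring m V E c}"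
  \<comment> \<open>A strict upper bound on the infimum yields an element of the set below that
    bound.\<close>
  have "Inf ?S < enat (Suc n)"
    using assms by (simp add: span_chromatic_number_def order_le_less_trans)
  then obtain e where "e \<in> ?S" and e: "e < enat (Suc n)"
    by (auto simp only: Inf_less_iff)
  then obtain m and c :: "'v \<Rightarrow> (nat \<Rightarrow> 'k) set \<times> (nat \<Rightarrow> 'k) set" where "e = enat m" "span_colouring m V E c"
    by blast
  with e that[of m c] show thesis by simp
qed

text \<open>The colouring may live in a dimension m < n; padding by zeros turns it into data for
  \<open>n\<close>. The pairing of \<open>F w\<close> and \<open>G v\<close> is odd exactly when the
  vector of \<open>v\<close> is outside the hyperplane of \<open>w\<close>.\<close>

lemma ex_span_data:
  fixes V :: "'v set"
  assumes L: "simplicial_complex_on V L" and "finite V"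
    and "span_chromatic_number TYPE(bit) V (skeleton_edges L) \<le> enat n"
  shows "\<exists>F G. span_data n V L F G"
proof -
  obtain m and c :: "'v \<Rightarrow> (nat \<Rightarrow> bit) set \<times> (nat \<Rightarrow> bit) set"
    where m: "m \<le> n" and c: "span_colouring m V (skeleton_edges L) c"
    by (rule ex_span_colouring_if_chromatic_number_le[OF assms(3)])
  have W: "coord_subspace m (m - 1) (snd (c v))" if "v \<in> V" for v
    using c that by (auto simp: span_colouring_def)
  have "\<exists>u. u \<in> fst (c v) \<and> u \<notin> snd (c v) \<and> u \<in> coord_space m" if "v \<in> V" for v
    using c that coord_subspace_1_obtains[of m "fst (c v)" "m - 1" "snd (c v)"]
    unfolding span_colouring_def by metis
  then obtain u where u: "\<And>v. v \<in> V \<Longrightarrow> u v \<in> fst (c v) \<and> u v \<notin> snd (c v) \<and> u v \<in> coord_space m"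
    by metis
  \<comment> \<open>Sequences are indexed from 0 and the x_i from 1, hence the shift by one.\<close>
  define F where "F v i = (of_bool (i \<in> {1..m} \<and> unit_seq (i - 1) \<notin> snd (c v)) :: int)" for v i
  define G where "G v i = (of_bool (i \<in> {1..m} \<and> u v (i - 1) = 1) :: int)" for v i
  have pairing: "odd (\<Sum>i=1..n. F w i * G v i) \<longleftrightarrow> u v \<notin> snd (c w)" if "v \<in> V" "w \<in> V" for v w
  proof -
    define I where "I = {i. i < m \<and> u v i = 1}"
    define T where "T = {i \<in> I. unit_seq i \<notin> snd (c w)}"
    have "(\<Sum>i=1..n. F w i * G v i) = (\<Sum>i\<in>Suc ` T. 1)"
    proof (rule sum.mono_neutral_cong_right)
      show "Suc ` T \<subseteq> {1..n}" using m by (auto simp: T_def I_def)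
      show "\<forall>i\<in>{1..n} - Suc ` T. F w i * G v i = 0"
      proof
        fix i assume i: "i \<in> {1..n} - Suc ` T"
        then have "i - 1 \<notin> T" by (metis DiffE Suc_pred' atLeastAtMost_iff imageI less_eq_Suc_le One_nat_def)
        with i show "F w i * G v i = 0" by (auto simp: F_def G_def T_def I_def)
      qed
    qed (auto simp: F_def G_def T_def I_def)
    also have "\<dots> = int (card {i \<in> I. unit_seq i \<notin> snd (c w)})"
      by (simp add: card_image T_def)
    finally have "odd (\<Sum>i=1..n. F w i * G v i) \<longleftrightarrow> odd (card {i \<in> I. unit_seq i \<notin> snd (c w)})"
      by simp
    also have "\<dots> \<longleftrightarrow> sum unit_seq I \<notin> snd (c w)"
      using sum_mem_hyperplane_iff[OF W[OF that(2)], of I] by (auto simp: I_def)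
    also have "sum unit_seq I = u v"
      using unit_seq_expansion[of "u v" m] u[OF that(1)] by (simp add: I_def)
    finally show ?thesis .
  qed
  have "span_data n V L F G"
  proof
    show "odd (\<Sum>i=1..n. F v i * G v i)" if "v \<in> V" for v
      using pairing[OF that that] u[OF that] by simp
    show "even (\<Sum>i=1..n. F w i * G v i)" if "v \<in> V" "w \<in> V" "v \<noteq> w" "{v, w} \<in> L" for v w
    proof -
      have "{v, w} \<in> skeleton_edges L" using that by (simp add: skeleton_edges_def)
      then have "fst (c v) \<subseteq> snd (c w)" using c that by (auto simp: span_colouring_def)
      then show ?thesis using pairing[OF that(1,2)] u[OF that(1)] by auto
    qed
    show "F v i = 0" if "i \<notin> {1..n}" for v i
      using that m by (auto simp: F_def)
  qed (rule L, rule \<open>finite V\<close>)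
  then show ?thesis by blast
qed


section \<open>Monoid rings\<close>

lemma carrier_monoid_ring: "carrier (monoid_ring G) = {p. Poly_Mapping.keys p \<subseteq> carrier G}"
  and zero_monoid_ring: "\<zero>\<^bsub>monoid_ring G\<^esub> = 0"
  and add_monoid_ring: "p \<oplus>\<^bsub>monoid_ring G\<^esub> q = p + q"
  and one_monoid_ring: "\<one>\<^bsub>monoid_ring G\<^esub> = Poly_Mapping.single \<one>\<^bsub>G\<^esub> 1"
  and mult_monoid_ring: "p \<otimes>\<^bsub>monoid_ring G\<^esub> q = (\<Sum>s\<in>Poly_Mapping.keys p. \<Sum>t\<in>Poly_Mapping.keys q.
    Poly_Mapping.single (s \<otimes>\<^bsub>G\<^esub> t) (Poly_Mapping.lookup p s * Poly_Mapping.lookup q t))"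
  by (simp_all add: monoid_ring_def)

lemma monoid_ring_mult_add_left:
  "(p + p') \<otimes>\<^bsub>monoid_ring G\<^esub> q = p \<otimes>\<^bsub>monoid_ring G\<^esub> q + p' \<otimes>\<^bsub>monoid_ring G\<^esub> q"
  unfolding mult_monoid_ring
  by (rule setsum_keys_plus_distrib) (simp_all add: distrib_right single_add sum.distrib)

lemma monoid_ring_mult_add_right:
  "p \<otimes>\<^bsub>monoid_ring G\<^esub> (q + q') = p \<otimes>\<^bsub>monoid_ring G\<^esub> q + p \<otimes>\<^bsub>monoid_ring G\<^esub> q'"
  unfolding mult_monoid_ring sum.distrib[symmetric]
  by (intro sum.cong refl setsum_keys_plus_distrib) (simp_all add: distrib_left single_add)

lemma monoid_ring_mult_zero [simp]:
  "0 \<otimes>\<^bsub>monoid_ring G\<^esub> q = 0" "q \<otimes>\<^bsub>monoid_ring G\<^esub> 0 = 0"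
  by (simp_all add: mult_monoid_ring)

lemma monoid_ring_mult_single:
  "Poly_Mapping.single s a \<otimes>\<^bsub>monoid_ring G\<^esub> Poly_Mapping.single t b = Poly_Mapping.single (s \<otimes>\<^bsub>G\<^esub> t) (a * b)"
  by (simp add: mult_monoid_ring)

lemma monoid_ring_induct [consumes 1, case_names zero add]:
  assumes "p \<in> carrier (monoid_ring G)" and "P 0"
    and "\<And>s a p. \<lbrakk>s \<in> carrier G; p \<in> carrier (monoid_ring G); P p\<rbrakk> \<Longrightarrow> P (Poly_Mapping.single s a + p)"
  shows "P p"
  using assms(1)
proof (induction p rule: poly_mapping_single_induct)
  case zero
  show ?case by (rule assms(2))
next
  case (add p s a)
  have "Poly_Mapping.keys (Poly_Mapping.single s a + p) = insert s (Poly_Mapping.keys p)"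
    using add(1,2) by (rule keys_single_add)
  then have "s \<in> carrier G" "p \<in> carrier (monoid_ring G)"
    using add.prems by (auto simp: carrier_monoid_ring)
  then show ?case using add.IH assms(3) by blast
qed

lemma monoid_ring_add_closed:
  "\<lbrakk>p \<in> carrier (monoid_ring G); q \<in> carrier (monoid_ring G)\<rbrakk> \<Longrightarrow> p + q \<in> carrier (monoid_ring G)"
  using Poly_Mapping.keys_add[of p q] by (auto simp: carrier_monoid_ring)

lemma single_mem_monoid_ring: "s \<in> carrier G \<Longrightarrow> Poly_Mapping.single s a \<in> carrier (monoid_ring G)"
  by (simp add: carrier_monoid_ring)

lemma monoid_ring_uminus_closed: "p \<in> carrier (monoid_ring G) \<Longrightarrow> - p \<in> carrier (monoid_ring G)"
  by (auto simp: carrier_monoid_ring in_keys_iff)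

text \<open>The product is biadditive, so the ring axioms reduce to basis elements, where they are
  the laws of \<open>G\<close>. Applied to pairs for the tensor product and to words for the
  Steenrod algebra.\<close>

lemma ring_monoid_ring:
  fixes G :: "('g, 'x) monoid_scheme"
  assumes "monoid G"
  shows "ring (monoid_ring G :: ('g \<Rightarrow>\<^sub>0 'a::ring_1) ring)"
proof -
  interpret monoid G by fact
  let ?R = "monoid_ring G :: ('g \<Rightarrow>\<^sub>0 'a) ring"
  have closed: "p \<otimes>\<^bsub>?R\<^esub> q \<in> carrier ?R" if "p \<in> carrier ?R" "q \<in> carrier ?R" for p q
    using that(1)
  proof (induction p rule: monoid_ring_induct)
    case (add s a p)
    from that(2) have "Poly_Mapping.single s a \<otimes>\<^bsub>?R\<^esub> q \<in> carrier ?R"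
    proof (induction q rule: monoid_ring_induct)
      case (add t b q)
      then show ?case
        using \<open>s \<in> carrier G\<close>
        by (simp add: monoid_ring_mult_add_right monoid_ring_mult_single monoid_ring_add_closed single_mem_monoid_ring)
    qed (simp add: carrier_monoid_ring)
    with add show ?case by (simp add: monoid_ring_mult_add_left monoid_ring_add_closed)
  qed (simp add: carrier_monoid_ring)
  have assoc: "p \<otimes>\<^bsub>?R\<^esub> q \<otimes>\<^bsub>?R\<^esub> r = p \<otimes>\<^bsub>?R\<^esub> (q \<otimes>\<^bsub>?R\<^esub> r)"
    if "p \<in> carrier ?R" "q \<in> carrier ?R" "r \<in> carrier ?R" for p q r
    using that(1)
  proof (induction p rule: monoid_ring_induct)
    case (add s a p)
    from that(2) have "Poly_Mapping.single s a \<otimes>\<^bsub>?R\<^esub> q \<otimes>\<^bsub>?R\<^esub> r = Poly_Mapping.single s a \<otimes>\<^bsub>?R\<^esub> (q \<otimes>\<^bsub>?R\<^esub> r)"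
    proof (induction q rule: monoid_ring_induct)
      case (add t b q)
      from that(3) have "Poly_Mapping.single s a \<otimes>\<^bsub>?R\<^esub> Poly_Mapping.single t b \<otimes>\<^bsub>?R\<^esub> r =
          Poly_Mapping.single s a \<otimes>\<^bsub>?R\<^esub> (Poly_Mapping.single t b \<otimes>\<^bsub>?R\<^esub> r)"
      proof (induction r rule: monoid_ring_induct)
        case (add u c r)
        then show ?case
          using \<open>s \<in> carrier G\<close> \<open>t \<in> carrier G\<close>
          by (simp add: monoid_ring_mult_add_right monoid_ring_mult_single mult.assoc m_assoc)
      qed simp
      with add show ?case by (simp add: monoid_ring_mult_add_left monoid_ring_mult_add_right)
    qed simp
    with add show ?case by (simp add: monoid_ring_mult_add_left)
  qed simp
  have one: "\<one>\<^bsub>?R\<^esub> \<otimes>\<^bsub>?R\<^esub> p = p \<and> p \<otimes>\<^bsub>?R\<^esub> \<one>\<^bsub>?R\<^esub> = p" if "p \<in> carrier ?R" for p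
    using that
    by (induction p rule: monoid_ring_induct)
       (simp_all add: one_monoid_ring monoid_ring_mult_add_left monoid_ring_mult_add_right monoid_ring_mult_single)
  show ?thesis
  proof (rule ringI)
    show "abelian_group ?R"
    proof (rule abelian_groupI)
      show "\<exists>q\<in>carrier ?R. q \<oplus>\<^bsub>?R\<^esub> p = \<zero>\<^bsub>?R\<^esub>" if "p \<in> carrier ?R" for p
        using that by (intro bexI[of _ "- p"]) (simp_all add: add_monoid_ring zero_monoid_ring monoid_ring_uminus_closed)
    qed (simp_all add: add_monoid_ring zero_monoid_ring monoid_ring_add_closed add_ac, simp add: carrier_monoid_ring)
    show "monoid ?R"
      using closed assoc one by (intro monoidI) (simp_all add: one_monoid_ring single_mem_monoid_ring)
  qed (simp_all add: add_monoid_ring monoid_ring_mult_add_left monoid_ring_mult_add_right)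
qed

lemma cring_monoid_ring:
  fixes G :: "('g, 'x) monoid_scheme"
  assumes "comm_monoid G"
  shows "cring (monoid_ring G :: ('g \<Rightarrow>\<^sub>0 'a::comm_ring_1) ring)"
proof -
  interpret comm_monoid G by fact
  let ?R = "monoid_ring G :: ('g \<Rightarrow>\<^sub>0 'a) ring"
  interpret R: ring ?R by (rule ring_monoid_ring) unfold_locales
  have "p \<otimes>\<^bsub>?R\<^esub> q = q \<otimes>\<^bsub>?R\<^esub> p" if "p \<in> carrier ?R" "q \<in> carrier ?R" for p q
    using that(1)
  proof (induction p rule: monoid_ring_induct)
    case (add s a p)
    from that(2) have "Poly_Mapping.single s a \<otimes>\<^bsub>?R\<^esub> q = q \<otimes>\<^bsub>?R\<^esub> Poly_Mapping.single s a"
    proof (induction q rule: monoid_ring_induct)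
      case (add t b q)
      then show ?case
        using \<open>s \<in> carrier G\<close> m_comm[of s t]
        by (simp add: monoid_ring_mult_add_left monoid_ring_mult_add_right monoid_ring_mult_single mult.commute)
    qed simp
    with add show ?case by (simp add: monoid_ring_mult_add_left monoid_ring_mult_add_right)
  qed simp
  then show ?thesis
    by (intro cring.intro R.ring_axioms comm_monoid.intro R.monoid_axioms comm_monoid_axioms.intro)
qed

lemma a_inv_monoid_ring:
  fixes G :: "('g, 'x) monoid_scheme" and p :: "'g \<Rightarrow>\<^sub>0 'a::ring_1"
  assumes "monoid G" "p \<in> carrier (monoid_ring G)"
  shows "\<ominus>\<^bsub>monoid_ring G\<^esub> p = - p"
proof -
  interpret ring "monoid_ring G :: ('g \<Rightarrow>\<^sub>0 'a) ring" by (rule ring_monoid_ring) fact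
  show ?thesis
    by (rule minus_equality) (simp_all add: assms monoid_ring_uminus_closed add_monoid_ring zero_monoid_ring)
qed

lemma ideal_monoid_ringI:
  fixes G :: "('g, 'x) monoid_scheme" and I :: "('g \<Rightarrow>\<^sub>0 'a::ring_1) set"
  assumes G: "monoid G" and "I \<subseteq> carrier (monoid_ring G)" "0 \<in> I"
    and "\<And>p q. \<lbrakk>p \<in> I; q \<in> I\<rbrakk> \<Longrightarrow> p + q \<in> I" and "\<And>p. p \<in> I \<Longrightarrow> - p \<in> I"
    and "\<And>p q. \<lbrakk>p \<in> I; q \<in> carrier (monoid_ring G)\<rbrakk> \<Longrightarrow> q \<otimes>\<^bsub>monoid_ring G\<^esub> p \<in> I"
    and "\<And>p q. \<lbrakk>p \<in> I; q \<in> carrier (monoid_ring G)\<rbrakk> \<Longrightarrow> p \<otimes>\<^bsub>monoid_ring G\<^esub> q \<in> I"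
  shows "ideal I (monoid_ring G)"
proof (rule idealI)
  show ring: "ring (monoid_ring G :: ('g \<Rightarrow>\<^sub>0 'a) ring)" by (rule ring_monoid_ring) fact
  show "subgroup I (add_monoid (monoid_ring G))"
  proof
    fix p assume "p \<in> I"
    then have "inv\<^bsub>add_monoid (monoid_ring G)\<^esub> p = - p"
      using a_inv_monoid_ring[OF G, of p] assms(2) by (auto simp: a_inv_def)
    then show "inv\<^bsub>add_monoid (monoid_ring G)\<^esub> p \<in> I"
      using assms(5) \<open>p \<in> I\<close> by simp
  qed (use assms in \<open>auto simp: add_monoid_ring zero_monoid_ring\<close>)
qed (use assms in auto)


section \<open>Integral Stanley-Reisner rings\<close>

lemma carrier_int_poly_ring: "carrier (int_poly_ring W) = {p. \<forall>m\<in>Poly_Mapping.keys p. Poly_Mapping.keys m \<subseteq> W}"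
  and zero_int_poly_ring: "\<zero>\<^bsub>int_poly_ring W\<^esub> = 0"
  and one_int_poly_ring: "\<one>\<^bsub>int_poly_ring W\<^esub> = 1"
  and add_int_poly_ring: "p \<oplus>\<^bsub>int_poly_ring W\<^esub> q = p + q"
  and mult_int_poly_ring: "p \<otimes>\<^bsub>int_poly_ring W\<^esub> q = p * q"
  by (simp_all add: int_poly_ring_def ring_of_type_algebra_def)

lemmas int_poly_ring_simps = zero_int_poly_ring one_int_poly_ring add_int_poly_ring mult_int_poly_ring

lemma
  assumes "p \<in> carrier (int_poly_ring W)"
  shows int_poly_ring_add_closed: "q \<in> carrier (int_poly_ring W) \<Longrightarrow> p + q \<in> carrier (int_poly_ring W)"
    and int_poly_ring_mult_closed: "q \<in> carrier (int_poly_ring W) \<Longrightarrow> p * q \<in> carrier (int_poly_ring W)"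
    and int_poly_ring_uminus_closed: "- p \<in> carrier (int_poly_ring W)"
  using assms Poly_Mapping.keys_add[of p q]
  by (auto simp: carrier_int_poly_ring dest!: subsetD[OF keys_mult] simp: keys_add_nat) (metis subsetD)+

lemmas int_poly_ring_closed =
  int_poly_ring_add_closed int_poly_ring_mult_closed int_poly_ring_uminus_closed

lemma int_poly_ring_consts: "0 \<in> carrier (int_poly_ring W)" "1 \<in> carrier (int_poly_ring W)"
  by (auto simp: carrier_int_poly_ring)

lemma cring_int_poly_ring: "cring (int_poly_ring W)"
proof (rule cringI)
  show "abelian_group (int_poly_ring W)"
  proof (rule abelian_groupI)
    show "\<exists>q\<in>carrier (int_poly_ring W). q \<oplus>\<^bsub>int_poly_ring W\<^esub> p = \<zero>\<^bsub>int_poly_ring W\<^esub>"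
      if "p \<in> carrier (int_poly_ring W)" for p
      using that by (intro bexI[of _ "- p"]) (simp_all add: int_poly_ring_simps int_poly_ring_closed)
  qed (simp_all add: int_poly_ring_simps int_poly_ring_closed int_poly_ring_consts add_ac)
  show "comm_monoid (int_poly_ring W)"
    by (rule comm_monoidI) (simp_all add: int_poly_ring_simps int_poly_ring_closed int_poly_ring_consts mult_ac)
qed (simp add: int_poly_ring_simps distrib_right)

lemma a_inv_int_poly_ring: "p \<in> carrier (int_poly_ring W) \<Longrightarrow> \<ominus>\<^bsub>int_poly_ring W\<^esub> p = - p"
proof -
  interpret cring "int_poly_ring W" by (rule cring_int_poly_ring)
  show "p \<in> carrier (int_poly_ring W) \<Longrightarrow> \<ominus>\<^bsub>int_poly_ring W\<^esub> p = - p"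
    by (rule minus_equality) (simp_all add: int_poly_ring_simps int_poly_ring_closed)
qed


lemma ideal_Int_int_poly_ring:
  fixes J :: "(('w \<Rightarrow>\<^sub>0 nat) \<Rightarrow>\<^sub>0 int) set"
  assumes "ring_ideal J"
  shows "ideal (J \<inter> carrier (int_poly_ring W)) (int_poly_ring W)"
proof -
  interpret ring_ideal J by fact
  interpret R: cring "int_poly_ring W" by (rule cring_int_poly_ring)
  show ?thesis
  proof (rule idealI)
    show "ring (int_poly_ring W)" by unfold_locales
    show "subgroup (J \<inter> carrier (int_poly_ring W)) (add_monoid (int_poly_ring W))"
    proof
      fix p assume p: "p \<in> J \<inter> carrier (int_poly_ring W)"
      then have "inv\<^bsub>add_monoid (int_poly_ring W)\<^esub> p = - p"
        using a_inv_int_poly_ring by (auto simp: a_inv_def)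
      then show "inv\<^bsub>add_monoid (int_poly_ring W)\<^esub> p \<in> J \<inter> carrier (int_poly_ring W)"
        using p by (simp add: uminus_mem int_poly_ring_uminus_closed)
    qed (auto simp: int_poly_ring_simps int_poly_ring_closed int_poly_ring_consts add_mem zero_mem)
  qed (auto simp: int_poly_ring_simps int_poly_ring_closed mult_mem mult_mem_right)
qed

abbreviation face_generators :: "'w set \<Rightarrow> 'w set set \<Rightarrow> (('w \<Rightarrow>\<^sub>0 nat) \<Rightarrow>\<^sub>0 int) set" where
  "face_generators W K \<equiv> {\<Prod>v\<in>\<sigma>. indet v | \<sigma>. finite \<sigma> \<and> \<sigma> \<subseteq> W \<and> \<sigma> \<notin> K}"

lemma face_generators_subset: "face_generators W K \<subseteq> carrier (int_poly_ring W)"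
proof
  fix p assume "p \<in> face_generators W K"
  then obtain \<sigma> where \<sigma>: "p = (\<Prod>v\<in>\<sigma>. indet v)" "finite \<sigma>" "\<sigma> \<subseteq> W" by blast
  then show "p \<in> carrier (int_poly_ring W)"
    using keys_indicator_monomial[OF \<sigma>(2)] by (auto simp: prod_indet carrier_int_poly_ring)
qed

lemma ideal_stanley_reisner_ideal: "ideal (stanley_reisner_ideal W K) (int_poly_ring W)"
  unfolding stanley_reisner_ideal_def
  by (rule ring.genideal_ideal[OF cring.axioms(1)[OF cring_int_poly_ring] face_generators_subset])

lemma stanley_reisner_ideal_subset:
  assumes down: "\<And>\<sigma> \<tau>. \<lbrakk>\<sigma> \<in> K; \<tau> \<subseteq> \<sigma>\<rbrakk> \<Longrightarrow> \<tau> \<in> K"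
  shows "stanley_reisner_ideal W K \<subseteq> mod2_face_ideal K"
proof -
  have "ring_ideal (mod2_face_ideal K)"
    by (rule even_ring_ideal.axioms(1)[OF even_ring_ideal_mod2_face_ideal]) (rule down)
  moreover have "face_generators W K \<subseteq> mod2_face_ideal K"
    proof
    fix p assume "p \<in> face_generators W K"
    then obtain \<sigma> where \<sigma>: "p = (\<Prod>v\<in>\<sigma>. indet v)" "finite \<sigma>" "\<sigma> \<notin> K" by blast
    then show "p \<in> mod2_face_ideal K"
      using keys_indicator_monomial[OF \<sigma>(2)] by (simp add: prod_indet single_mem_mod2_face_ideal)
  qed
  ultimately show ?thesis
    unfolding stanley_reisner_ideal_def
    using ring.genideal_minimal[OF cring.axioms(1)[OF cring_int_poly_ring] ideal_Int_int_poly_ring,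
        of "mod2_face_ideal K" "face_generators W K" W] face_generators_subset[of W K] by blast
qed

text \<open>A monomial with non-face support is a multiple of the square-free monomial on that
  support, which is a generator.\<close>

lemma mem_stanley_reisner_ideal:
  assumes "p \<in> carrier (int_poly_ring W)" "\<And>m. m \<in> Poly_Mapping.keys p \<Longrightarrow> Poly_Mapping.keys m \<notin> K"
  shows "p \<in> stanley_reisner_ideal W K"
proof -
  interpret ideal "stanley_reisner_ideal W K" "int_poly_ring W"
    by (rule ideal_stanley_reisner_ideal)
  have single: "Poly_Mapping.single m c \<in> stanley_reisner_ideal W K"
    if m: "Poly_Mapping.keys m \<subseteq> W" "Poly_Mapping.keys m \<notin> K" for m c
  proof -
    \<comment> \<open>The square-free part of \<open>m\<close>. The subtraction \<open>m - e\<close>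
      is not truncated, as \<open>e\<close> has exponent 1 only where \<open>m\<close> has a
      positive one.\<close>
    define e where "e = (\<Sum>v\<in>Poly_Mapping.keys m. Poly_Mapping.single v (1::nat))"
    have "m = (m - e) + e"
      by (rule poly_mapping_eqI)
         (simp only: lookup_add lookup_minus e_def lookup_indicator_monomial finite_keys, auto simp: in_keys_iff)
    then have "Poly_Mapping.single m c = Poly_Mapping.single (m - e) c * Poly_Mapping.single e 1"
      by (metis mult_single mult_1_right)
    also have "Poly_Mapping.single e 1 = (\<Prod>v\<in>Poly_Mapping.keys m. indet v)"
      by (simp only: prod_indet finite_keys e_def)
    finally have eq: "Poly_Mapping.single m c = Poly_Mapping.single (m - e) c * (\<Prod>v\<in>Poly_Mapping.keys m. indet v)" .
    have "(\<Prod>v\<in>Poly_Mapping.keys m. indet v) \<in> face_generators W K"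
      using m by auto
    then have "(\<Prod>v\<in>Poly_Mapping.keys m. indet v) \<in> stanley_reisner_ideal W K"
      unfolding stanley_reisner_ideal_def using genideal_self[OF face_generators_subset] by blast
    moreover have "Poly_Mapping.keys (m - e) \<subseteq> Poly_Mapping.keys m"
      by (auto simp: in_keys_iff lookup_minus)
    then have "Poly_Mapping.single (m - e) c \<in> carrier (int_poly_ring W)"
      using m by (auto simp: carrier_int_poly_ring)
    ultimately show ?thesis
      unfolding eq using I_l_closed by (simp add: mult_int_poly_ring)
  qed
  show ?thesis
    using assms
  proof (induction p rule: poly_mapping_single_induct)
    case zero
    show ?case
      using additive_subgroup.zero_closed[OF additive_subgroup_axioms] by (simp add: zero_int_poly_ring)
  next
    case (add p m c)
    have keys: "Poly_Mapping.keys (Poly_Mapping.single m c + p) = insert m (Poly_Mapping.keys p)"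
      using add(1,2) by (rule keys_single_add)
    have "Poly_Mapping.single m c \<in> stanley_reisner_ideal W K" "p \<in> stanley_reisner_ideal W K"
      using add.prems add.IH unfolding keys by (auto simp: carrier_int_poly_ring keys intro!: single)
    then show ?case
      using additive_subgroup.a_closed[OF additive_subgroup_axioms] by (simp add: add_int_poly_ring)
  qed
qed


section \<open>Tensor products\<close>

locale tensor_product = A: cring A + B: cring B
  for A :: "('a, 'x) ring_scheme" and B :: "('b, 'y) ring_scheme"
begin

abbreviation "MR \<equiv> monoid_ring (A \<times>\<times> B) :: ('a \<times> 'b \<Rightarrow>\<^sub>0 int) ring"
abbreviation "tensor \<equiv> pure_tensor A B"

lemma comm_monoid_DirProd: "comm_monoid (A \<times>\<times> B)"
  by (rule comm_monoidI) (auto simp: A.m_assoc B.m_assoc intro: A.m_comm B.m_comm)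

sublocale MR: cring MR
  by (rule cring_monoid_ring) (rule comm_monoid_DirProd)

lemma tensor_relations_subset: "tensor_relations A B \<subseteq> carrier MR"
proof -
  have "p - q - r \<in> carrier MR" if "p \<in> carrier MR" "q \<in> carrier MR" "r \<in> carrier MR" for p q r
    using that monoid_ring_add_closed monoid_ring_uminus_closed by (metis diff_conv_add_uminus)
  then show ?thesis
    by (auto simp: tensor_relations_def single_mem_monoid_ring)
qed

sublocale T: ideal "tensor_ideal A B" MR
  unfolding tensor_ideal_def by (rule MR.genideal_ideal[OF tensor_relations_subset])

sublocale Q: cring "tensor_ring A B"
  unfolding tensor_ring_def by (rule T.quotient_is_cring) (rule MR.cring_axioms)

definition "coset p = tensor_ideal A B +>\<^bsub>MR\<^esub> p"

lemma tensor_eq_coset: "tensor a b = coset (Poly_Mapping.single (a, b) 1)"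
  by (simp add: pure_tensor_def coset_def)

lemma coset_ring_hom: "coset \<in> ring_hom MR (tensor_ring A B)"
  using T.rcos_ring_hom by (simp add: tensor_ring_def coset_def[abs_def])

lemma coset_closed: "p \<in> carrier MR \<Longrightarrow> coset p \<in> carrier (tensor_ring A B)"
  by (rule ring_hom_closed[OF coset_ring_hom])

lemma coset_add: "\<lbrakk>p \<in> carrier MR; q \<in> carrier MR\<rbrakk> \<Longrightarrow> coset (p + q) = coset p \<oplus>\<^bsub>tensor_ring A B\<^esub> coset q"
  using ring_hom_add[OF coset_ring_hom, of p q] by (simp add: add_monoid_ring)

lemma coset_mult:
  "\<lbrakk>p \<in> carrier MR; q \<in> carrier MR\<rbrakk> \<Longrightarrow> coset (p \<otimes>\<^bsub>MR\<^esub> q) = coset p \<otimes>\<^bsub>tensor_ring A B\<^esub> coset q"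
  by (rule ring_hom_mult[OF coset_ring_hom])

lemma coset_surj: "z \<in> carrier (tensor_ring A B) \<Longrightarrow> \<exists>p\<in>carrier MR. z = coset p"
  by (auto simp: tensor_ring_def FactRing_def A_RCOSETS_def' coset_def)

lemma coset_eq_zero_iff: "p \<in> carrier MR \<Longrightarrow> coset p = \<zero>\<^bsub>tensor_ring A B\<^esub> \<longleftrightarrow> p \<in> tensor_ideal A B"
  unfolding coset_def tensor_ring_def FactRing_def
  using T.a_rcos_self[of p] MR.a_coset_join2[OF _ T.a_subgroup] by auto

lemma coset_zero: "coset 0 = \<zero>\<^bsub>tensor_ring A B\<^esub>"
  using coset_eq_zero_iff[of 0] additive_subgroup.zero_closed[OF T.additive_subgroup_axioms] MR.zero_closed
  by (simp add: zero_monoid_ring)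

lemma tensor_closed: "\<lbrakk>a \<in> carrier A; b \<in> carrier B\<rbrakk> \<Longrightarrow> tensor a b \<in> carrier (tensor_ring A B)"
  by (simp add: tensor_eq_coset coset_closed single_mem_monoid_ring)

lemma coset_eq_if_relation:
  assumes "p - q - r \<in> tensor_relations A B" "p \<in> carrier MR" "q \<in> carrier MR" "r \<in> carrier MR"
  shows "coset p = coset q \<oplus>\<^bsub>tensor_ring A B\<^esub> coset r"
proof -
  have T: "p - q - r \<in> tensor_ideal A B"
    unfolding tensor_ideal_def using assms(1) MR.genideal_self[OF tensor_relations_subset] by blast
  have mem: "p - q - r \<in> carrier MR" using assms(1) tensor_relations_subset by blast
  have "coset p = coset ((p - q - r) + (q + r))" by simp
  also have "\<dots> = coset (p - q - r) \<oplus>\<^bsub>tensor_ring A B\<^esub> coset (q + r)"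
    by (rule coset_add[OF mem]) (rule monoid_ring_add_closed[OF assms(3,4)])
  also have "coset (p - q - r) = \<zero>\<^bsub>tensor_ring A B\<^esub>"
    using coset_eq_zero_iff[OF mem] T by simp
  finally show ?thesis
    using assms by (simp add: coset_add coset_closed)
qed

lemma tensor_add_left:
  assumes "a \<in> carrier A" "a' \<in> carrier A" "b \<in> carrier B"
  shows "tensor (a \<oplus>\<^bsub>A\<^esub> a') b = tensor a b \<oplus>\<^bsub>tensor_ring A B\<^esub> tensor a' b"
  unfolding tensor_eq_coset using assms
  by (intro coset_eq_if_relation) (auto simp: tensor_relations_def single_mem_monoid_ring)

lemma tensor_add_right:
  assumes "a \<in> carrier A" "b \<in> carrier B" "b' \<in> carrier B"
  shows "tensor a (b \<oplus>\<^bsub>B\<^esub> b') = tensor a b \<oplus>\<^bsub>tensor_ring A B\<^esub> tensor a b'"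
  unfolding tensor_eq_coset using assms
  by (intro coset_eq_if_relation) (auto simp: tensor_relations_def single_mem_monoid_ring)

lemma tensor_mult:
  assumes "a \<in> carrier A" "a' \<in> carrier A" "b \<in> carrier B" "b' \<in> carrier B"
  shows "tensor (a \<otimes>\<^bsub>A\<^esub> a') (b \<otimes>\<^bsub>B\<^esub> b') = tensor a b \<otimes>\<^bsub>tensor_ring A B\<^esub> tensor a' b'"
  unfolding tensor_eq_coset using assms
  by (subst coset_mult[symmetric]) (simp_all add: single_mem_monoid_ring monoid_ring_mult_single)

lemma tensor_zero_right: "a \<in> carrier A \<Longrightarrow> tensor a \<zero>\<^bsub>B\<^esub> = \<zero>\<^bsub>tensor_ring A B\<^esub>"
  using tensor_add_right[of a "\<zero>\<^bsub>B\<^esub>" "\<zero>\<^bsub>B\<^esub>"] tensor_closed[of a "\<zero>\<^bsub>B\<^esub>"]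
  by (metis B.zero_closed B.l_zero Q.add.l_cancel_one')

lemma tensor_ideal_subset:
  assumes "ideal I MR" "tensor_relations A B \<subseteq> I"
  shows "tensor_ideal A B \<subseteq> I"
  unfolding tensor_ideal_def using assms by (rule MR.genideal_minimal)

text \<open>Elements are integer combinations of pairs, so sums and negatives of pure tensors
  exhaust the ring; zero is the pure tensor of two zeros.\<close>

lemma tensor_ring_induct [consumes 1, case_names tensor add uminus]:
  assumes z: "z \<in> carrier (tensor_ring A B)"
    and tensor: "\<And>a b. \<lbrakk>a \<in> carrier A; b \<in> carrier B\<rbrakk> \<Longrightarrow> P (tensor a b)"
    and add: "\<And>z z'. \<lbrakk>z \<in> carrier (tensor_ring A B); z' \<in> carrier (tensor_ring A B); P z; P z'\<rbrakk>
      \<Longrightarrow> P (z \<oplus>\<^bsub>tensor_ring A B\<^esub> z')"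
    and uminus: "\<And>z. \<lbrakk>z \<in> carrier (tensor_ring A B); P z\<rbrakk> \<Longrightarrow> P (\<ominus>\<^bsub>tensor_ring A B\<^esub> z)"
  shows "P z"
proof -
  have zero: "P \<zero>\<^bsub>tensor_ring A B\<^esub>"
    using tensor[of "\<zero>\<^bsub>A\<^esub>" "\<zero>\<^bsub>B\<^esub>"] by (simp add: tensor_zero_right)
  have single: "P (coset (Poly_Mapping.single s k))" if s: "s \<in> carrier (A \<times>\<times> B)" for s k
  proof (induction k rule: int_induct[of _ 0])
    case base
    then show ?case using zero by (simp add: coset_zero)
  next
    case (step1 k)
    have "Poly_Mapping.single s (k + 1) = Poly_Mapping.single s k + Poly_Mapping.single s 1"
      by (simp add: single_add)
    then have "coset (Poly_Mapping.single s (k + 1)) =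
        coset (Poly_Mapping.single s k) \<oplus>\<^bsub>tensor_ring A B\<^esub> tensor (fst s) (snd s)"
      using s by (simp only: coset_add single_mem_monoid_ring tensor_eq_coset prod.collapse)
    then show ?case
      using s step1 by (auto intro!: add tensor tensor_closed coset_closed single_mem_monoid_ring)
  next
    case (step2 k)
    have "Poly_Mapping.single s k = Poly_Mapping.single s (k - 1) + Poly_Mapping.single s 1"
      by (simp add: single_add[symmetric])
    then have "coset (Poly_Mapping.single s k) =
        coset (Poly_Mapping.single s (k - 1)) \<oplus>\<^bsub>tensor_ring A B\<^esub> tensor (fst s) (snd s)"
      using s by (simp only: coset_add single_mem_monoid_ring tensor_eq_coset prod.collapse)
    moreover have c: "coset (Poly_Mapping.single s (k - 1)) \<in> carrier (tensor_ring A B)"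
        "tensor (fst s) (snd s) \<in> carrier (tensor_ring A B)"
      using s by (auto intro!: tensor_closed coset_closed single_mem_monoid_ring)
    ultimately have "coset (Poly_Mapping.single s (k - 1)) =
        coset (Poly_Mapping.single s k) \<oplus>\<^bsub>tensor_ring A B\<^esub> (\<ominus>\<^bsub>tensor_ring A B\<^esub> tensor (fst s) (snd s))"
      by (simp add: Q.a_assoc Q.r_neg)
    then show ?case
      using s step2 c by (auto intro!: add tensor uminus tensor_closed coset_closed single_mem_monoid_ring)
  qed
  have "P (coset p)" if "p \<in> carrier MR" for p
    using that
  proof (induction p rule: monoid_ring_induct)
    case zero
    then show ?case using \<open>P \<zero>\<^bsub>tensor_ring A B\<^esub>\<close> by (simp add: coset_zero)
  next
    case (add s a p)
    then show ?case
      using assms(3) single by (simp add: coset_add single_mem_monoid_ring coset_closed)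
  qed
  then show ?thesis using coset_surj[OF z] by blast
qed

end


section \<open>Reduction modulo 2\<close>

text \<open>No colouring enters here. The aim is a presentation of the tensor product as all integer
  polynomials modulo \<open>J\<close>.\<close>

locale A_ring_mod_2 =
  fixes n :: nat and V :: "'v set" and L :: "'v set set"
  assumes complex: "simplicial_complex_on V L"
begin

abbreviation "W \<equiv> A_vertices n V"
abbreviation "K \<equiv> A_complex n L"
abbreviation "J \<equiv> mod2_face_ideal K"
abbreviation "P \<equiv> int_poly_ring W"
abbreviation "I \<equiv> stanley_reisner_ideal W K"
abbreviation "A \<equiv> A_ring n V L"
abbreviation "M \<equiv> A_mod_2 n V L"

sublocale even_ring_ideal J
  by (rule even_ring_ideal_mod2_face_ideal) (rule A_complex_subset[OF complex])

notation eqv (infix \<open>\<asymp>\<close> 50)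

sublocale P: cring P by (rule cring_int_poly_ring)

sublocale I: ideal I P by (rule ideal_stanley_reisner_ideal)

lemma I_subset: "I \<subseteq> J"
  by (rule stanley_reisner_ideal_subset) (rule A_complex_subset[OF complex])

sublocale A: cring A
  unfolding A_ring_def stanley_reisner_ring_def by (rule I.quotient_is_cring) (rule P.cring_axioms)

sublocale Z2: cring Z_mod_2
  by (rule comm_ring_1_class.cring_from_type_algebra)

sublocale tensor_product A Z_mod_2 ..

lemma M_eq: "M = tensor_ring A Z_mod_2"
  by (simp add: A_mod_2_def)

definition "cls p = I +>\<^bsub>P\<^esub> p"

lemma cls_ring_hom: "cls \<in> ring_hom P A"
  using I.rcos_ring_hom by (simp add: A_ring_def stanley_reisner_ring_def cls_def[abs_def])

lemma cls_closed: "p \<in> carrier P \<Longrightarrow> cls p \<in> carrier A"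
  by (rule ring_hom_closed[OF cls_ring_hom])

lemma cls_add: "\<lbrakk>p \<in> carrier P; q \<in> carrier P\<rbrakk> \<Longrightarrow> cls (p + q) = cls p \<oplus>\<^bsub>A\<^esub> cls q"
  using ring_hom_add[OF cls_ring_hom, of p q] by (simp add: add_int_poly_ring)

lemma cls_mult: "\<lbrakk>p \<in> carrier P; q \<in> carrier P\<rbrakk> \<Longrightarrow> cls (p * q) = cls p \<otimes>\<^bsub>A\<^esub> cls q"
  using ring_hom_mult[OF cls_ring_hom, of p q] by (simp add: mult_int_poly_ring)

lemma cls_eq_zero: "p \<in> I \<Longrightarrow> cls p = \<zero>\<^bsub>A\<^esub>"
  using P.a_coset_join2[OF _ I.a_subgroup, of p] I.a_subset
  by (auto simp: cls_def A_ring_def stanley_reisner_ring_def FactRing_def)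

lemma cls_surj: "a \<in> carrier A \<Longrightarrow> \<exists>p\<in>carrier P. a = cls p"
  by (auto simp: A_ring_def stanley_reisner_ring_def FactRing_def A_RCOSETS_def' cls_def)

text \<open>
  Variables outside \<open>W\<close> lie in \<open>J\<close>, so dropping them presents the ring as a quotient of all polynomials
  and no carrier has to be tracked.
\<close>

definition restr :: "(('v vertex \<Rightarrow>\<^sub>0 nat) \<Rightarrow>\<^sub>0 int) \<Rightarrow> ('v vertex \<Rightarrow>\<^sub>0 nat) \<Rightarrow>\<^sub>0 int" where
  "restr = Poly_Mapping.mapp (\<lambda>m c. if Poly_Mapping.keys m \<subseteq> W then c else 0)"

lemma lookup_restr:
  "Poly_Mapping.lookup (restr p) m = (if Poly_Mapping.keys m \<subseteq> W then Poly_Mapping.lookup p m else 0)"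
  by (simp add: restr_def lookup_mapp when_def in_keys_iff)

lemma keys_restr: "Poly_Mapping.keys (restr p) = {m \<in> Poly_Mapping.keys p. Poly_Mapping.keys m \<subseteq> W}"
  by (rule Set.set_eqI) (simp add: in_keys_iff[of _ "restr p"] in_keys_iff[of _ p] lookup_restr)

lemma restr_closed: "restr p \<in> carrier P"
  by (simp add: carrier_int_poly_ring keys_restr)

lemma restr_add: "restr (p + q) = restr p + restr q"
  by (rule poly_mapping_eqI) (simp add: lookup_restr lookup_add)

lemma restr_id: "p \<in> carrier P \<Longrightarrow> restr p = p"
  by (rule poly_mapping_eqI) (auto simp: lookup_restr carrier_int_poly_ring in_keys_iff)

lemma restr_eqv: "restr p \<asymp> p"
proof -
  have "Poly_Mapping.lookup (restr p - p) m = 0" if "Poly_Mapping.keys m \<in> K" for m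
    using A_complex_subset_vertices[OF complex that] by (simp add: lookup_minus lookup_restr)
  then show ?thesis by (simp add: eqv_def) (simp add: mod2_face_ideal_def)
qed

lemma homogeneous_restr: "homogeneous A_degree d p \<Longrightarrow> homogeneous A_degree d (restr p)"
  by (simp add: homogeneous_def keys_restr)

text \<open>The presentation map. It turns out to be additive, multiplicative and surjective with
  kernel exactly \<open>J\<close>, so every element of the tensor product has the form a \<otimes>
  1.\<close>

definition "\<pi> p = tensor (cls (restr p)) 1"

lemma Z2_simps: "carrier Z_mod_2 = UNIV" "\<zero>\<^bsub>Z_mod_2\<^esub> = 0" "\<one>\<^bsub>Z_mod_2\<^esub> = 1"
  "b \<oplus>\<^bsub>Z_mod_2\<^esub> b' = b + b'" "b \<otimes>\<^bsub>Z_mod_2\<^esub> b' = b * b'"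
  by (simp_all add: ring_of_type_algebra_def)

lemma \<pi>_closed: "\<pi> p \<in> carrier M"
  by (simp add: \<pi>_def M_eq tensor_closed cls_closed restr_closed Z2_simps)

lemma \<pi>_add: "\<pi> (p + q) = \<pi> p \<oplus>\<^bsub>M\<^esub> \<pi> q"
  by (simp add: \<pi>_def M_eq restr_add cls_add restr_closed tensor_add_left cls_closed Z2_simps)

text \<open>The factor 2 crosses the tensor sign and vanishes in Z/2.\<close>

lemma \<pi>_double: "\<pi> (2 * p) = \<zero>\<^bsub>M\<^esub>"
proof -
  have c: "cls (restr p) \<in> carrier A" by (rule cls_closed[OF restr_closed])
  have "\<pi> (2 * p) = \<pi> p \<oplus>\<^bsub>M\<^esub> \<pi> p"
    by (simp only: mult_2 \<pi>_add)
  also have "\<dots> = tensor (cls (restr p)) (1 \<oplus>\<^bsub>Z_mod_2\<^esub> 1)"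
    unfolding \<pi>_def M_eq by (rule tensor_add_right[symmetric]) (simp_all only: c Z2_simps UNIV_I)
  also have "(1 :: bit) \<oplus>\<^bsub>Z_mod_2\<^esub> 1 = \<zero>\<^bsub>Z_mod_2\<^esub>"
    by (simp add: Z2_simps)
  finally show ?thesis
    by (simp only: tensor_zero_right[OF c] M_eq)
qed

lemma \<pi>_zero: "\<pi> 0 = \<zero>\<^bsub>M\<^esub>"
  using \<pi>_double[of 0] by (simp only: mult_zero_right)

lemma \<pi>_eq_zero_if_mem_I: "p \<in> I \<Longrightarrow> \<pi> p = \<zero>\<^bsub>M\<^esub>"
proof -
  assume p: "p \<in> I"
  then have "restr p = p" using I.a_subset restr_id by blast
  moreover have "cls p = cls 0"
    using p cls_eq_zero additive_subgroup.zero_closed[OF I.additive_subgroup_axioms]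
    by (metis zero_int_poly_ring)
  moreover have "restr 0 = 0" by (simp add: restr_id int_poly_ring_consts)
  ultimately have "\<pi> p = \<pi> 0" by (simp add: \<pi>_def)
  then show ?thesis by (simp add: \<pi>_zero)
qed

text \<open>The restriction of \<open>p\<close> is 2 r + i, where \<open>r\<close> halves the
  coefficients on faces, even by assumption, and \<open>i\<close> is the part on non-faces, which
  lies in the Stanley-Reisner ideal.\<close>

lemma \<pi>_eq_zero_if_mem: "p \<in> J \<Longrightarrow> \<pi> p = \<zero>\<^bsub>M\<^esub>"
proof -
  assume p: "p \<in> J"
  define r where "r = Poly_Mapping.mapp (\<lambda>m c. if Poly_Mapping.keys m \<in> K then c div 2 else 0) (restr p)"
  define i where "i = Poly_Mapping.mapp (\<lambda>m c. if Poly_Mapping.keys m \<in> K then 0 else c) (restr p)"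
  have lr: "Poly_Mapping.lookup r m = (if Poly_Mapping.keys m \<in> K then Poly_Mapping.lookup (restr p) m div 2 else 0)" for m
    by (simp add: r_def lookup_mapp when_def in_keys_iff)
  have li: "Poly_Mapping.lookup i m = (if Poly_Mapping.keys m \<in> K then 0 else Poly_Mapping.lookup (restr p) m)" for m
    by (simp add: i_def lookup_mapp when_def in_keys_iff)
  have even: "even (Poly_Mapping.lookup (restr p) m)" if "Poly_Mapping.keys m \<in> K" for m
    using p that by (auto simp: mod2_face_ideal_def lookup_restr)
  have "Poly_Mapping.lookup (restr p) m = Poly_Mapping.lookup (r + r + i) m" for m
    unfolding lookup_add lr li using even[of m] by (auto elim!: evenE)
  then have eq: "restr p = 2 * r + i"
    unfolding mult_2 by (rule poly_mapping_eqI)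
  have keys_i: "Poly_Mapping.keys i = {m \<in> Poly_Mapping.keys (restr p). Poly_Mapping.keys m \<notin> K}"
    by (rule Set.set_eqI) (simp add: in_keys_iff[of _ i] in_keys_iff[of _ "restr p"] li)
  have "i \<in> I"
    by (rule mem_stanley_reisner_ideal)
       (use keys_i restr_closed[of p] in \<open>auto simp: carrier_int_poly_ring\<close>)
  then have "\<pi> (restr p) = \<zero>\<^bsub>M\<^esub>"
    unfolding eq \<pi>_add by (simp add: \<pi>_double \<pi>_eq_zero_if_mem_I M_eq)
  moreover have "\<pi> (restr p) = \<pi> p"
    by (simp add: \<pi>_def restr_id restr_closed)
  ultimately show ?thesis by simp
qed

lemma \<pi>_uminus: "\<pi> (- p) = \<ominus>\<^bsub>M\<^esub> \<pi> p"
proof -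
  have "\<pi> (- p) \<oplus>\<^bsub>M\<^esub> \<pi> p = \<zero>\<^bsub>M\<^esub>"
    using \<pi>_add[of "- p" p] by (simp add: \<pi>_zero)
  then show ?thesis
    using Q.minus_equality[of "\<pi> (- p)" "\<pi> p"] \<pi>_closed by (simp add: M_eq)
qed

lemma \<pi>_cong: "p \<asymp> q \<Longrightarrow> \<pi> p = \<pi> q"
proof -
  assume "p \<asymp> q"
  then have "\<pi> (p - q) = \<zero>\<^bsub>M\<^esub>" by (intro \<pi>_eq_zero_if_mem) (simp add: eqv_def)
  then show ?thesis
    using \<pi>_add[of "p - q" q] \<pi>_closed[of q] by (simp add: M_eq)
qed

lemma \<pi>_mult: "\<pi> (p * q) = \<pi> p \<otimes>\<^bsub>M\<^esub> \<pi> q"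
proof -
  have "\<pi> (p * q) = \<pi> (restr p * restr q)"
    by (intro \<pi>_cong eqv_mult eqv_sym[OF restr_eqv])
  also have "\<dots> = tensor (cls (restr p * restr q)) (1 * 1)"
    by (simp add: \<pi>_def restr_id restr_closed int_poly_ring_mult_closed)
  also have "\<dots> = \<pi> p \<otimes>\<^bsub>M\<^esub> \<pi> q"
    using tensor_mult[of "cls (restr p)" "cls (restr q)" 1 1]
    by (simp add: \<pi>_def cls_mult restr_closed cls_closed Z2_simps M_eq)
  finally show ?thesis .
qed

lemma \<pi>_tensor: "a \<in> carrier A \<Longrightarrow> \<exists>p\<in>carrier P. a = cls p \<and> tensor a b = \<pi> (if b = 1 then p else 0)"
proof -
  assume a: "a \<in> carrier A"
  then obtain p where p: "p \<in> carrier P" "a = cls p" using cls_surj by blast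
  then have "tensor a b = \<pi> (if b = 1 then p else 0)"
    using tensor_zero_right[OF a] by (cases b) (simp_all add: \<pi>_def[of p] restr_id \<pi>_zero Z2_simps M_eq)
  with p show ?thesis by blast
qed

lemma \<pi>_surj: "z \<in> carrier M \<Longrightarrow> \<exists>p. z = \<pi> p"
  unfolding M_eq
proof (induction z rule: tensor_ring_induct)
  case (tensor a b)
  then show ?case using \<pi>_tensor by blast
next
  case (add z z')
  then show ?case using \<pi>_add by (metis M_eq)
next
  case (uminus z)
  then show ?case using \<pi>_uminus by (metis M_eq)
qed

text \<open>Lets the grading be handled on polynomials. The subgroup generated by the homogeneous
  pure tensors stays inside the image, because homogeneous polynomials of one degree are closed
  under sums and negation.\<close>

lemma component_eq: "A_mod_2_component n V L d = \<pi> ` {p. homogeneous A_degree d p}"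
proof (intro equalityI subsetI)
  fix z assume "z \<in> A_mod_2_component n V L d"
  then have mem: "z \<in> generate (add_monoid M) {tensor a b | a b. a \<in> A_component n V L d \<and> b \<in> carrier Z_mod_2}"
    by (simp add: A_mod_2_component_def)
  have gen: "\<exists>p. homogeneous A_degree d p \<and> z = \<pi> p"
    if z: "z \<in> {tensor a b | a b. a \<in> A_component n V L d \<and> b \<in> carrier Z_mod_2}" for z
  proof -
    obtain p b where p: "p \<in> carrier P" "homogeneous A_degree d p" "z = tensor (cls p) b"
      using z by (auto simp: A_component_def stanley_reisner_component_def homogeneous_def cls_def)
    show ?thesis
    proof (cases b)
      case zero
      then have "z = \<pi> 0" using p tensor_zero_right[of "cls p"] by (simp add: cls_closed \<pi>_zero Z2_simps M_eq)
      then show ?thesis by (intro exI[of _ 0]) simp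
    next
      case one
      then have "z = \<pi> p" using p by (simp add: \<pi>_def restr_id)
      then show ?thesis using p by blast
    qed
  qed
  from mem have "\<exists>p. homogeneous A_degree d p \<and> z = \<pi> p"
  proof (induction z rule: generate.induct)
    case one
    then show ?case by (intro exI[of _ 0]) (simp add: \<pi>_zero)
  next
    case (incl h)
    then show ?case by (rule gen)
  next
    case (inv h)
    then obtain p where "homogeneous A_degree d p" "h = \<pi> p" using gen by blast
    then show ?case
      by (intro exI[of _ "- p"]) (simp add: homogeneous_uminus \<pi>_uminus a_inv_def)
  next
    case (eng h h')
    then obtain p p' where "homogeneous A_degree d p" "h = \<pi> p" "homogeneous A_degree d p'" "h' = \<pi> p'" by blast
    then show ?case
      by (intro exI[of _ "p + p'"]) (simp add: homogeneous_add \<pi>_add)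
  qed
  then show "z \<in> \<pi> ` {p. homogeneous A_degree d p}" by blast
next
  fix z assume "z \<in> \<pi> ` {p. homogeneous A_degree d p}"
  then obtain p where p: "homogeneous A_degree d p" "z = \<pi> p" by blast
  have "cls (restr p) \<in> A_component n V L d"
    using homogeneous_restr[OF p(1)] restr_closed[of p]
    by (auto simp: A_component_def stanley_reisner_component_def homogeneous_def cls_def)
  then show "z \<in> A_mod_2_component n V L d"
    unfolding A_mod_2_component_def p(2) \<pi>_def by (intro generate.incl) (auto simp: Z2_simps)
qed

text \<open>The kernel is bounded by mapping the free group on pairs to polynomials along chosen representatives.\<close>

definition "rep a = (SOME p. p \<in> (a :: (('v vertex \<Rightarrow>\<^sub>0 nat) \<Rightarrow>\<^sub>0 int) set))"

lemma rep_cls: "p \<in> carrier P \<Longrightarrow> rep (cls p) \<asymp> p"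
proof -
  assume p: "p \<in> carrier P"
  then have "p \<in> cls p" unfolding cls_def by (rule I.a_rcos_self)
  then have "rep (cls p) \<in> cls p" unfolding rep_def by (rule someI)
  then obtain i where "i \<in> I" "rep (cls p) = i + p"
    by (auto simp: cls_def a_r_coset_def' add_int_poly_ring)
  then show ?thesis using I_subset by (auto simp: eqv_def)
qed

lemma rep_add:
  assumes "a \<in> carrier A" "a' \<in> carrier A"
  shows "rep (a \<oplus>\<^bsub>A\<^esub> a') \<asymp> rep a + rep a'"
proof -
  obtain p p' where p: "p \<in> carrier P" "a = cls p" "p' \<in> carrier P" "a' = cls p'"
    using assms cls_surj by meson
  have "rep (a \<oplus>\<^bsub>A\<^esub> a') \<asymp> p + p'"
    using p rep_cls[of "p + p'"] by (simp add: cls_add int_poly_ring_add_closed)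
  also have "\<dots> \<asymp> rep a + rep a'"
    using p by (auto intro!: eqv_add eqv_sym[OF rep_cls])
  finally show ?thesis .
qed

lemma rep_mult:
  assumes "a \<in> carrier A" "a' \<in> carrier A"
  shows "rep (a \<otimes>\<^bsub>A\<^esub> a') \<asymp> rep a * rep a'"
proof -
  obtain p p' where p: "p \<in> carrier P" "a = cls p" "p' \<in> carrier P" "a' = cls p'"
    using assms cls_surj by meson
  have "rep (a \<otimes>\<^bsub>A\<^esub> a') \<asymp> p * p'"
    using p rep_cls[of "p * p'"] by (simp add: cls_mult int_poly_ring_mult_closed)
  also have "\<dots> \<asymp> rep a * rep a'"
    using p by (auto intro!: eqv_mult eqv_sym[OF rep_cls])
  finally show ?thesis .
qed

definition lift :: "((('v vertex \<Rightarrow>\<^sub>0 nat) \<Rightarrow>\<^sub>0 int) set \<times> bit \<Rightarrow>\<^sub>0 int) \<Rightarrow> ('v vertex \<Rightarrow>\<^sub>0 nat) \<Rightarrow>\<^sub>0 int" where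
  "lift q = (\<Sum>s\<in>Poly_Mapping.keys q. of_int (Poly_Mapping.lookup q s) * (of_bit (snd s) * rep (fst s)))"

lemma lift_add: "lift (p + q) = lift p + lift q"
  unfolding lift_def by (rule setsum_keys_plus_distrib) (auto simp: algebra_simps)

lemma lift_single: "lift (Poly_Mapping.single s k) = of_int k * (of_bit (snd s) * rep (fst s))"
  by (simp add: lift_def)

lemma lift_zero [simp]: "lift 0 = 0"
  by (simp add: lift_def)

lemma lift_uminus: "lift (- p) = - lift p"
  using lift_add[of "- p" p] by (simp add: eq_neg_iff_add_eq_0)

text \<open>Chosen representatives are known to be multiplicative only up to \<open>J\<close>, and
  so is \<open>lift\<close>; that is enough to make the preimage of \<open>J\<close> an
  ideal.\<close>

lemma lift_mult:
  assumes "p \<in> carrier MR" "q \<in> carrier MR"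
  shows "lift (p \<otimes>\<^bsub>MR\<^esub> q) \<asymp> lift p * lift q"
  using assms(1)
proof (induction p rule: monoid_ring_induct)
  case (add s k p)
  from assms(2) have "lift (Poly_Mapping.single s k \<otimes>\<^bsub>MR\<^esub> q) \<asymp> lift (Poly_Mapping.single s k) * lift q"
  proof (induction q rule: monoid_ring_induct)
    case (add t l q)
    have "lift (Poly_Mapping.single (s \<otimes>\<^bsub>A \<times>\<times> Z_mod_2\<^esub> t) (k * l)) =
        of_int (k * l) * (of_bit (snd s) * of_bit (snd t)) * rep (fst s \<otimes>\<^bsub>A\<^esub> fst t)"
      by (simp add: lift_single mult_DirProd' Z2_simps mult_ac)
    also have "\<dots> \<asymp> of_int (k * l) * (of_bit (snd s) * of_bit (snd t)) * (rep (fst s) * rep (fst t))"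
      using add \<open>s \<in> carrier (A \<times>\<times> Z_mod_2)\<close> by (intro eqv_mult eqv_refl rep_mult) auto
    also have "\<dots> = lift (Poly_Mapping.single s k) * lift (Poly_Mapping.single t l)"
      by (simp add: lift_single)
    finally show ?case
      using add.IH by (simp add: monoid_ring_mult_add_right monoid_ring_mult_single lift_add distrib_left eqv_add)
  qed simp
  with add.IH show ?case by (simp add: monoid_ring_mult_add_left lift_add distrib_right eqv_add)
qed simp

text \<open>The preimage of \<open>J\<close> is an ideal, so only the bilinearity relations need
  checking. Those in the first argument hold by \<open>rep_add\<close>, those in the second because
  2 is in \<open>J\<close>.\<close>

lemma lift_tensor_ideal: "q \<in> tensor_ideal A Z_mod_2 \<Longrightarrow> lift q \<in> J"
proof -
  let ?B = "{q \<in> carrier MR. lift q \<in> J}"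
  have "ideal ?B MR"
  proof (rule ideal_monoid_ringI)
    show "monoid (A \<times>\<times> Z_mod_2)"
      using comm_monoid_DirProd by (rule comm_monoid.axioms(1))
    show "q \<otimes>\<^bsub>MR\<^esub> p \<in> ?B" if "p \<in> ?B" "q \<in> carrier MR" for p q
      using that lift_mult[of q p] eqv_mem_iff mult_mem by auto
    show "p \<otimes>\<^bsub>MR\<^esub> q \<in> ?B" if "p \<in> ?B" "q \<in> carrier MR" for p q
      using that lift_mult[of p q] eqv_mem_iff mult_mem_right by auto
    show "0 \<in> ?B" using MR.zero_closed by (simp add: zero_monoid_ring zero_mem)
  qed (auto simp: monoid_ring_add_closed monoid_ring_uminus_closed lift_add lift_uminus add_mem uminus_mem)
  moreover have "tensor_relations A Z_mod_2 \<subseteq> ?B"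
  proof
    fix q assume q: "q \<in> tensor_relations A Z_mod_2"
    have diff: "lift (x - y - z) = lift x - lift y - lift z" for x y z
      using lift_add[of "x - y - z" "y + z"] by (simp add: lift_add algebra_simps)
    from q consider a a' b where "a \<in> carrier A" "a' \<in> carrier A"
        "q = Poly_Mapping.single (a \<oplus>\<^bsub>A\<^esub> a', b) 1 - Poly_Mapping.single (a, b) 1 - Poly_Mapping.single (a', b) 1"
      | a b b' where "q = Poly_Mapping.single (a, b + b') 1 - Poly_Mapping.single (a, b) 1 - Poly_Mapping.single (a, b') 1"
      by (auto simp: tensor_relations_def Z2_simps)
    then have "lift q \<in> J"
    proof cases
      case (1 a a' b)
      have "lift q = of_bit b * (rep (a \<oplus>\<^bsub>A\<^esub> a') - (rep a + rep a'))"
        unfolding 1(3) diff by (simp add: lift_single algebra_simps)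
      moreover have "rep (a \<oplus>\<^bsub>A\<^esub> a') - (rep a + rep a') \<in> J"
        using rep_add[OF 1(1,2)] by (simp add: eqv_def)
      ultimately show ?thesis by (simp add: mult_mem)
    next
      case (2 a b b')
      have "lift q = (of_bit (b + b') - of_bit b - of_bit b') * rep a"
        unfolding 2 diff by (simp add: lift_single algebra_simps)
      \<comment> \<open>Nonzero only for b = b' = 1, where the value is -2.\<close>
      moreover have "of_bit (b + b') - of_bit b - of_bit b' \<in> J"
        using uminus_mem[OF two_mem] by (cases b; cases b') (simp_all add: zero_mem)
      ultimately show ?thesis by (simp add: mult_mem_right)
    qed
    then show "q \<in> ?B" using q tensor_relations_subset by auto
  qed
  ultimately show "q \<in> tensor_ideal A Z_mod_2 \<Longrightarrow> lift q \<in> J"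
    using tensor_ideal_subset by blast
qed

lemma \<pi>_eq_zero_iff: "\<pi> p = \<zero>\<^bsub>M\<^esub> \<longleftrightarrow> p \<in> J"
proof
  assume "\<pi> p = \<zero>\<^bsub>M\<^esub>"
  moreover have "Poly_Mapping.single (cls (restr p), 1) 1 \<in> carrier MR"
    by (simp add: single_mem_monoid_ring cls_closed restr_closed Z2_simps)
  ultimately have "Poly_Mapping.single (cls (restr p), 1) 1 \<in> tensor_ideal A Z_mod_2"
    using coset_eq_zero_iff by (simp add: \<pi>_def M_eq tensor_eq_coset)
  then have "rep (cls (restr p)) \<in> J"
    using lift_tensor_ideal by (fastforce simp: lift_single)
  moreover have "rep (cls (restr p)) \<asymp> p"
    using eqv_trans[OF rep_cls[OF restr_closed] restr_eqv] .
  ultimately show "p \<in> J" using eqv_mem_iff by blast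
qed (rule \<pi>_eq_zero_if_mem)

lemma \<pi>_eq_iff: "\<pi> p = \<pi> q \<longleftrightarrow> p \<asymp> q"
proof
  assume eq: "\<pi> p = \<pi> q"
  have "\<pi> (p - q) = \<pi> p \<oplus>\<^bsub>M\<^esub> \<ominus>\<^bsub>M\<^esub> \<pi> q"
    using \<pi>_add[of p "- q"] by (simp add: \<pi>_uminus)
  also have "\<dots> = \<zero>\<^bsub>M\<^esub>"
    unfolding eq using \<pi>_closed[of q] Q.r_neg by (simp add: M_eq)
  finally show "p \<asymp> q" by (simp add: \<pi>_eq_zero_iff eqv_def)
qed (rule \<pi>_cong)

end


section \<open>The action of the Steenrod algebra\<close>

lemma monoid_sq_words: "monoid sq_words"
  by (rule monoidI) (simp_all add: sq_words_def)

lemma mem_free_sq_algebra [simp]: "f \<in> carrier free_sq_algebra"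
  by (simp add: carrier_monoid_ring sq_words_def)

lemma ring_free_sq_algebra: "ring free_sq_algebra"
  by (rule ring_monoid_ring) (rule monoid_sq_words)

lemma ideal_steenrod_ideal: "ideal steenrod_ideal free_sq_algebra"
  unfolding steenrod_ideal_def
  by (rule ring.genideal_ideal[OF ring_free_sq_algebra]) auto

lemma steenrod_coset_ring_hom: "(+>\<^bsub>free_sq_algebra\<^esub>) steenrod_ideal \<in> ring_hom free_sq_algebra steenrod_algebra"
  unfolding steenrod_algebra_def by (rule ideal.rcos_ring_hom) (rule ideal_steenrod_ideal)

lemma ring_steenrod_algebra: "ring steenrod_algebra"
  unfolding steenrod_algebra_def by (rule ideal.quotient_is_ring) (rule ideal_steenrod_ideal)

lemma steenrod_coset_surj:
  "a \<in> carrier steenrod_algebra \<Longrightarrow> \<exists>f. a = steenrod_ideal +>\<^bsub>free_sq_algebra\<^esub> f"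
  by (auto simp: steenrod_algebra_def FactRing_def A_RCOSETS_def')

context span_data
begin

sublocale R: A_ring_mod_2 n V L
  by unfold_locales (rule complex)

section \<open>Words in the squares acting on polynomials\<close>

fun sqs :: "nat list \<Rightarrow> (('v vertex \<Rightarrow>\<^sub>0 nat) \<Rightarrow>\<^sub>0 int) \<Rightarrow> ('v vertex \<Rightarrow>\<^sub>0 nat) \<Rightarrow>\<^sub>0 int" where
  "sqs [] p = p"
| "sqs (k # w) p = sq k (sqs w p)"

lemma sqs_append: "sqs (w @ w') p = sqs w (sqs w' p)"
  by (induction w) auto

lemma sqs_zero [simp]: "sqs w 0 = 0"
  by (induction w) auto

lemma sqs_add: "sqs w (p + q) = sqs w p + sqs w q"
  by (induction w) (auto simp: sq_add)

lemma sqs_mem: "p \<in> J \<Longrightarrow> sqs w p \<in> J"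
  by (induction w) (auto simp: sq_mem)

lemma homogeneous_sqs: "homogeneous A_degree d p \<Longrightarrow> homogeneous A_degree (sum_list w + d) (sqs w p)"
  by (induction w) (auto simp: add.assoc intro: homogeneous_sq)

text \<open>The coefficients in Z/2 are lifted to 0 and 1, so the action is additive in
  \<open>p\<close> exactly, but in \<open>f\<close> only modulo \<open>J\<close>.\<close>

definition word_act :: "(nat list \<Rightarrow>\<^sub>0 bit) \<Rightarrow> (('v vertex \<Rightarrow>\<^sub>0 nat) \<Rightarrow>\<^sub>0 int) \<Rightarrow> ('v vertex \<Rightarrow>\<^sub>0 nat) \<Rightarrow>\<^sub>0 int" where
  "word_act f p = (\<Sum>w\<in>Poly_Mapping.keys f. of_bit (Poly_Mapping.lookup f w) * sqs w p)"

lemma word_act_superset: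
  "\<lbrakk>finite S; Poly_Mapping.keys f \<subseteq> S\<rbrakk> \<Longrightarrow> word_act f p = (\<Sum>w\<in>S. of_bit (Poly_Mapping.lookup f w) * sqs w p)"
  unfolding word_act_def by (rule sum.mono_neutral_left) (auto simp: in_keys_iff)

lemma word_act_single: "word_act (Poly_Mapping.single w b) p = of_bit b * sqs w p"
  by (subst word_act_superset[of "{w}"]) auto

lemma of_bit_add_eqv: "of_bit (a + b) \<asymp> of_bit a + of_bit b"
  using eqv_sym[OF eqv_plus_double[of 0 1]] by (cases a; cases b) simp_all

lemma word_act_add_left: "word_act (f + g) p \<asymp> word_act f p + word_act g p"
proof -
  let ?S = "Poly_Mapping.keys f \<union> Poly_Mapping.keys g"
  have "word_act (f + g) p = (\<Sum>w\<in>?S. of_bit (Poly_Mapping.lookup f w + Poly_Mapping.lookup g w) * sqs w p)"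
    using Poly_Mapping.keys_add[of f g] by (subst word_act_superset[of ?S]) (simp_all add: lookup_add)
  also have "\<dots> \<asymp> (\<Sum>w\<in>?S. (of_bit (Poly_Mapping.lookup f w) + of_bit (Poly_Mapping.lookup g w)) * sqs w p)"
    by (intro eqv_sum eqv_mult of_bit_add_eqv eqv_refl)
  also have "\<dots> = word_act f p + word_act g p"
    by (simp only: distrib_right sum.distrib word_act_superset[of ?S] finite_UnI finite_keys Un_upper1 Un_upper2)
  finally show ?thesis .
qed

lemma word_act_diff_left: "word_act (f - g) p \<asymp> word_act f p - word_act g p"
  using eqv_diff[OF eqv_sym[OF word_act_add_left[of "f - g" g p]] eqv_refl[of "word_act g p"]] by simp

lemma word_act_zero [simp]: "word_act 0 p = 0"
  by (simp add: word_act_def)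

lemma word_act_uminus_left: "word_act (- f) p \<asymp> - word_act f p"
  using word_act_diff_left[of 0 f p] by simp

lemma word_act_sum_left: "word_act (sum f S) p \<asymp> (\<Sum>i\<in>S. word_act (f i) p)"
proof (induction S rule: infinite_finite_induct)
  case (insert i S)
  have "word_act (f i + sum f S) p \<asymp> word_act (f i) p + word_act (sum f S) p"
    by (rule word_act_add_left)
  also have "\<dots> \<asymp> word_act (f i) p + (\<Sum>i\<in>S. word_act (f i) p)"
    by (intro eqv_add eqv_refl insert.IH)
  finally show ?case using insert.hyps by simp
qed simp_all

lemma word_act_add_right: "word_act f (p + q) = word_act f p + word_act f q"
  by (simp add: word_act_def sqs_add distrib_left sum.distrib)

lemma word_act_zero_right [simp]: "word_act f 0 = 0"
  by (simp add: word_act_def)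

lemma word_act_diff_right: "word_act f (p - q) = word_act f p - word_act f q"
  using word_act_add_right[of f "p - q" q] by simp

lemma word_act_mem: "p \<in> J \<Longrightarrow> word_act f p \<in> J"
  unfolding word_act_def by (intro sum_mem mult_mem sqs_mem)

lemma word_act_eqv: "p \<asymp> q \<Longrightarrow> word_act f p \<asymp> word_act f q"
  using word_act_mem[of "p - q" f] by (simp add: eqv_def word_act_diff_right)

text \<open>By additivity it suffices to compare single words, where multiplication is
  concatenation. Congruences may be used inside the outer action since the squares preserve
  \<open>J\<close>.\<close>

lemma word_act_mult: "word_act (f \<otimes>\<^bsub>free_sq_algebra\<^esub> g) p \<asymp> word_act f (word_act g p)"
proof (induction f rule: monoid_ring_induct[where G = sq_words, OF mem_free_sq_algebra])
  case (2 w a f)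
  have "word_act (Poly_Mapping.single w a \<otimes>\<^bsub>free_sq_algebra\<^esub> g) p \<asymp> word_act (Poly_Mapping.single w a) (word_act g p)"
  proof (induction g rule: monoid_ring_induct[where G = sq_words, OF mem_free_sq_algebra])
    case (2 w' b g)
    have "word_act (Poly_Mapping.single w a \<otimes>\<^bsub>free_sq_algebra\<^esub> Poly_Mapping.single w' b) p =
        word_act (Poly_Mapping.single w a) (word_act (Poly_Mapping.single w' b) p)"
      by (cases b) (simp_all add: monoid_ring_mult_single word_act_single sqs_append sq_words_def)
    then have "word_act (Poly_Mapping.single w a \<otimes>\<^bsub>free_sq_algebra\<^esub> (Poly_Mapping.single w' b + g)) p \<asymp>
        word_act (Poly_Mapping.single w a) (word_act (Poly_Mapping.single w' b) p)
          + word_act (Poly_Mapping.single w a) (word_act g p)"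
      unfolding monoid_ring_mult_add_right
      using eqv_trans[OF word_act_add_left eqv_add[OF eqv_refl 2(3)]] by metis
    also have "\<dots> = word_act (Poly_Mapping.single w a) (word_act (Poly_Mapping.single w' b) p + word_act g p)"
      by (simp only: word_act_add_right)
    also have "\<dots> \<asymp> word_act (Poly_Mapping.single w a) (word_act (Poly_Mapping.single w' b + g) p)"
      by (intro word_act_eqv eqv_sym[OF word_act_add_left])
    finally show ?case .
  qed simp
  then have "word_act ((Poly_Mapping.single w a + f) \<otimes>\<^bsub>free_sq_algebra\<^esub> g) p \<asymp>
      word_act (Poly_Mapping.single w a) (word_act g p) + word_act f (word_act g p)"
    unfolding monoid_ring_mult_add_left
    by (intro eqv_trans[OF word_act_add_left] eqv_add 2(3))
  also have "\<dots> \<asymp> word_act (Poly_Mapping.single w a + f) (word_act g p)"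
    by (rule eqv_sym[OF word_act_add_left])
  finally show ?case .
qed simp

lemma of_bit_of_nat_eqv: "of_bit (of_nat k) \<asymp> of_nat k"
proof -
  have "(of_nat k :: bit) = of_bool (odd k)" by (induction k) auto
  then have "of_bit (of_nat k :: bit) = of_int (of_bool (odd k))" by simp
  also have "\<dots> \<asymp> of_int (int k)" by (rule of_int_eqv) simp
  finally show ?thesis by simp
qed

text \<open>The elements that send every polynomial into \<open>J\<close> form a two-sided ideal:
  closed under left multiples because the action preserves \<open>J\<close>, under right multiples
  because all arguments are quantified. So the unit relation and the Adem relations are
  enough.\<close>

lemma steenrod_ideal_word_act_mem: "f \<in> steenrod_ideal \<Longrightarrow> word_act f p \<in> J"
proof -
  let ?Ann = "{f. \<forall>p. word_act f p \<in> J}"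
  have "ideal ?Ann free_sq_algebra"
  proof (rule ideal_monoid_ringI[OF monoid_sq_words])
    fix f g assume f: "f \<in> ?Ann"
    have "word_act (g \<otimes>\<^bsub>free_sq_algebra\<^esub> f) p \<in> J" for p
      using eqv_mem_iff[OF word_act_mult[of g f p]] word_act_mem f by simp
    then show "g \<otimes>\<^bsub>free_sq_algebra\<^esub> f \<in> ?Ann" by simp
    have "word_act (f \<otimes>\<^bsub>free_sq_algebra\<^esub> g) p \<in> J" for p
      using eqv_mem_iff[OF word_act_mult[of f g p]] f by simp
    then show "f \<otimes>\<^bsub>free_sq_algebra\<^esub> g \<in> ?Ann" by simp
    have "word_act (- f) p \<in> J" for p
      using eqv_mem_iff[OF word_act_uminus_left[of f p]] uminus_mem f by simp
    then show "- f \<in> ?Ann" by simp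
  next
    fix f g assume "f \<in> ?Ann" "g \<in> ?Ann"
    then have "word_act (f + g) p \<in> J" for p
      using eqv_mem_iff[OF word_act_add_left[of f g p]] add_mem by simp
    then show "f + g \<in> ?Ann" by simp
  qed (auto simp: zero_mem)
  moreover have "word_act (Poly_Mapping.single [0] 1 - Poly_Mapping.single [] 1) p \<in> J" for p
    using eqv_mem_iff[OF word_act_diff_left[of "Poly_Mapping.single [0] 1" "Poly_Mapping.single [] 1" p]]
    by (simp add: word_act_single sq_0 zero_mem)
  moreover have "word_act (adem_relation a b) p \<in> J" if "a < 2 * b" for a b p
  proof -
    let ?c = "\<lambda>c. (b - c - 1) choose (a - 2 * c)"
    have "word_act (\<Sum>c = 0..a div 2. Poly_Mapping.single [a + b - c, c] (of_nat (?c c))) p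
        \<asymp> (\<Sum>c = 0..a div 2. of_bit (of_nat (?c c)) * sqs [a + b - c, c] p)"
      unfolding word_act_single[symmetric] by (rule word_act_sum_left)
    also have "\<dots> \<asymp> (\<Sum>c = 0..a div 2. of_nat (?c c) * sqs [a + b - c, c] p)"
      by (intro eqv_sum eqv_mult of_bit_of_nat_eqv eqv_refl)
    also have "\<dots> \<asymp> sq a (sq b p)"
      using eqv_sym[OF adem[OF that]] by simp
    finally have "word_act (adem_relation a b) p \<asymp> word_act (Poly_Mapping.single [a, b] 1) p - sq a (sq b p)"
      unfolding adem_relation_def by (intro eqv_trans[OF word_act_diff_left] eqv_diff eqv_refl)
    then show ?thesis by (simp add: word_act_single eqv_zero_iff)
  qed
  ultimately have "steenrod_ideal \<subseteq> ?Ann"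
    unfolding steenrod_ideal_def by (intro ring.genideal_minimal[OF ring_free_sq_algebra]) auto
  then show "f \<in> steenrod_ideal \<Longrightarrow> word_act f p \<in> J" by blast
qed

definition act :: "(nat list \<Rightarrow>\<^sub>0 bit) set \<Rightarrow> ((('v vertex \<Rightarrow>\<^sub>0 nat) \<Rightarrow>\<^sub>0 int) set \<times> bit \<Rightarrow>\<^sub>0 int) set
    \<Rightarrow> ((('v vertex \<Rightarrow>\<^sub>0 nat) \<Rightarrow>\<^sub>0 int) set \<times> bit \<Rightarrow>\<^sub>0 int) set" where
  "act a z = R.\<pi> (word_act (SOME f. f \<in> a) (SOME p. R.\<pi> p = z))"

text \<open>Both choices in \<open>act\<close> are harmless: changing the polynomial is absorbed by
  \<open>word_act_eqv\<close>, and changing the element of the coset adds a member of the Steenrod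
  ideal, which acts by zero modulo \<open>J\<close>.\<close>

lemma act_coset: "act (steenrod_ideal +>\<^bsub>free_sq_algebra\<^esub> f) (R.\<pi> p) = R.\<pi> (word_act f p)"
proof -
  interpret I: ideal steenrod_ideal free_sq_algebra by (rule ideal_steenrod_ideal)
  let ?g = "SOME g. g \<in> steenrod_ideal +>\<^bsub>free_sq_algebra\<^esub> f" and ?q = "SOME q. R.\<pi> q = R.\<pi> p"
  have "f \<in> steenrod_ideal +>\<^bsub>free_sq_algebra\<^esub> f"
    by (rule I.a_rcos_self) simp
  then have "?g \<in> steenrod_ideal +>\<^bsub>free_sq_algebra\<^esub> f" by (rule someI)
  then obtain i where i: "i \<in> steenrod_ideal" "?g = i + f"
    by (auto simp: a_r_coset_def' add_monoid_ring)
  have "R.\<pi> ?q = R.\<pi> p" by (rule someI[of _ p]) simp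
  then have q: "?q \<asymp> p" by (simp add: R.\<pi>_eq_iff)
  have "word_act ?g ?q \<asymp> word_act ?g p" by (rule word_act_eqv[OF q])
  also have "\<dots> \<asymp> word_act i p + word_act f p"
    unfolding i(2) by (rule word_act_add_left)
  also have "\<dots> \<asymp> word_act f p"
    using steenrod_ideal_word_act_mem[OF i(1)] by (simp add: eqv_def)
  finally show ?thesis
    unfolding act_def by (simp only: R.\<pi>_eq_iff)
qed

lemma act_Sq: "act (Sq k) (R.\<pi> p) = R.\<pi> (sq k p)"
  by (simp add: Sq_def act_coset word_act_single)

lemma homogeneous_word_act:
  assumes "\<And>w. w \<in> Poly_Mapping.keys f \<Longrightarrow> sum_list w = k" "homogeneous A_degree d p"
  shows "homogeneous A_degree (k + d) (word_act f p)"
  unfolding word_act_def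
proof (rule homogeneous_sum)
  fix w assume "w \<in> Poly_Mapping.keys f"
  then have "homogeneous A_degree (k + d) (sqs w p)"
    using homogeneous_sqs[OF assms(2), of w] assms(1) by simp
  then show "homogeneous A_degree (k + d) (of_bit (Poly_Mapping.lookup f w) * sqs w p)"
    by (cases "Poly_Mapping.lookup f w") simp_all
qed

lemma \<pi>_sum:
  assumes "finite S"
  shows "R.\<pi> (sum f S) = finsum (A_mod_2 n V L) (\<lambda>i. R.\<pi> (f i)) S"
proof -
  interpret M: cring "A_mod_2 n V L" unfolding R.M_eq by (rule R.Q.cring_axioms)
  show ?thesis
    using assms
    by (induction S rule: finite_induct) (simp_all add: R.\<pi>_zero R.\<pi>_add R.\<pi>_closed)
qed

text \<open>Each axiom is pulled back along the surjections from polynomials and from the free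
  algebra, where it is already known, exactly or modulo \<open>J\<close>.\<close>

lemma steenrod_action: "steenrod_action (A_mod_2 n V L) (A_mod_2_component n V L) act"
proof -
  let ?M = "A_mod_2 n V L" and ?cl = "\<lambda>f. steenrod_ideal +>\<^bsub>free_sq_algebra\<^esub> f"
  interpret M: cring ?M unfolding R.M_eq by (rule R.Q.cring_axioms)
  interpret S: ring steenrod_algebra by (rule ring_steenrod_algebra)
  note hom = steenrod_coset_ring_hom
  have cl_add: "?cl f \<oplus>\<^bsub>steenrod_algebra\<^esub> ?cl g = ?cl (f + g)" for f g
    using ring_hom_add[OF hom, of f g] by (simp add: add_monoid_ring)
  have cl_mult: "?cl f \<otimes>\<^bsub>steenrod_algebra\<^esub> ?cl g = ?cl (f \<otimes>\<^bsub>free_sq_algebra\<^esub> g)" for f g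
    using ring_hom_mult[OF hom, of f g] by simp
  have cl_one: "\<one>\<^bsub>steenrod_algebra\<^esub> = ?cl (Poly_Mapping.single [] 1)"
    using ring_hom_one[OF hom] by (simp add: one_monoid_ring sq_words_def)
  have M: "\<exists>p. z = R.\<pi> p" if "z \<in> carrier ?M" for z
    using R.\<pi>_surj[OF that] .
  show ?thesis
  proof (intro steenrod_action.intro left_module.intro left_module_axioms.intro steenrod_action_axioms.intro)
    show "cring ?M" "ring steenrod_algebra" "abelian_group ?M"
      by unfold_locales
  next
    fix a z assume "a \<in> carrier steenrod_algebra" "z \<in> carrier ?M"
    then show "act a z \<in> carrier ?M"
      using steenrod_coset_surj M by (metis act_coset R.\<pi>_closed)
  next
    fix a b z assume "a \<in> carrier steenrod_algebra" "b \<in> carrier steenrod_algebra" "z \<in> carrier ?M"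
    then obtain f g p where [simp]: "a = ?cl f" "b = ?cl g" "z = R.\<pi> p"
      using steenrod_coset_surj M by meson
    have "R.\<pi> (word_act (f + g) p) = R.\<pi> (word_act f p + word_act g p)"
      by (rule R.\<pi>_cong[OF word_act_add_left])
    then show "act (a \<oplus>\<^bsub>steenrod_algebra\<^esub> b) z = act a z \<oplus>\<^bsub>?M\<^esub> act b z"
      by (simp add: cl_add act_coset R.\<pi>_add)
    have "R.\<pi> (word_act (f \<otimes>\<^bsub>free_sq_algebra\<^esub> g) p) = R.\<pi> (word_act f (word_act g p))"
      by (rule R.\<pi>_cong[OF word_act_mult])
    then show "act (a \<otimes>\<^bsub>steenrod_algebra\<^esub> b) z = act a (act b z)"
      by (simp add: cl_mult act_coset)
  next
    fix a y z assume "a \<in> carrier steenrod_algebra" "y \<in> carrier ?M" "z \<in> carrier ?M"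
    then obtain f p q where [simp]: "a = ?cl f" "y = R.\<pi> p" "z = R.\<pi> q"
      using steenrod_coset_surj M by meson
    show "act a (y \<oplus>\<^bsub>?M\<^esub> z) = act a y \<oplus>\<^bsub>?M\<^esub> act a z"
      by (simp add: act_coset word_act_add_right flip: R.\<pi>_add)
  next
    fix z assume "z \<in> carrier ?M"
    then obtain p where "z = R.\<pi> p" using M by blast
    then show "act \<one>\<^bsub>steenrod_algebra\<^esub> z = z"
      by (simp add: cl_one act_coset word_act_single)
  next
    fix a k z d assume "a \<in> steenrod_component k" "z \<in> A_mod_2_component n V L d"
    then show "act a z \<in> A_mod_2_component n V L (k + d)"
      by (auto simp: steenrod_component_def R.component_eq act_coset intro!: imageI homogeneous_word_act)
  next
    fix y z k assume "y \<in> carrier ?M" "z \<in> carrier ?M"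
    then obtain p q where [simp]: "y = R.\<pi> p" "z = R.\<pi> q"
      using M by meson
    have "act (Sq k) (y \<otimes>\<^bsub>?M\<^esub> z) = R.\<pi> (\<Sum>i\<in>{0..k}. sq i p * sq (k - i) q)"
      by (simp add: act_Sq sq_mult atMost_atLeast0 flip: R.\<pi>_mult)
    also have "\<dots> = (\<Oplus>\<^bsub>?M\<^esub>i\<in>{0..k}. act (Sq i) y \<otimes>\<^bsub>?M\<^esub> act (Sq (k - i)) z)"
      by (simp add: \<pi>_sum act_Sq R.\<pi>_mult)
    finally show "act (Sq k) (y \<otimes>\<^bsub>?M\<^esub> z) = \<dots>" .
  next
    fix z d assume "z \<in> A_mod_2_component n V L d"
    then obtain p where p: "homogeneous A_degree d p" "z = R.\<pi> p"
      by (auto simp: R.component_eq)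
    then show "act (Sq d) z = z \<otimes>\<^bsub>?M\<^esub> z"
      using R.\<pi>_cong[OF sq_degree[OF p(1)]] by (simp add: act_Sq R.\<pi>_mult)
    show "act (Sq k) z = \<zero>\<^bsub>?M\<^esub>" if "d < k" for k
      using p that by (simp add: act_Sq sq_above_degree R.\<pi>_zero)
  qed
qed

end

theorem theorem1p4:
  fixes n :: nat and V :: "'v set" and L :: "'v set set"
  assumes "simplicial_complex_on V L"
    and "finite V"
    and "span_chromatic_number TYPE(bit) V (skeleton_edges L) \<le> enat n"
  shows "\<exists>act. steenrod_action (A_mod_2 n V L) (A_mod_2_component n V L) act"
proof -
  obtain F G where "span_data n V L F G" using ex_span_data[OF assms] by blast
  then show ?thesis by (intro exI) (rule span_data.steenrod_action)
qed

end
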